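(* (1) The finite spectrum on four real letters equals the finite spectrum on four integer letters. For each integer $L\ge4$, every finite value $g(T)<L$ of a four-element real alphabet $T$ is realized (as $g(T')$) by a primitive four-element integer alphabet $T'$ of diameter at most $\lfloor L/2\rfloor(\lfloor L/2\rfloor+1)$. (2) For every $m\ge2$ the finite spectrum on $m$ real letters equals the finite spectrum on $m$ integer letters, and for each integer $L\ge4$ every finite value $g(T)<L$ of an $m$-element real alphabet $T$ is realized by a primitive $m$-element integer alphabet of diameter at most $H_m(\lfloor L/2\rfloor)$. For $m=5$ this bound equals $\lfloor L/2\rfloor^2(\lfloor L/2\rfloor+1)$, and for $m\ge5$ it is at most $\sum_{j=2}^{m-2}\lfloor L/2\rfloor^j$.
   Context: A word over a finite set $T$ of real numbers (an alphabet) is a finite sequence of its elements. An additive square is a factor consisting of two adjacent nonempty blocks of equal length and equal sum; a word is additive-square-free if it has no such (contiguous) factor. $g(T)=\sup\{|W|: W$ is an additive-square-free word over $T\}$, with $g(T)=\infty$ if these lengths are unbounded. The finite spectrum on $m$ real (respectively integer) letters is the set of finite values of $g(T)$ over $m$-element sets $T$ of reals (respectively integers). An integer alphabet is primitive if, after translating its smallest letter to $0$, the gcd of its letters is $1$; its diameter is its largest minus its smallest letter. For integer $q\ge1$ and a strictly increasing real tuple $T=(t_0<\cdots<t_{m-1})$, an order-preserving integer $q$-model is a strictly increasing integer tuple $(s_0<\cdots<s_{m-1})$ such that for every $1\le h\le q$ and all index lists (repetitions allowed), $\sum_{\nu=1}^h t_{i_\nu}=\sum_{\nu=1}^h t_{j_\nu}$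 if and only if $\sum_{\nu=1}^h s_{i_\nu}=\sum_{\nu=1}^h s_{j_\nu}$. $H_m(q)$ is the least integer $D$ such that every such real $m$-tuple has an order-preserving integer $q$-model of diameter at most $D$. *)

theory Defs
  imports Complex_Main "HOL-Library.Sublist" "HOL-Library.Extended_Nat"
begin

definition additive_square :: "'a::monoid_add list \<Rightarrow> bool" where
  "additive_square w \<longleftrightarrow>
     (\<exists>u v. w = u @ v \<and> u \<noteq> [] \<and> length u = length v \<and> sum_list u = sum_list v)"

definition additive_square_free :: "'a::monoid_add list \<Rightarrow> bool" where
  "additive_square_free w \<longleftrightarrow> (\<forall>x. sublist x w \<longrightarrow> \<not> additive_square x)"

text \<open>The quantity $g(T)$; the value \<open>\<infinity>\<close> means that the lengths are unbounded.\<close>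

definition asf_length :: "'a::monoid_add set \<Rightarrow> enat" where
  "asf_length T = (SUP w \<in> {w. set w \<subseteq> T \<and> additive_square_free w}. enat (length w))"

definition real_finite_spectrum :: "nat \<Rightarrow> nat set" where
  "real_finite_spectrum m =
     {n. \<exists>T::real set. finite T \<and> card T = m \<and> asf_length T = enat n}"

definition int_finite_spectrum :: "nat \<Rightarrow> nat set" where
  "int_finite_spectrum m =
     {n. \<exists>T::int set. finite T \<and> card T = m \<and> asf_length T = enat n}"

definition primitive_alphabet :: "int set \<Rightarrow> bool" where
  "primitive_alphabet T \<longleftrightarrow> Gcd ((\<lambda>t. t - Min T) ` T) = 1"

definition diameter_alphabet :: "int set \<Rightarrow> int" where
  "diameter_alphabet T = Max T - Min T"

text \<open>Tuples are lists, indexed from \<open>0\<close>; \<open>is\<close> and \<open>js\<close> are index lists of length \<open>h\<close>.\<close>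

definition order_preserving_model :: "nat \<Rightarrow> real list \<Rightarrow> int list \<Rightarrow> bool" where
  "order_preserving_model q t s \<longleftrightarrow>
     length s = length t \<and> sorted_wrt (<) s \<and>
     (\<forall>h is js. 1 \<le> h \<and> h \<le> q \<and> length is = h \<and> length js = h \<and>
        set is \<subseteq> {..<length t} \<and> set js \<subseteq> {..<length t} \<longrightarrow>
        ((\<Sum>i\<leftarrow>is. t ! i) = (\<Sum>j\<leftarrow>js. t ! j) \<longleftrightarrow> (\<Sum>i\<leftarrow>is. s ! i) = (\<Sum>j\<leftarrow>js. s ! j)))"

text \<open>The least integer $H_m(q)$. Since diameters are nonnegative, for $m \ge 1$ only
  natural numbers can qualify, so the minimum is taken over \<open>nat\<close>.\<close>

definition H :: "nat \<Rightarrow> nat \<Rightarrow> nat" where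
  "H m q = (LEAST D. \<forall>t::real list. length t = m \<and> sorted_wrt (<) t \<longrightarrow>
     (\<exists>s. order_preserving_model q t s \<and> diameter_alphabet (set s) \<le> int D))"

end

theory Submission imports Defs "Jordan_Normal_Form.Determinant" begin

text \<open>Words of length at most \<open>L\<close> only involve squares with blocks of length at most \<open>q = L div 2\<close>, so
  passing to a \<open>q\<close>-model preserves every value \<open>g(T) < L\<close>, and everything reduces to small models.

  The relations of length at most \<open>q\<close> that hold for \<open>t\<close> cut out a subspace, and the other relations cut
  the cone of increasing tuples in it into chambers. An extreme ray of a chamber of \<open>m\<close>-tuples is
  spanned by an integer vector of diameter at most \<open>q ^ (m - 2)\<close>: by Cramer's rule this is a
  determinant whose rows are sums of at most \<open>q\<close> differences of unit vectors, hence, by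
  multilinearity and unimodularity of network matrices, it is at most the product of the row lengths.
  On a facet of the cone letters merge; a model of such a degenerate tuple plus an extreme ray of an
  adjacent chamber is a model of \<open>t\<close>, which gives \<open>H m q \<le> H (m - 1) q + q ^ (m - 2)\<close>.

  This starts the recursion only one step too high, so that four letters without relations, and five
  letters with at most one relation up to multiples, need explicit constructions. For the lower bound
  on \<open>H 5 q\<close>, a relation \<open>q x = (q - 1) y + z\<close> between letters multiplies the diameter by \<open>q\<close>.\<close>

text \<open>Unrolled down to two letters, the recursion costs 1 + q + ... + q^(n-1) for n gaps,
  while four letters allow only q + q^2 and five only q^2 + q^3. A step to a facet lowers the
  dimension of the kernel modulo constants; if this is at most two, one step reaches a tuple fixed
  by its relations, and only the two highest powers are paid. Left over are tuples with too few
  independent relations. Without any, the gaps are chosen by base \<open>q\<close> digits. For five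
  letters with one relation \<open>S\<close>, gaps are sought at which every relation of length at
  most \<open>q\<close> that holds is a multiple of \<open>S\<close>. One gap may be closed if the
  others sum to at most q^2, because the lift adds q^3. A primitive integer solution of
  \<open>S\<close> on three gaps, with sum above q (q - 1), works if these coefficients of
  \<open>S\<close> have both signs and differ by at most q - 1: the cross product of
  \<open>S\<close> with another relation is an integer multiple of the solution, and its coordinate
  sum is too small for a nonzero one. Apart from relations with two zero coefficients, only the few
  families of \<open>extremal_pattern\<close> escape, where two coefficients differ by exactly q;
  they get explicit gaps.\<close>

section \<open>Relations between letters\<close>

text \<open>A pair of index lists of equal length is encoded as the list of the pairs of their entries.\<close>

definition rel_val :: "(nat \<times> nat) list \<Rightarrow> (nat \<Rightarrow> 'a::ab_group_add) \<Rightarrow> 'a" where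
  "rel_val ps x = (\<Sum>(i, j)\<leftarrow>ps. x i - x j)"

definition rels :: "nat \<Rightarrow> nat \<Rightarrow> (nat \<times> nat) list set" where
  "rels m q = {ps. length ps \<le> q \<and> set ps \<subseteq> {..<m} \<times> {..<m}}"

lemma rel_val_Nil [simp]: "rel_val [] x = 0"
  by (simp add: rel_val_def)

lemma rel_val_Cons [simp]: "rel_val (p # ps) x = x (fst p) - x (snd p) + rel_val ps x"
  by (simp add: rel_val_def case_prod_beta)

lemma rel_val_add: "rel_val ps (\<lambda>i. x i + y i) = rel_val ps x + rel_val ps y"
  by (induction ps) auto

lemma rel_val_diff: "rel_val ps (\<lambda>i. x i - y i) = rel_val ps x - rel_val ps y"
  by (induction ps) auto

lemma rel_val_scale: "rel_val ps (\<lambda>i. c * x i) = (c::'a::comm_ring) * rel_val ps x"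
  by (induction ps) (auto simp: algebra_simps)

lemma rel_val_of_int: "rel_val ps (\<lambda>i. of_int (x i)) = (of_int (rel_val ps x) :: 'a::ring_1)"
  by (induction ps) auto

lemma rel_val_map: "rel_val (map (map_prod f f) ps) x = rel_val ps (\<lambda>i. x (f i))"
  by (induction ps) auto

lemma rel_val_swap: "rel_val (map prod.swap ps) x = - rel_val ps x"
  by (induction ps) auto

lemma rel_val_sum: "rel_val ps (\<lambda>i. \<Sum>k\<in>A. f k i) = (\<Sum>k\<in>A. rel_val ps (f k))"
  by (induction ps) (auto simp: sum.distrib sum_subtractf)

lemma rel_val_cong:
  assumes "set ps \<subseteq> {..<m} \<times> {..<m}" "\<And>i. i < m \<Longrightarrow> x i = y i"
  shows "rel_val ps x = rel_val ps y"
  using assms(1) by (induction ps) (auto simp: assms(2))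

text \<open>Both sides of a relation have equally many letters, so translations do not change its
  value. Kernels are therefore always considered modulo constant tuples.\<close>

lemma rel_val_const:
  assumes "set ps \<subseteq> {..<m} \<times> {..<m}" "\<And>i. i < m \<Longrightarrow> x i = c"
  shows "rel_val ps x = 0"
  using assms(1) by (induction ps) (auto simp: assms(2))

lemma finite_rels [simp]: "finite (rels m q)"
proof -
  have "rels m q = {ps. set ps \<subseteq> {..<m} \<times> {..<m} \<and> length ps \<le> q}"
    by (auto simp: rels_def)
  then show ?thesis
    using finite_lists_length_le[of "{..<m} \<times> {..<m}" q] by simp
qed

lemma swap_rels: "ps \<in> rels m q \<Longrightarrow> map prod.swap ps \<in> rels m q"
  by (auto simp: rels_def)

lemma single_rels: "\<lbrakk>1 \<le> q; i < m; j < m\<rbrakk> \<Longrightarrow> [(i, j)] \<in> rels m q"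
  by (auto simp: rels_def)

section \<open>Determinants of relation matrices and integral kernel vectors\<close>

text \<open>Letters \<open>n\<close> and above are grounded: they have no column in \<open>rel_mat n\<close>.\<close>

definition ind :: "nat \<Rightarrow> nat \<Rightarrow> int" where
  "ind c i = (if i = c then 1 else 0)"

definition rel_mat :: "nat \<Rightarrow> (nat \<Rightarrow> (nat \<times> nat) list) \<Rightarrow> int mat" where
  "rel_mat n R = mat n n (\<lambda>(r, c). rel_val (R r) (ind c))"

lemma rel_mat_carrier [simp]: "rel_mat n R \<in> carrier_mat n n"
  by (simp add: rel_mat_def)

lemma rel_mat_index [simp]:
  "\<lbrakk>r < n; c < n\<rbrakk> \<Longrightarrow> rel_mat n R $$ (r, c) = rel_val (R r) (ind c)"
  by (simp add: rel_mat_def)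

text \<open>Extended by 0 to the grounded letters, the cofactors of row \<open>l\<close> form a
  tuple at which relations can be evaluated.\<close>

definition row_cof :: "nat \<Rightarrow> (nat \<Rightarrow> (nat \<times> nat) list) \<Rightarrow> nat \<Rightarrow> nat \<Rightarrow> int" where
  "row_cof n R l c = (if c < n then cofactor (rel_mat n R) l c else 0)"

lemma mat_delete_row_upd: "mat_delete (rel_mat n (R(l := L))) l c = mat_delete (rel_mat n R) l c"
  by (rule eq_matI) (auto simp: mat_delete_def rel_mat_def)

lemma rel_val_ind_sum:
  "rel_val L (\<lambda>c. if c < n then K c else 0) = (\<Sum>c<n. rel_val L (ind c) * (K c :: int))"
proof -
  have "(\<lambda>c. if c < n then K c else 0) = (\<lambda>i. \<Sum>c<n. K c * ind c i)"
    by (rule ext) (simp add: ind_def if_distrib if_distribR sum.delta cong: if_cong)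
  then show ?thesis
    by (simp add: rel_val_sum rel_val_scale mult.commute)
qed

text \<open>Laplace expansion: the cofactors of row \<open>l\<close> do not depend on that row, so
  the determinant is a linear functional of the relation placed there.\<close>

lemma det_row_upd:
  assumes "l < n"
  shows "det (rel_mat n (R(l := L))) = rel_val L (row_cof n R l)"
proof -
  have "det (rel_mat n (R(l := L))) =
      (\<Sum>c<n. rel_mat n (R(l := L)) $$ (l, c) * cofactor (rel_mat n (R(l := L))) l c)"
    by (rule laplace_expansion_row[OF _ assms]) simp
  also have "\<dots> = (\<Sum>c<n. rel_val L (ind c) * cofactor (rel_mat n R) l c)"
    using assms by (intro sum.cong) (auto simp: cofactor_def mat_delete_row_upd)
  also have "\<dots> = rel_val L (row_cof n R l)"
    unfolding row_cof_def by (rule rel_val_ind_sum[symmetric])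
  finally show ?thesis .
qed

lemma det_rel_mat: "l < n \<Longrightarrow> det (rel_mat n R) = rel_val (R l) (row_cof n R l)"
  using det_row_upd[of l n R "R l"] by simp

text \<open>The value is the determinant of a matrix in which rows \<open>r\<close> and
  \<open>l\<close> coincide.\<close>

lemma rel_val_other_row:
  assumes "l < n" "r < n" "r \<noteq> l"
  shows "rel_val (R r) (row_cof n R l) = 0"
proof -
  let ?A = "rel_mat n (R(l := R r))"
  have "row ?A r = row ?A l"
    using assms by (intro eq_vecI) (auto simp: rel_mat_def)
  then have "det ?A = 0"
    using det_identical_rows[of ?A n r l] assms by simp
  then show ?thesis
    using det_row_upd[OF assms(1)] by simp
qed

text \<open>Adding column \<open>a\<close> to column \<open>b\<close> turns the row of the pair
  \<open>(a, b)\<close> into a unit vector, so up to sign the determinant is the minor at column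
  \<open>a\<close>. That minor is again a relation matrix: \<open>a\<close> has been merged into
  \<open>b\<close>, and \<open>f\<close> renumbers the letters above \<open>a\<close>. If
  \<open>b\<close> is grounded, the row already is a unit vector, and \<open>a\<close> becomes
  grounded.\<close>

lemma minor_relabel:
  assumes "a < Suc k" "b \<noteq> a"
  defines "f \<equiv> \<lambda>i. delete_index a (if i = a then b else i)"
  shows "\<bar>det (rel_mat (Suc k) (R(0 := [(a, b)])))\<bar>
    = \<bar>det (rel_mat k (\<lambda>r. map (map_prod f f) (R (Suc r))))\<bar>"
proof -
  let ?A = "rel_mat (Suc k) (R(0 := [(a, b)]))"
  define A' where "A' = (if b < Suc k then addcol 1 b a ?A else ?A)"
  have A'c: "A' \<in> carrier_mat (Suc k) (Suc k)"
    by (auto simp: A'_def rel_mat_def)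
  have detA: "det A' = det ?A"
    using assms(1,2) det_addcol[of a "Suc k" b ?A 1] by (simp add: A'_def)
  have ent: "A' $$ (r, c) = rel_val ((R(0 := [(a, b)])) r) (\<lambda>i. ind c (if i = a \<and> c \<noteq> a then b else i))"
    if "r < Suc k" "c < Suc k" for r c
  proof (cases "c = b")
    case True
    have "A' $$ (r, c) = rel_val ((R(0 := [(a, b)])) r) (\<lambda>i. ind a i + ind c i)"
      using that True assms(1,2) unfolding rel_val_add by (simp add: A'_def rel_mat_def)
    moreover have "(\<lambda>i. ind a i + ind c i) = (\<lambda>i. ind c (if i = a \<and> c \<noteq> a then b else i))"
      using True assms(2) by (auto simp: ind_def fun_eq_iff)
    ultimately show ?thesis by simp
  next
    case False
    have "A' $$ (r, c) = rel_val ((R(0 := [(a, b)])) r) (ind c)"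
      using that False assms(1,2) by (auto simp: A'_def rel_mat_def)
    moreover have "ind c = (\<lambda>i. ind c (if i = a \<and> c \<noteq> a then b else i))"
      using False assms(2) by (auto simp: ind_def fun_eq_iff)
    ultimately show ?thesis by simp
  qed
  have "det A' = (\<Sum>c<Suc k. A' $$ (0, c) * cofactor A' 0 c)"
    by (rule laplace_expansion_row[OF A'c]) simp
  also have "\<dots> = (\<Sum>c<Suc k. if c = a then cofactor A' 0 c else 0)"
    using assms(2) by (intro sum.cong refl) (auto simp: ent ind_def)
  also have "\<dots> = cofactor A' 0 a"
    using assms(1) by (simp add: sum.delta)
  finally have "\<bar>det A'\<bar> = \<bar>det (mat_delete A' 0 a)\<bar>"
    by (simp add: cofactor_def abs_mult power_abs)
  moreover have "mat_delete A' 0 a = rel_mat k (\<lambda>r. map (map_prod f f) (R (Suc r)))"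
  proof (rule eq_matI)
    fix r c
    assume "r < dim_row (rel_mat k (\<lambda>r. map (map_prod f f) (R (Suc r))))"
      "c < dim_col (rel_mat k (\<lambda>r. map (map_prod f f) (R (Suc r))))"
    then have rc: "r < k" "c < k" by (auto simp: rel_mat_def)
    let ?c = "insert_index a c"
    have c: "?c < Suc k" "?c \<noteq> a" using rc by (auto simp: insert_index_def)
    have "mat_delete A' 0 a $$ (r, c) = A' $$ (Suc r, ?c)"
      using rc A'c by (auto simp: mat_delete_def insert_index_def)
    also have "\<dots> = rel_val (R (Suc r)) (\<lambda>i. ind ?c (if i = a then b else i))"
      using rc c by (subst ent) auto
    also have "(\<lambda>i. ind ?c (if i = a then b else i)) = (\<lambda>i. ind c (f i))"
      using assms(2) by (auto simp: ind_def fun_eq_iff f_def insert_index_def delete_index_def split: if_splits)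
    finally show "mat_delete A' 0 a $$ (r, c)
        = rel_mat k (\<lambda>r. map (map_prod f f) (R (Suc r))) $$ (r, c)"
      using rc by (simp add: rel_mat_def rel_val_map)
  qed (use A'c in \<open>auto simp: rel_mat_def\<close>)
  ultimately show ?thesis using detA by simp
qed

text \<open>Multilinearity splits row 0 into single pairs, and each pair is contracted by
  \<open>minor_relabel\<close>, which keeps the lengths of the other rows. For rows of length 1 this
  is the unimodularity of network matrices.\<close>

lemma det_rel_mat_bound: "\<bar>det (rel_mat n R)\<bar> \<le> (\<Prod>r<n. int (length (R r)))"
proof (induction n arbitrary: R)
  case 0
  then show ?case by (simp add: det_dim_zero[OF rel_mat_carrier])
next
  case (Suc k)
  let ?P = "\<Prod>r<k. int (length (R (Suc r)))"
  have col: "\<bar>det (rel_mat (Suc k) (R(0 := [(a, b)])))\<bar> \<le> ?P" if "a < Suc k" "b \<noteq> a" for a b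
    using Suc.IH[of "\<lambda>r. map (map_prod (\<lambda>i. delete_index a (if i = a then b else i))
      (\<lambda>i. delete_index a (if i = a then b else i))) (R (Suc r))"]
    unfolding minor_relabel[OF that] by simp
  have P0: "0 \<le> ?P" by (simp add: prod_nonneg)
  have pair: "\<bar>row_cof (Suc k) R 0 a - row_cof (Suc k) R 0 b\<bar> \<le> ?P" for a b
  proof (cases "a = b")
    case False
    have e: "det (rel_mat (Suc k) (R(0 := [(c, d)]))) = row_cof (Suc k) R 0 c - row_cof (Suc k) R 0 d" for c d
      by (simp add: det_row_upd)
    show ?thesis
    proof (cases "a < Suc k")
      case True
      then show ?thesis using col[of a b] False e by simp
    next
      case na: False
      show ?thesis
      proof (cases "b < Suc k")
        case True
        then show ?thesis using col[of b a] False e[of b a] by (simp add: abs_minus_commute)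
      next
        case False
        then show ?thesis using na P0 by (simp add: row_cof_def)
      qed
    qed
  qed (use P0 in simp)
  have "\<bar>rel_val L (row_cof (Suc k) R 0)\<bar> \<le> int (length L) * ?P" for L
  proof (induction L)
    case (Cons p L)
    then show ?case using pair[of "fst p" "snd p"] by (simp add: algebra_simps)
  qed simp
  from this[of "R 0"] show ?case
    by (simp add: det_rel_mat[of 0] prod.lessThan_Suc_shift del: prod.lessThan_Suc)
qed

text \<open>Letter \<open>n\<close> is the only grounded letter that occurs; subtracting its value
  turns \<open>x\<close> into a nonzero real kernel vector of the matrix.\<close>

lemma det_zero_of_kernel:
  fixes x :: "nat \<Rightarrow> real"
  assumes R: "\<And>r. r < n \<Longrightarrow> set (R r) \<subseteq> {..<Suc n} \<times> {..<Suc n}"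
    and ker: "\<And>r. r < n \<Longrightarrow> rel_val (R r) x = 0"
    and ne: "k < n" "x k \<noteq> x n"
  shows "det (rel_mat n R) = 0"
proof -
  let ?A = "map_mat real_of_int (rel_mat n R)"
  let ?v = "vec n (\<lambda>i. x i - x n)"
  have "?v \<noteq> 0\<^sub>v n"
    using ne by (auto dest!: arg_cong[where f = "\<lambda>v. v $ k"])
  moreover have "?A *\<^sub>v ?v = 0\<^sub>v n"
  proof (rule eq_vecI)
    fix r assume "r < dim_vec (0\<^sub>v n :: real vec)"
    then have r: "r < n" by simp
    have "(?A *\<^sub>v ?v) $ r = (\<Sum>c<n. real_of_int (rel_val (R r) (ind c)) * (x c - x n))"
      using r by (auto simp: mult_mat_vec_def scalar_prod_def rel_mat_def atLeast0LessThan intro!: sum.cong)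
    also have "\<dots> = (\<Sum>c<n. rel_val (R r) (\<lambda>i. (x c - x n) * real_of_int (ind c i)))"
      by (intro sum.cong refl, subst rel_val_scale, subst rel_val_of_int) (rule mult.commute)
    also have "\<dots> = rel_val (R r) (\<lambda>i. \<Sum>c<n. (x c - x n) * real_of_int (ind c i))"
      by (rule rel_val_sum[symmetric])
    also have "\<dots> = rel_val (R r) (\<lambda>i. x i - x n)"
    proof (rule rel_val_cong[OF R[OF r]])
      fix i assume "i < Suc n"
      then show "(\<Sum>c<n. (x c - x n) * real_of_int (ind c i)) = x i - x n"
        by (cases "i = n") (auto simp: ind_def if_distrib sum.delta' cong: if_cong)
    qed
    also have "\<dots> = 0"
      using ker[OF r] rel_val_const[OF R[OF r], of "\<lambda>i. x n" "x n"] by (simp add: rel_val_diff)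
    finally show "(?A *\<^sub>v ?v) $ r = 0\<^sub>v n $ r" using r by simp
  qed (simp add: rel_mat_def)
  ultimately have "det ?A = 0"
    using det_0_iff_vec_prod_zero_field[of ?A n] by (metis carrier_vec_dim_vec dim_vec map_carrier_mat rel_mat_carrier)
  then show ?thesis
    by simp
qed

text \<open>Cramer's rule for a one-dimensional kernel: exchanging rows of the identity for relations one
  at a time, as the cofactors of a row never lie in the kernel of all the relations, leads to a
  nonsingular system, whose cofactors along the row of \<open>e\<close> are the solution.\<close>

lemma bounded_kernel_vector:
  fixes x :: "nat \<Rightarrow> real"
  assumes n: "0 < n" and A: "A \<subseteq> rels (Suc n) q"
    and e: "set e \<subseteq> {..<Suc n} \<times> {..<Suc n}"
    and xA: "\<And>ps. ps \<in> A \<Longrightarrow> rel_val ps x = 0" and xe: "rel_val e x \<noteq> 0"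
    and triv: "\<And>y :: nat \<Rightarrow> real. \<lbrakk>\<And>ps. ps \<in> A \<Longrightarrow> rel_val ps y = 0; rel_val e y = 0\<rbrakk>
      \<Longrightarrow> \<forall>i<Suc n. y i = y n"
  obtains v :: "nat \<Rightarrow> int" where "\<And>ps. ps \<in> A \<Longrightarrow> rel_val ps v = 0" "rel_val e v \<noteq> 0"
    "\<bar>v 0 - v n\<bar> \<le> int (q ^ (n - 1))"
proof -
  \<comment> \<open>Comparing each letter with the grounded letter \<open>n\<close> gives the
    identity matrix.\<close>
  define R0 where "R0 = (\<lambda>r. [(r, n)] :: (nat \<times> nat) list)"
  have I: "rel_mat n R0 = 1\<^sub>m n"
    by (rule eq_matI) (auto simp: rel_mat_def R0_def ind_def)
  have cofI: "row_cof n R0 l c = (if c < n \<and> c = l then 1 else 0)" if "l < n" for l c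
  proof (cases "c < n")
    case True
    have "adj_mat (rel_mat n R0) = 1\<^sub>m n"
      using adj_mat(1)[OF rel_mat_carrier, of n R0] adj_mat(3)[OF rel_mat_carrier, of n R0]
      by (auto simp: I intro!: eq_matI)
    then have "adj_mat (rel_mat n R0) $$ (c, l) = (1\<^sub>m n :: int mat) $$ (c, l)" by simp
    then show ?thesis using True that by (simp add: adj_mat_def row_cof_def I)
  qed (simp add: row_cof_def)
  \<comment> \<open>A nonzero coefficient of \<open>e\<close> marks a row of the identity that
    \<open>e\<close> can replace while the determinant stays nonzero.\<close>
  obtain l where l: "l < n" "rel_val e (ind l) \<noteq> 0"
  proof -
    have "\<exists>l<n. rel_val e (ind l) \<noteq> 0"
    proof (rule ccontr)
      assume *: "\<not> ?thesis"
      have "rel_val e x = rel_val e (\<lambda>i. x i - x n)"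
        using rel_val_const[OF e, of "\<lambda>i. x n" "x n"] by (simp add: rel_val_diff)
      also have "\<dots> = rel_val e (\<lambda>i. \<Sum>c<n. (x c - x n) * real_of_int (ind c i))"
      proof (rule rel_val_cong[OF e])
        fix i assume "i < Suc n"
        then show "x i - x n = (\<Sum>c<n. (x c - x n) * real_of_int (ind c i))"
          by (cases "i = n") (auto simp: ind_def if_distrib sum.delta' cong: if_cong)
      qed
      also have "\<dots> = 0"
        unfolding rel_val_sum using * by (intro sum.neutral ballI, subst rel_val_scale, subst rel_val_of_int) simp
      finally show False using xe by simp
    qed
    then show ?thesis using that by blast
  qed
  have "\<exists>R. R l = e \<and> (\<forall>r\<in>J. R r \<in> A) \<and> (\<forall>r<n. set (R r) \<subseteq> {..<Suc n} \<times> {..<Suc n}) \<and>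
      det (rel_mat n R) \<noteq> 0" if "finite J" "J \<subseteq> {..<n} - {l}" for J
    using that
  proof (induction J)
    case empty
    have "rel_val e (row_cof n R0 l) = rel_val e (ind l)"
      using l(1) by (intro arg_cong[where f = "rel_val e"] ext) (auto simp: cofI ind_def)
    then have d: "det (rel_mat n (R0(l := e))) \<noteq> 0"
      using l det_row_upd[OF l(1), of R0 e] by simp
    have s: "\<forall>r<n. set ((R0(l := e)) r) \<subseteq> {..<Suc n} \<times> {..<Suc n}"
      using e by (simp add: R0_def)
    show ?case
    proof (intro exI[of _ "R0(l := e)"] conjI)
      show "det (rel_mat n (R0(l := e))) \<noteq> 0" by (rule d)
      show "\<forall>r<n. set ((R0(l := e)) r) \<subseteq> {..<Suc n} \<times> {..<Suc n}" by (rule s)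
    qed simp_all
  next
    case (insert j J)
    have "J \<subseteq> {..<n} - {l}" using insert.prems by simp
    from insert.IH[OF this] obtain R where R: "R l = e" "\<forall>r\<in>J. R r \<in> A"
      "\<forall>r<n. set (R r) \<subseteq> {..<Suc n} \<times> {..<Suc n}" "det (rel_mat n R) \<noteq> 0" by blast
    have j: "j < n" "j \<noteq> l" using insert.prems by auto
    let ?K = "row_cof n R j"
    \<comment> \<open>Otherwise \<open>triv\<close> makes the cofactors of row \<open>j\<close>
      constant, and the determinant, being the value of \<open>R j\<close> at them, would
      vanish.\<close>
    have "\<exists>a\<in>A. rel_val a ?K \<noteq> 0"
    proof (rule ccontr)
      assume *: "\<not> ?thesis"
      have eK: "rel_val e ?K = 0"
        using rel_val_other_row[OF j(1) l(1)] j R(1) by metis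
      have "\<forall>i<Suc n. real_of_int (?K i) = real_of_int (?K n)"
      proof (rule triv)
        fix ps assume "ps \<in> A"
        then show "rel_val ps (\<lambda>i. real_of_int (?K i)) = 0"
          unfolding rel_val_of_int using * by simp
      next
        show "rel_val e (\<lambda>i. real_of_int (?K i)) = 0"
          unfolding rel_val_of_int using eK by simp
      qed
      then have c: "?K i = ?K n" if "i < Suc n" for i
        using that of_int_eq_iff by blast
      have "rel_val (R j) ?K = 0"
        by (rule rel_val_const[OF _ c]) (use R(3) j(1) in blast)
      then show False using R(4) det_rel_mat[OF j(1), of R] by simp
    qed
    then obtain a where a: "a \<in> A" "rel_val a ?K \<noteq> 0" by auto
    then have d: "det (rel_mat n (R(j := a))) \<noteq> 0" using det_row_upd[OF j(1), of R a] by simp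
    show ?case
    proof (intro exI[of _ "R(j := a)"] conjI)
      show "det (rel_mat n (R(j := a))) \<noteq> 0" by (rule d)
      show "\<forall>r<n. set ((R(j := a)) r) \<subseteq> {..<Suc n} \<times> {..<Suc n}"
        using R(3) a(1) A by (auto simp: rels_def)
    qed (use R(1,2) a(1) j in auto)
  qed
  from this[of "{..<n} - {l}"] obtain R where R: "R l = e" "\<And>r. \<lbrakk>r < n; r \<noteq> l\<rbrakk> \<Longrightarrow> R r \<in> A"
    "\<forall>r<n. set (R r) \<subseteq> {..<Suc n} \<times> {..<Suc n}" "det (rel_mat n R) \<noteq> 0" by auto
  define v where "v = row_cof n R l"
  have xne: "\<exists>k<n. x k \<noteq> x n"
  proof (rule ccontr)
    assume "\<not> ?thesis"
    then have c: "x i = x n" if "i < Suc n" for i using that by (cases "i = n") auto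
    have "rel_val e x = 0" by (rule rel_val_const[OF e c])
    then show False using xe by simp
  qed
  show ?thesis
  proof (rule that[of v])
    fix ps assume ps: "ps \<in> A"
    let ?R = "R(l := ps)"
    obtain k where k: "k < n" "x k \<noteq> x n" using xne by blast
    \<comment> \<open>With \<open>ps\<close> in place of \<open>e\<close>, all rows hold at the
      nonconstant \<open>x\<close>.\<close>
    have "det (rel_mat n ?R) = 0"
    proof (rule det_zero_of_kernel[of n ?R x k])
      fix r assume "r < n"
      then show "set (?R r) \<subseteq> {..<Suc n} \<times> {..<Suc n}" "rel_val (?R r) x = 0"
        using R ps A xA by (auto simp: rels_def)
    qed (use k in auto)
    then show "rel_val ps v = 0"
      using det_row_upd[OF l(1), of R ps] by (simp add: v_def)
  next
    show "rel_val e v \<noteq> 0"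
      using R(1,4) det_rel_mat[OF l(1), of R] by (simp add: v_def)
  next
    \<comment> \<open>The diameter is itself a determinant: row \<open>l\<close> becomes a single
      pair, whose length 1 drops out of the product and leaves \<open>n - 1\<close> rows of length
      at most \<open>q\<close>.\<close>
    let ?R = "R(l := [(0, n)])"
    have "v 0 - v n = det (rel_mat n ?R)"
      using det_row_upd[OF l(1), of R "[(0, n)]"] by (simp add: v_def)
    then have "\<bar>v 0 - v n\<bar> \<le> (\<Prod>r<n. int (length (?R r)))"
      using det_rel_mat_bound[of n ?R] by simp
    also have "\<dots> = (\<Prod>r\<in>{..<n} - {l}. int (length (R r)))"
      using l(1) by (subst prod.remove[of _ l]) auto
    also have "\<dots> \<le> (\<Prod>r\<in>{..<n} - {l}. int q)"
    proof (rule prod_mono)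
      fix r assume "r \<in> {..<n} - {l}"
      then have "R r \<in> rels (Suc n) q" using R(2) A by auto
      then show "0 \<le> int (length (R r)) \<and> int (length (R r)) \<le> int q" by (auto simp: rels_def)
    qed
    also have "\<dots> = int (q ^ (n - 1))" using l(1) by simp
    finally show "\<bar>v 0 - v n\<bar> \<le> int (q ^ (n - 1))" .
  qed
qed

text \<open>Here and below \<open>n\<close> counts the gaps, so a tuple has the \<open>Suc n\<close>
  letters with indices \<open>0, ..., n\<close>.\<close>

definition incr :: "nat \<Rightarrow> (nat \<Rightarrow> 'a::order) \<Rightarrow> bool" where
  "incr n x \<longleftrightarrow> (\<forall>i<n. x i < x (Suc i))"

section \<open>Models, facets and chambers\<close>

definition has_model :: "nat \<Rightarrow> nat \<Rightarrow> (nat \<Rightarrow> real) \<Rightarrow> int \<Rightarrow> bool" where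
  "has_model n q t D \<longleftrightarrow> (\<exists>s :: nat \<Rightarrow> int. incr n s \<and>
     (\<forall>ps\<in>rels (Suc n) q. rel_val ps t = 0 \<longleftrightarrow> rel_val ps s = 0) \<and> s n - s 0 \<le> D)"

definition kern :: "nat \<Rightarrow> nat \<Rightarrow> (nat \<Rightarrow> real) \<Rightarrow> (nat \<Rightarrow> real) set" where
  "kern n q t = {y. \<forall>ps\<in>rels (Suc n) q. rel_val ps t = 0 \<longrightarrow> rel_val ps y = 0}"

lemma has_model_mono: "has_model n q t D \<Longrightarrow> D \<le> D' \<Longrightarrow> has_model n q t D'"
  unfolding has_model_def by (meson order_trans)

lemma kern_comb: "\<lbrakk>y \<in> kern n q t; z \<in> kern n q t\<rbrakk> \<Longrightarrow> (\<lambda>i. a * y i + b * z i) \<in> kern n q t"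
  by (auto simp: kern_def rel_val_add rel_val_scale)

lemma self_kern: "t \<in> kern n q t"
  by (auto simp: kern_def)

lemma const_of_gaps:
  assumes "\<And>i. i < n \<Longrightarrow> y (Suc i) = (y i :: 'a)"
  shows "i \<le> n \<Longrightarrow> y i = y 0"
  by (induction i) (auto simp: assms)

text \<open>A chamber of the arrangement of the remaining relations in \<open>kern n q t\<close> has \<open>u\<close> in the facet
  spanned by its points with vanishing \<open>j\<close>-th gap. A vertex \<open>y\<close> of the slice of that chamber where
  the \<open>j\<close>-th gap is 1 spans an extreme ray off this facet, and adding the integer vector on this ray
  to \<open>u\<close> leads into the interior of the chamber.\<close>

lemma facet_lift:
  fixes t :: "nat \<Rightarrow> real" and u :: "nat \<Rightarrow> int"
  assumes q: "1 \<le> q" and incr: "incr n t"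
    and uV: "\<And>ps. \<lbrakk>ps \<in> rels (Suc n) q; rel_val ps t = 0\<rbrakk> \<Longrightarrow> rel_val ps u = 0"
    and u: "\<And>i. i < n \<Longrightarrow> u i \<le> u (Suc i)"
    and j: "j < n" "u (Suc j) = u j"
    \<comment> \<open>This says that \<open>u\<close> is generic in its facet: on the kernel, a
      relation that holds at \<open>u\<close> is a multiple of the \<open>j\<close>-th gap.\<close>
    and key: "\<And>ps y. \<lbrakk>ps \<in> rels (Suc n) q; rel_val ps u = 0; y \<in> kern n q t\<rbrakk> \<Longrightarrow>
      rel_val ps y * (t (Suc j) - t j) = rel_val ps t * (y (Suc j) - y j)"
  shows "has_model n q t (u n - u 0 + int (q ^ (n - 1)))"
proof -
  have t: "t i < t (Suc i)" if "i < n" for i using incr that by (simp add: incr_def)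
  define e where "e = [(Suc j, j)]"
  have e: "rel_val e y = y (Suc j) - y j" for y :: "nat \<Rightarrow> 'b::ab_group_add"
    by (simp add: e_def)
  have e_sub: "set e \<subseteq> {..<Suc n} \<times> {..<Suc n}" using j by (simp add: e_def)
  \<comment> \<open>\<open>P\<close> records the signs that cut out the chamber; a relation that is
    negative at \<open>u\<close> enters through its swapped version.\<close>
  define P where "P = {ps \<in> rels (Suc n) q. rel_val ps u > 0}"
  have finP: "finite P" by (simp add: P_def)
  define feas where "feas = {y \<in> kern n q t. rel_val e y = 1 \<and> (\<forall>ps\<in>P. 0 \<le> rel_val ps y)}"
  define tight where "tight = (\<lambda>y :: nat \<Rightarrow> real. {ps \<in> P. rel_val ps y = 0})"
  have gap: "[(Suc i, i)] \<in> rels (Suc n) q" if "i < n" for i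
    using that q by (intro single_rels) auto
  have et: "rel_val e t > 0" using t[OF j(1)] by (simp add: e)
  have uK: "(\<lambda>i. real_of_int (u i)) \<in> kern n q t"
    using uV by (auto simp: kern_def rel_val_of_int)
  have "feas \<noteq> {}"
  proof -
    \<comment> \<open>Relations in \<open>P\<close> are at least 1 at the integer point
      \<open>u\<close>, and \<open>K\<close> bounds every value at \<open>t\<close>. So
      \<open>K\<close> times \<open>u\<close> plus \<open>t\<close> lies in the chamber, and
      dividing by the gap of \<open>t\<close> brings it into the slice.\<close>
    define K where "K = (\<Sum>ps\<in>rels (Suc n) q. \<bar>rel_val ps t\<bar>)"
    define y where "y = (\<lambda>i. (K / rel_val e t) * real_of_int (u i) + (1 / rel_val e t) * t i)"
    have y: "rel_val ps y = (K * real_of_int (rel_val ps u) + rel_val ps t) / rel_val e t" for ps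
      unfolding y_def rel_val_add rel_val_scale rel_val_of_int by (simp add: add_divide_distrib)
    have "y \<in> kern n q t" unfolding y_def by (rule kern_comb[OF uK self_kern])
    moreover have "rel_val e u = 0" using j by (simp add: e)
    then have "rel_val e y = 1" using et by (simp add: y)
    moreover have "0 \<le> rel_val ps y" if "ps \<in> P" for ps
    proof -
      have "\<bar>rel_val ps t\<bar> \<le> K"
        unfolding K_def using that by (intro member_le_sum[of ps _ "\<lambda>ps. \<bar>rel_val ps t\<bar>"]) (auto simp: P_def)
      moreover have "1 \<le> real_of_int (rel_val ps u)" using that by (simp add: P_def)
      then have "K * 1 \<le> K * real_of_int (rel_val ps u)"
        by (intro mult_left_mono) (auto simp: K_def sum_nonneg)
      ultimately show ?thesis using et by (simp add: y)
    qed
    ultimately show ?thesis by (auto simp: feas_def)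
  qed
  \<comment> \<open>A vertex is found as a feasible point with the most tight constraints.\<close>
  then obtain y where y: "y \<in> feas" and ymax: "\<And>z. z \<in> feas \<Longrightarrow> card (tight z) \<le> card (tight y)"
    using ex_has_greatest_nat[of "\<lambda>y. y \<in> feas" _ "\<lambda>y. card (tight y)" "Suc (card P)"]
    by (metis (no_types, lifting) all_not_in_conv card_mono finP le_imp_less_Suc mem_Collect_eq subsetI tight_def)
  have yK: "y \<in> kern n q t" and ye: "rel_val e y = 1" and yP: "\<And>ps. ps \<in> P \<Longrightarrow> 0 \<le> rel_val ps y"
    using y by (auto simp: feas_def)
  define A where "A = {ps \<in> rels (Suc n) q. rel_val ps t = 0} \<union> tight y"
  \<comment> \<open>A nonconstant direction \<open>w\<close> along the tight constraints could be
    followed, in one of its two senses, until a further constraint becomes tight, against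
    maximality.\<close>
  have triv: "\<forall>i<Suc n. w i = w n" if wA: "\<And>ps. ps \<in> A \<Longrightarrow> rel_val ps w = 0" and we: "rel_val e w = 0"
    for w :: "nat \<Rightarrow> real"
  proof (rule ccontr)
    assume nc: "\<not> ?thesis"
    have wK: "w \<in> kern n q t" using wA by (auto simp: kern_def A_def)
    \<comment> \<open>By \<open>key\<close>, the gaps that vanish at \<open>u\<close> vanish on
      \<open>w\<close>; all other gaps are in \<open>P\<close>. So if \<open>P\<close> vanished on
      \<open>w\<close>, then \<open>w\<close> would be constant.\<close>
    have "\<exists>ps\<in>P. rel_val ps w \<noteq> 0"
    proof (rule ccontr)
      assume *: "\<not> ?thesis"
      have "w (Suc i) = w i" if i: "i < n" for i
      proof (cases "u (Suc i) = u i")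
        case True
        then have "rel_val [(Suc i, i)] u = 0" by simp
        from key[OF gap[OF i] this wK] show ?thesis using et we by (simp add: e)
      next
        case False
        then have "[(Suc i, i)] \<in> P" using u[OF i] gap[OF i] by (simp add: P_def)
        then show ?thesis using * by fastforce
      qed
      from const_of_gaps[of n w, OF this] have "w i = w 0" if "i \<le> n" for i using that by blast
      then have "w i = w n" if "i < Suc n" for i
        using that by (metis le_refl less_Suc_eq_le)
      then show False using nc by blast
    qed
    then obtain w' where w': "w' \<in> kern n q t" "rel_val e w' = 0" "\<And>ps. ps \<in> tight y \<Longrightarrow> rel_val ps w' = 0"
      "\<exists>ps\<in>P. rel_val ps w' < 0"
    proof -
      obtain ps where ps: "ps \<in> P" "rel_val ps w \<noteq> 0" using \<open>\<exists>ps\<in>P. rel_val ps w \<noteq> 0\<close> by blast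
      have tw: "\<And>ps. ps \<in> tight y \<Longrightarrow> rel_val ps w = 0" using wA by (simp add: A_def)
      show ?thesis
      proof (cases "rel_val ps w < 0")
        case True
        then show ?thesis using that[of w] wK we tw ps by blast
      next
        case False
        have m: "rel_val qs (\<lambda>i. - 1 * w i + 0 * w i) = - rel_val qs w" for qs
          unfolding rel_val_add rel_val_scale by simp
        have n: "rel_val qs (\<lambda>i. - 1 * w i + 0 * w i) = 0" if "rel_val qs w = 0" for qs
          unfolding m using that by simp
        show ?thesis
        proof (rule that[of "\<lambda>i. - 1 * w i + 0 * w i"])
          show "(\<lambda>i. - 1 * w i + 0 * w i) \<in> kern n q t" by (rule kern_comb[OF wK wK])
          show "\<exists>ps\<in>P. rel_val ps (\<lambda>i. - 1 * w i + 0 * w i) < 0"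
            unfolding m using ps False by (intro bexI[of _ ps]) auto
        qed (use n we tw in blast)+
      qed
    qed
    define N where "N = {ps \<in> P. rel_val ps w' < 0}"
    define r where "r = (\<lambda>ps. rel_val ps y / - rel_val ps w')"
    have "finite N" "N \<noteq> {}" using finP w'(4) by (auto simp: N_def)
    then obtain p where p: "p \<in> N" and pmin: "\<And>ps. ps \<in> N \<Longrightarrow> r p \<le> r ps"
      using ex_min_if_finite[of "r ` N"] by (metis (no_types, lifting) finite_imageI imageE image_eqI image_is_empty linorder_not_le)
    define y' where "y' = (\<lambda>i. 1 * y i + r p * w' i)"
    have y': "rel_val ps y' = rel_val ps y + r p * rel_val ps w'" for ps
      unfolding y'_def rel_val_add rel_val_scale by simp
    have rp: "0 \<le> r p" using p yP[of p] by (auto simp: r_def N_def divide_nonneg_neg)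
    have "y' \<in> feas"
    proof -
      have "y' \<in> kern n q t" unfolding y'_def by (rule kern_comb[OF yK w'(1)])
      moreover have "rel_val e y' = 1" using ye w'(2) by (simp add: y')
      moreover have "0 \<le> rel_val ps y'" if ps: "ps \<in> P" for ps
      proof (cases "ps \<in> N")
        case True
        then have "r p * (- rel_val ps w') \<le> r ps * (- rel_val ps w')"
          using pmin[OF True] by (intro mult_right_mono) (auto simp: N_def)
        also have "\<dots> = rel_val ps y" using True by (simp add: r_def N_def)
        finally show ?thesis by (simp add: y')
      next
        case False
        then show ?thesis using ps rp yP[OF ps] by (simp add: y' N_def)
      qed
      ultimately show ?thesis by (simp add: feas_def)
    qed
    moreover have "card (tight y) < card (tight y')"
    proof (rule psubset_card_mono)
      have "tight y \<subseteq> tight y'" using w'(3) by (auto simp: tight_def y')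
      moreover have "p \<in> tight y'" using p by (auto simp: tight_def N_def y' r_def)
      moreover have "p \<notin> tight y" using p w'(3)[of p] by (auto simp: N_def)
      ultimately show "tight y \<subset> tight y'" by blast
    qed (simp add: tight_def finP)
    ultimately show False using ymax[of y'] by simp
  qed
  have n0: "0 < n" using j by simp
  have A: "A \<subseteq> rels (Suc n) q" by (auto simp: A_def tight_def P_def)
  have yA: "rel_val ps y = 0" if "ps \<in> A" for ps using that yK by (auto simp: A_def tight_def kern_def)
  have ye0: "rel_val e y \<noteq> 0" using ye by simp
  obtain v0 where v0: "\<And>ps. ps \<in> A \<Longrightarrow> rel_val ps v0 = 0" "rel_val e v0 \<noteq> 0"
    "\<bar>v0 0 - v0 n\<bar> \<le> int (q ^ (n - 1))"
    using bounded_kernel_vector[OF n0 A e_sub yA ye0 triv] by blast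
  define v where "v = (\<lambda>i. sgn (rel_val e v0) * v0 i)"
  have v: "rel_val ps v = sgn (rel_val e v0) * rel_val ps v0" for ps
    unfolding v_def by (rule rel_val_scale)
  have ev: "rel_val e v > 0" using v0(2) by (simp add: v sgn_mult_self_eq mult.commute[of "sgn _"])
    (simp add: linorder_not_le mult_sgn_abs zero_less_mult_iff sgn_if)
  have vn: "v n - v 0 \<le> int (q ^ (n - 1))"
    using v0(3) by (auto simp: v_def sgn_if)
  \<comment> \<open>By \<open>triv\<close> the kernel of \<open>A\<close> is a line modulo
    constants, so on every relation the integer vector is the same multiple of the vertex.\<close>
  have vy: "real_of_int (rel_val ps v) = real_of_int (rel_val e v) * rel_val ps y" if ps: "ps \<in> rels (Suc n) q" for ps
  proof -
    define w where "w = (\<lambda>i. real_of_int (v i) - real_of_int (rel_val e v) * y i)"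
    have w: "rel_val ps w = real_of_int (rel_val ps v) - real_of_int (rel_val e v) * rel_val ps y" for ps
      unfolding w_def rel_val_diff rel_val_scale rel_val_of_int by simp
    have c: "\<forall>i<Suc n. w i = w n"
    proof (rule triv)
      fix ps assume "ps \<in> A"
      then show "rel_val ps w = 0" using v0(1) yA by (simp add: w v)
    qed (simp add: w ye)
    have "rel_val ps w = 0"
    proof (rule rel_val_const)
      show "set ps \<subseteq> {..<Suc n} \<times> {..<Suc n}" using ps by (simp add: rels_def)
      show "w i = w n" if "i < Suc n" for i using c that by blast
    qed
    then show ?thesis by (simp add: w)
  qed
  have vpos: "rel_val ps v \<ge> 0" if "ps \<in> P" for ps
  proof -
    have "real_of_int (rel_val ps v) \<ge> 0"
      using that vy[of ps] yP[OF that] ev by (simp add: P_def)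
    then show ?thesis by simp
  qed
  \<comment> \<open>Where \<open>u\<close> is nonzero, \<open>v\<close> does not have the opposite
    sign, so nothing cancels. Where \<open>u\<close> vanishes, \<open>key\<close> decides through
    the \<open>j\<close>-th gap, which is positive for both \<open>v\<close> and
    \<open>t\<close>.\<close>
  define s where "s = (\<lambda>i. u i + v i)"
  have s: "rel_val ps s = rel_val ps u + rel_val ps v" for ps unfolding s_def by (rule rel_val_add)
  show ?thesis
    unfolding has_model_def incr_def
  proof (intro exI[of _ s] conjI ballI allI impI)
    fix i assume i: "i < n"
    have "rel_val [(Suc i, i)] s > 0"
    proof (cases "u (Suc i) = u i")
      case True
      then have "rel_val [(Suc i, i)] u = 0" by simp
      from key[OF gap[OF i] this yK] have "rel_val [(Suc i, i)] y * rel_val e t = (t (Suc i) - t i) * 1"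
        using ye by (simp add: e)
      also have "\<dots> > 0" using t[OF i] by simp
      finally have "rel_val [(Suc i, i)] y > 0" using et by (simp add: zero_less_mult_iff)
      then have "real_of_int (rel_val [(Suc i, i)] v) > 0"
        unfolding vy[OF gap[OF i]] using ev by simp
      then show ?thesis using True by (simp add: s)
    next
      case False
      then have "[(Suc i, i)] \<in> P" using u[OF i] gap[OF i] by (simp add: P_def)
      then show ?thesis using vpos[of "[(Suc i, i)]"] by (simp add: s P_def)
    qed
    then show "s i < s (Suc i)" by simp
  next
    fix ps assume ps: "ps \<in> rels (Suc n) q"
    show "rel_val ps t = 0 \<longleftrightarrow> rel_val ps s = 0"
    proof
      assume z: "rel_val ps t = 0"
      then have "ps \<in> A" using ps by (simp add: A_def)
      then show "rel_val ps s = 0" using uV[OF ps z] v0(1) by (simp add: s v)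
    next
      assume z: "rel_val ps s = 0"
      have "rel_val ps u = 0"
      proof (cases "rel_val ps u" "0 :: int" rule: linorder_cases)
        case greater
        then have "ps \<in> P" using ps by (simp add: P_def)
        then show ?thesis using vpos[of ps] z greater by (simp add: s)
      next
        case less
        then have "map prod.swap ps \<in> P" using ps by (simp add: P_def rel_val_swap swap_rels)
        then show ?thesis using vpos[of "map prod.swap ps"] z less by (simp add: s rel_val_swap)
      qed
      then have "rel_val ps v = 0" using z by (simp add: s)
      then have "rel_val ps y = 0" using vy[OF ps] ev by simp
      then show "rel_val ps t = 0" using key[OF ps \<open>rel_val ps u = 0\<close> yK] ye by (simp add: e)
    qed
  next
    show "s n - s 0 \<le> u n - u 0 + int (q ^ (n - 1))" using vn by (simp add: s_def)
  qed
qed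

section \<open>Reaching a generic point of a facet, and the recursion\<close>

text \<open>Along \<open>w + c y\<close>, each of the finitely many functionals is either a nonzero
  constant or vanishes for a single \<open>c\<close>.\<close>

lemma avoid_hyperplanes:
  fixes V :: "(nat \<Rightarrow> real) set"
  assumes "finite F" "V \<noteq> {}"
    and V: "\<And>a b y z. \<lbrakk>y \<in> V; z \<in> V\<rbrakk> \<Longrightarrow> (\<lambda>i. a * y i + b * z i) \<in> V"
    and lin: "\<And>f a b y z. f \<in> F \<Longrightarrow> f (\<lambda>i. a * y i + b * z i) = a * f y + b * f z"
    and nz: "\<And>f. f \<in> F \<Longrightarrow> \<exists>y\<in>V. f y \<noteq> (0 :: real)"
  shows "\<exists>w\<in>V. \<forall>f\<in>F. f w \<noteq> 0"
  using assms(1) lin nz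
proof (induction F)
  case empty
  then show ?case using assms(2) by auto
next
  case (insert f F)
  have "\<exists>w\<in>V. \<forall>g\<in>F. g w \<noteq> 0"
    by (rule insert.IH) (use insert.prems in blast)+
  then obtain w where w: "w \<in> V" "\<forall>g\<in>F. g w \<noteq> 0" by blast
  obtain y where y: "y \<in> V" "f y \<noteq> 0" using insert.prems(2) by blast
  have "finite (insert 0 ((\<lambda>g. - g w / g y) ` insert f F))" using insert.hyps by simp
  then obtain c where c: "c \<notin> insert 0 ((\<lambda>g. - g w / g y) ` insert f F)"
    using ex_new_if_finite[OF infinite_UNIV_char_0] by blast
  have "\<forall>g\<in>insert f F. g (\<lambda>i. 1 * w i + c * y i) \<noteq> 0"
  proof
    fix g assume g: "g \<in> insert f F"
    have e: "g (\<lambda>i. 1 * w i + c * y i) = g w + c * g y" using insert.prems(1)[OF g, of 1 w c y] by simp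
    show "g (\<lambda>i. 1 * w i + c * y i) \<noteq> 0"
    proof (cases "g y = 0")
      case True
      then show ?thesis using e g w y by auto
    next
      case False
      have "c \<noteq> - g w / g y" using c g by auto
      then show ?thesis using e False by (simp add: field_simps)
    qed
  qed
  then show ?case using V[OF w(1) y(1), of 1 c] by blast
qed

text \<open>In this case \<open>t\<close> itself spans an extreme ray, and the recursion over facets
  stops.\<close>

definition line_kernel :: "nat \<Rightarrow> nat \<Rightarrow> (nat \<Rightarrow> real) \<Rightarrow> bool" where
  "line_kernel n q t \<longleftrightarrow> (\<forall>y\<in>kern n q t. \<exists>c. \<forall>i\<le>n. y i - y 0 = c * (t i - t 0))"

text \<open>An integer vector in the kernel with nonzero first gap is, up to sign, a positive
  multiple of \<open>t\<close> modulo constants. Hence it is increasing and satisfies exactly the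
  relations of \<open>t\<close>.\<close>

lemma model_line:
  assumes q: "1 \<le> q" and n: "1 \<le> n" and incr: "incr n t"
    and line: "line_kernel n q t"
  shows "has_model n q t (int (q ^ (n - 1)))"
proof -
  have t: "t i < t (Suc i)" if "i < n" for i using incr that by (simp add: incr_def)
  define e where "e = [(1::nat, 0::nat)]"
  have e: "rel_val e y = y 1 - y 0" for y :: "nat \<Rightarrow> 'b::ab_group_add"
    by (simp add: e_def)
  have et: "rel_val e t > 0" using t[of 0] n by (simp add: e)
  let ?A = "{ps \<in> rels (Suc n) q. rel_val ps t = 0}"
  have triv: "\<forall>i<Suc n. w i = w n" if "\<And>ps. ps \<in> ?A \<Longrightarrow> rel_val ps w = 0" "rel_val e w = 0"
    for w :: "nat \<Rightarrow> real"
  proof -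
    have "w \<in> kern n q t" using that(1) by (auto simp: kern_def)
    then obtain c where c: "\<And>i. i \<le> n \<Longrightarrow> w i - w 0 = c * (t i - t 0)"
      using line unfolding line_kernel_def by blast
    have "c * rel_val e t = 0" using c[of 1] n that(2) by (simp add: e)
    then have c0: "c = 0" using et by simp
    have w0: "w i = w 0" if "i \<le> n" for i using c[OF that] c0 by simp
    show ?thesis
    proof (intro allI impI)
      fix i assume "i < Suc n"
      then show "w i = w n" using w0[of i] w0[of n] by linarith
    qed
  qed
  have n0: "0 < n" and e_sub: "set e \<subseteq> {..<Suc n} \<times> {..<Suc n}" using n by (auto simp: e_def)
  have A: "?A \<subseteq> rels (Suc n) q" and tA: "\<And>ps. ps \<in> ?A \<Longrightarrow> rel_val ps t = 0"
    and te: "rel_val e t \<noteq> 0" using et by auto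
  obtain v0 where v0: "\<And>ps. ps \<in> ?A \<Longrightarrow> rel_val ps v0 = 0" "rel_val e v0 \<noteq> 0"
    "\<bar>v0 0 - v0 n\<bar> \<le> int (q ^ (n - 1))"
    using bounded_kernel_vector[OF n0 A e_sub tA te triv] by blast
  define v where "v = (\<lambda>i. sgn (rel_val e v0) * v0 i)"
  have v: "rel_val ps v = sgn (rel_val e v0) * rel_val ps v0" for ps
    unfolding v_def by (rule rel_val_scale)
  have ev: "rel_val e v > 0" using v0(2) by (auto simp: v sgn_if)
  have vn: "v n - v 0 \<le> int (q ^ (n - 1))"
    using v0(3) by (auto simp: v_def sgn_if)
  have "(\<lambda>i. real_of_int (v i)) \<in> kern n q t"
    using v0(1) by (auto simp: kern_def rel_val_of_int v)
  from bspec[OF line[unfolded line_kernel_def] this]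
  obtain c where c: "\<And>i. i \<le> n \<Longrightarrow> real_of_int (v i) - real_of_int (v 0) = c * (t i - t 0)"
    by blast
  have "real_of_int (v 1) - real_of_int (v 0) = c * (t 1 - t 0)" by (rule c[OF n])
  moreover have "0 < real_of_int (v 1) - real_of_int (v 0)" using ev by (simp add: e)
  ultimately have "0 < c * rel_val e t" by (simp only: e)
  then have c0: "c > 0" using et by (metis zero_less_mult_pos2)
  have vt: "real_of_int (rel_val ps v) = c * rel_val ps t" if ps: "ps \<in> rels (Suc n) q" for ps
  proof -
    have s: "set ps \<subseteq> {..<Suc n} \<times> {..<Suc n}" using ps by (simp add: rels_def)
    have "rel_val ps (\<lambda>i. real_of_int (v i) - c * t i) = 0"
    proof (rule rel_val_const[OF s])
      fix i assume "i < Suc n"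
      then have "real_of_int (v i) - real_of_int (v 0) = c * t i - c * t 0"
        using c[of i] by (simp only: less_Suc_eq_le right_diff_distrib)
      then show "real_of_int (v i) - c * t i = real_of_int (v 0) - c * t 0" by linarith
    qed
    then show ?thesis unfolding rel_val_diff rel_val_scale rel_val_of_int by simp
  qed
  show ?thesis
    unfolding has_model_def incr_def
  proof (intro exI[of _ v] conjI allI impI ballI vn)
    fix i assume i: "i < n"
    have "[(Suc i, i)] \<in> rels (Suc n) q" using i q by (intro single_rels) auto
    from vt[OF this] have "real_of_int (v (Suc i) - v i) = c * (t (Suc i) - t i)" by simp
    also have "\<dots> > 0" using c0 t[OF i] by simp
    finally show "v i < v (Suc i)" by linarith
  next
    fix ps assume "ps \<in> rels (Suc n) q"
    then have "rel_val ps t = 0 \<longleftrightarrow> real_of_int (rel_val ps v) = 0" using vt c0 by simp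
    then show "rel_val ps t = 0 \<longleftrightarrow> rel_val ps v = 0" by simp
  qed
qed

text \<open>Subtracting from a generic \<open>w\<close> in the kernel the largest multiple of \<open>t\<close> that keeps it
  nondecreasing leads to a facet of the cone of nondecreasing tuples, and to a generic point of it.\<close>

lemma facet_point:
  fixes t :: "nat \<Rightarrow> real"
  assumes q: "1 \<le> q" and incr: "incr n t" and nl: "\<not> line_kernel n q t"
  obtains j t' where "j < n" "t' \<in> kern n q t" "\<And>i. i < n \<Longrightarrow> t' i \<le> t' (Suc i)"
    "t' (Suc j) = t' j" "\<exists>i<n. t' i < t' (Suc i)"
    "\<And>ps y. \<lbrakk>ps \<in> rels (Suc n) q; rel_val ps t' = 0; y \<in> kern n q t\<rbrakk> \<Longrightarrow>
      rel_val ps y * (t (Suc j) - t j) = rel_val ps t * (y (Suc j) - y j)"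
proof -
  have t: "t i < t (Suc i)" if "i < n" for i using incr that by (simp add: incr_def)
  let ?V = "kern n q t"
  \<comment> \<open>A 2 by 2 determinant: as the \<open>i\<close>-th gap of \<open>t\<close> is
    positive, it vanishes for all \<open>y\<close> in the kernel exactly if \<open>ps\<close> is
    there a multiple of the \<open>i\<close>-th gap. \<open>F\<close> keeps the functionals that are
    not identically 0, and \<open>w\<close> avoids their zeros.\<close>
  define \<phi> where "\<phi> = (\<lambda>(i, ps) y. rel_val ps y * (t (Suc i) - t i) - rel_val ps t * (y (Suc i) - y i))"
  define F where "F = {f \<in> \<phi> ` ({..<n} \<times> rels (Suc n) q). \<exists>y\<in>?V. f y \<noteq> 0}"
  have "\<exists>w\<in>?V. \<forall>f\<in>F. f w \<noteq> 0"
  proof (rule avoid_hyperplanes)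
    show "finite F" by (simp add: F_def)
    show "?V \<noteq> {}" using self_kern by blast
    show "(\<lambda>i. a * y i + b * z i) \<in> ?V" if "y \<in> ?V" "z \<in> ?V" for a b y z
      using kern_comb[OF that] .
    show "f (\<lambda>i. a * y i + b * z i) = a * f y + b * f z" if "f \<in> F" for f a b y z
      using that by (auto simp: F_def \<phi>_def rel_val_add rel_val_scale algebra_simps)
    show "\<exists>y\<in>?V. f y \<noteq> 0" if "f \<in> F" for f using that by (simp add: F_def)
  qed
  then obtain w where w: "w \<in> ?V" and wF: "\<And>f. f \<in> F \<Longrightarrow> f w \<noteq> 0" by blast
  have gap: "[(Suc i, i)] \<in> rels (Suc n) q" if "i < n" for i
    using that q by (intro single_rels) auto
  have generic: "\<phi> (i, ps) y = 0" if "\<phi> (i, ps) w = 0" "i < n" "ps \<in> rels (Suc n) q" "y \<in> ?V" for i ps y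
    using wF[of "\<phi> (i, ps)"] that by (auto simp: F_def)
  define r where "r = (\<lambda>i. (w (Suc i) - w i) / (t (Suc i) - t i))"
  have n0: "0 < n"
  proof (rule ccontr)
    assume "\<not> ?thesis"
    then have "line_kernel n q t" by (simp add: line_kernel_def)
    then show False using nl by blast
  qed
  obtain j where j: "j < n" "\<And>i. i < n \<Longrightarrow> r j \<le> r i"
    using ex_min_if_finite[of "r ` {..<n}"] n0
    by (metis (no_types, lifting) finite_imageI finite_lessThan imageE image_eqI image_is_empty
        lessThan_empty_iff lessThan_iff linorder_not_le nat_neq_iff not_less0)
  define t' where "t' = (\<lambda>i. 1 * w i + (- r j) * t i)"
  have t': "rel_val ps t' = rel_val ps w - r j * rel_val ps t" for ps
    unfolding t'_def rel_val_add rel_val_scale by simp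
  have gap': "t' (Suc i) - t' i = (r i - r j) * (t (Suc i) - t i)" if "i < n" for i
  proof -
    have "r i * (t (Suc i) - t i) = w (Suc i) - w i" using t[OF that] by (simp add: r_def)
    then show ?thesis by (simp add: t'_def algebra_simps)
  qed
  show ?thesis
  proof (rule that[of j t'])
    show "j < n" by (rule j)
    show "t' \<in> ?V" unfolding t'_def by (rule kern_comb[OF w self_kern])
    show "t' i \<le> t' (Suc i)" if "i < n" for i
    proof -
      have "0 \<le> (r i - r j) * (t (Suc i) - t i)"
        using j(2)[OF that] t[OF that] by (intro mult_nonneg_nonneg) auto
      then show ?thesis using gap'[OF that] by linarith
    qed
    show "t' (Suc j) = t' j" using gap'[OF j(1)] by simp
    \<comment> \<open>If all gaps of \<open>t'\<close> vanished, those of \<open>w\<close> would be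
      proportional to those of \<open>t\<close>; by genericity the same would hold for every
      \<open>y\<close> in the kernel, against \<open>nl\<close>.\<close>
    show "\<exists>i<n. t' i < t' (Suc i)"
    proof (rule ccontr)
      assume *: "\<not> ?thesis"
      have all: "r i = r j" if "i < n" for i
      proof -
        have "t' (Suc i) \<le> t' i" using * that by (meson linorder_not_less)
        then have "(r i - r j) * (t (Suc i) - t i) \<le> 0" using gap'[OF that] by linarith
        then have "r i - r j \<le> 0" using t[OF that] by (simp add: mult_le_0_iff)
        then show ?thesis using j(2)[OF that] by linarith
      qed
      have "line_kernel n q t"
        unfolding line_kernel_def
      proof (intro ballI)
        fix y assume y: "y \<in> ?V"
        define c where "c = (y (Suc j) - y j) / (t (Suc j) - t j)"
        have step: "y (Suc i) - y i = c * (t (Suc i) - t i)" if i: "i < n" for i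
        proof -
          have "\<phi> (j, [(Suc i, i)]) w = 0"
            using all[OF i] t[OF i] t[OF j(1)] by (simp add: \<phi>_def r_def field_simps)
          from generic[OF this j(1) gap[OF i] y] show ?thesis
            using t[OF j(1)] by (simp add: \<phi>_def c_def field_simps)
        qed
        have "y i - y 0 = c * (t i - t 0)" if "i \<le> n" for i
          using that
        proof (induction i)
          case (Suc i)
          then have "y (Suc i) - y i = c * (t (Suc i) - t i)" "y i - y 0 = c * (t i - t 0)"
            using step[of i] by auto
          then show ?case by (simp add: algebra_simps)
        qed simp
        then show "\<exists>c. \<forall>i\<le>n. y i - y 0 = c * (t i - t 0)" by blast
      qed
      then show False using nl by blast
    qed
    show "rel_val ps y * (t (Suc j) - t j) = rel_val ps t * (y (Suc j) - y j)"
      if ps: "ps \<in> rels (Suc n) q" and z: "rel_val ps t' = 0" and y: "y \<in> ?V" for ps y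
    proof -
      have "rel_val ps w = r j * rel_val ps t" using z by (simp add: t')
      then have "\<phi> (j, ps) w = 0" using t[OF j(1)] by (simp add: \<phi>_def r_def)
      from generic[OF this j(1) ps y] show ?thesis by (simp add: \<phi>_def)
    qed
  qed
qed

text \<open>\<open>f\<close> numbers the blocks of equal letters and \<open>z\<close> lists their
  values. One equality already gives \<open>n' < n\<close>, which makes the recursion
  terminate.\<close>

lemma merge_equal_letters:
  fixes x :: "nat \<Rightarrow> real"
  assumes "\<And>i. i < n \<Longrightarrow> x i \<le> x (Suc i)"
  obtains n' f z where "n' \<le> n" "f 0 = 0" "f n = n'" "\<And>i. i \<le> n \<Longrightarrow> f i \<le> n'"
    "\<And>i. i < n \<Longrightarrow> f (Suc i) = f i \<or> f (Suc i) = Suc (f i)"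
    "\<And>i. i \<le> n \<Longrightarrow> x i = z (f i)" "incr n' z"
    "(\<exists>j<n. x (Suc j) = x j) \<Longrightarrow> n' < n" "{..n'} \<subseteq> f ` {..n}"
proof -
  have ord: "\<forall>i<n. x i \<le> x (Suc i)" using assms by blast
  have "\<exists>n' f z. n' \<le> n \<and> f 0 = 0 \<and> f n = n' \<and> (\<forall>i\<le>n. f i \<le> n') \<and>
    (\<forall>i<n. f (Suc i) = f i \<or> f (Suc i) = Suc (f i)) \<and>
    (\<forall>i\<le>n. x i = z (f i)) \<and> (\<forall>i<n'. z i < z (Suc i)) \<and> ((\<exists>j<n. x (Suc j) = x j) \<longrightarrow> n' < n) \<and>
    {..n'} \<subseteq> f ` {..n}"
    using ord
  proof (induction n)
    case 0
    show ?case by (intro exI[of _ 0] exI[of _ "\<lambda>_. 0"] exI[of _ x]) auto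
  next
    case (Suc n)
    have "\<forall>i<n. x i \<le> x (Suc i)" using Suc.prems by simp
    from Suc.IH[OF this] obtain n' f z where h: "n' \<le> n" "f 0 = 0" "f n = n'" "\<And>i. i \<le> n \<Longrightarrow> f i \<le> n'"
      "\<And>i. i < n \<Longrightarrow> f (Suc i) = f i \<or> f (Suc i) = Suc (f i)"
      "\<And>i. i \<le> n \<Longrightarrow> x i = z (f i)" "\<And>i. i < n' \<Longrightarrow> z i < z (Suc i)"
      "(\<exists>j<n. x (Suc j) = x j) \<longrightarrow> n' < n" "{..n'} \<subseteq> f ` {..n}"
      by (elim exE conjE) blast
    show ?case
    proof (cases "x (Suc n) = x n")
      case True
      let ?f = "f(Suc n := n')"
      show ?thesis
      proof (intro exI[of _ n'] exI[of _ ?f] exI[of _ z] conjI allI impI)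
        show "?f (Suc i) = ?f i \<or> ?f (Suc i) = Suc (?f i)" if "i < Suc n" for i
          using h(3) h(5)[of i] that by (auto simp: less_Suc_eq)
        show "x i = z (?f i)" if "i \<le> Suc n" for i
          using True h(3) h(6)[of i] h(6)[of n] that by (auto simp: le_Suc_eq)
        have "?f ` {..Suc n} = insert n' (f ` {..n})" by (auto simp: atMost_Suc)
        then show "{..n'} \<subseteq> ?f ` {..Suc n}" using h(9) by auto
      qed (use h in \<open>auto simp: le_Suc_eq\<close>)
    next
      case False
      then have lt: "x n < x (Suc n)" using Suc.prems by (simp add: order_less_le)
      let ?f = "f(Suc n := Suc n')" and ?z = "z(Suc n' := x (Suc n))"
      show ?thesis
      proof (intro exI[of _ "Suc n'"] exI[of _ ?f] exI[of _ ?z] conjI allI impI)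
        show "?f (Suc i) = ?f i \<or> ?f (Suc i) = Suc (?f i)" if "i < Suc n" for i
          using h(3) h(5)[of i] that by (auto simp: less_Suc_eq)
        show "x i = ?z (?f i)" if "i \<le> Suc n" for i
          using h(4)[of i] h(6)[of i] that by (auto simp: le_Suc_eq)
        show "?z i < ?z (Suc i)" if "i < Suc n'" for i
          using h(7)[of i] h(6)[of n] h(3) lt that by (auto simp: less_Suc_eq)
        show "Suc n' < Suc n" if "\<exists>j<Suc n. x (Suc j) = x j"
          using that h(8) False by (auto simp: less_Suc_eq)
        have "?f ` {..Suc n} = insert (Suc n') (f ` {..n})" by (auto simp: atMost_Suc)
        then show "{..Suc n'} \<subseteq> ?f ` {..Suc n}" using h(9) by (auto simp: atMost_Suc)
        show "?f i \<le> Suc n'" if "i \<le> Suc n" for i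
          using h(4)[of i] that by (auto simp: le_Suc_eq)
      qed (use h in auto)
    qed
  qed
  then show ?thesis using that unfolding incr_def by (elim exE conjE) blast
qed

text \<open>The kernel is at most two-dimensional modulo constant tuples.\<close>

definition plane_kernel :: "nat \<Rightarrow> nat \<Rightarrow> (nat \<Rightarrow> real) \<Rightarrow> bool" where
  "plane_kernel n q t \<longleftrightarrow> (\<forall>y\<in>kern n q t. \<forall>z\<in>kern n q t. \<exists>a b c. (a \<noteq> 0 \<or> b \<noteq> 0 \<or> c \<noteq> 0) \<and>
     (\<forall>i\<le>n. a * (y i - y 0) + b * (z i - z 0) + c * (t i - t 0) = 0))"

text \<open>\<open>z\<close> is a generic facet point with equal letters merged; a model of
  \<open>z\<close>, pulled back along \<open>f\<close>, serves as \<open>u\<close> in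
  \<open>facet_lift\<close>. Passing to the facet loses a dimension of the kernel, whence the last
  claim.\<close>

lemma model_step:
  fixes t :: "nat \<Rightarrow> real"
  assumes q: "1 \<le> q" and t: "incr n t" and nl: "\<not> line_kernel n q t"
  shows "\<exists>n' z. 1 \<le> n' \<and> n' < n \<and> incr n' z \<and>
    (\<forall>D. has_model n' q z D \<longrightarrow> has_model n q t (D + int (q ^ (n - 1)))) \<and>
    (plane_kernel n q t \<longrightarrow> line_kernel n' q z)"
proof -
  obtain j t' where j: "j < n" and t'K: "t' \<in> kern n q t" and t'm: "\<And>i. i < n \<Longrightarrow> t' i \<le> t' (Suc i)"
    and t'j: "t' (Suc j) = t' j" and t'nc: "\<exists>i<n. t' i < t' (Suc i)"
    and key: "\<And>ps y. \<lbrakk>ps \<in> rels (Suc n) q; rel_val ps t' = 0; y \<in> kern n q t\<rbrakk> \<Longrightarrow>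
      rel_val ps y * (t (Suc j) - t j) = rel_val ps t * (y (Suc j) - y j)"
    using facet_point[OF q t nl] by blast
  obtain n' f z where f: "n' \<le> n" "f 0 = 0" "f n = n'" "\<And>i. i \<le> n \<Longrightarrow> f i \<le> n'"
    "\<And>i. i < n \<Longrightarrow> f (Suc i) = f i \<or> f (Suc i) = Suc (f i)"
    and z: "\<And>i. i \<le> n \<Longrightarrow> t' i = z (f i)" "incr n' z"
    and lt: "(\<exists>j<n. t' (Suc j) = t' j) \<Longrightarrow> n' < n" and surj: "{..n'} \<subseteq> f ` {..n}"
    using merge_equal_letters[of n t', OF t'm] by blast
  have map_rels: "map (map_prod f f) ps \<in> rels (Suc n') q" if "ps \<in> rels (Suc n) q" for ps
  proof -
    have "set (map (map_prod f f) ps) \<subseteq> {..<Suc n'} \<times> {..<Suc n'}"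
    proof
      fix p assume "p \<in> set (map (map_prod f f) ps)"
      then obtain a b where ab: "(a, b) \<in> set ps" "p = (f a, f b)" by auto
      then have "a \<le> n" "b \<le> n" using that by (auto simp: rels_def)
      then show "p \<in> {..<Suc n'} \<times> {..<Suc n'}" using f(4) ab(2) by (simp add: less_Suc_eq_le)
    qed
    then show ?thesis using that by (simp add: rels_def)
  qed
  have t'z: "rel_val ps t' = rel_val (map (map_prod f f) ps) z" if "ps \<in> rels (Suc n) q" for ps
    unfolding rel_val_map
  proof (rule rel_val_cong[of ps "Suc n"])
    show "set ps \<subseteq> {..<Suc n} \<times> {..<Suc n}" using that by (simp add: rels_def)
  qed (use z(1) in \<open>simp add: less_Suc_eq_le\<close>)
  have fj: "f (Suc j) = f j"
  proof (rule ccontr)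
    assume "f (Suc j) \<noteq> f j"
    then have s: "f (Suc j) = Suc (f j)" using f(5)[OF j] by blast
    then have "f j < n'" using f(4)[of "Suc j"] j by simp
    then have "z (f j) < z (f (Suc j))" using z(2) s by (simp add: incr_def)
    then show False using t'j z(1)[of j] z(1)[of "Suc j"] j by simp
  qed
  show ?thesis
  proof (intro exI[of _ n'] exI[of _ z] conjI allI impI)
    obtain i where i: "i < n" "t' i < t' (Suc i)" using t'nc by blast
    then have "f (Suc i) \<noteq> f i" using z(1)[of i] z(1)[of "Suc i"] by auto
    then have "f (Suc i) = Suc (f i)" using f(5)[OF i(1)] by blast
    then show "1 \<le> n'" using f(4)[of "Suc i"] i(1) by simp
    show "n' < n" using lt t'j j by blast
    show "incr n' z" by (rule z(2))
  next
    fix D assume "has_model n' q z D"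
    then obtain s :: "nat \<Rightarrow> int" where s: "incr n' s"
      "\<And>ps. ps \<in> rels (Suc n') q \<Longrightarrow> rel_val ps z = 0 \<longleftrightarrow> rel_val ps s = 0" "s n' - s 0 \<le> D"
      unfolding has_model_def by blast
    define u where "u = (\<lambda>i. s (f i))"
    have us: "rel_val ps u = rel_val (map (map_prod f f) ps) s" for ps
      unfolding u_def rel_val_map ..
    have ut': "rel_val ps t' = 0 \<longleftrightarrow> rel_val ps u = 0" if "ps \<in> rels (Suc n) q" for ps
      using s(2)[OF map_rels[OF that]] t'z[OF that] us by simp
    have "has_model n q t (u n - u 0 + int (q ^ (n - 1)))"
    proof (rule facet_lift[OF q t])
      show "rel_val ps u = 0" if "ps \<in> rels (Suc n) q" "rel_val ps t = 0" for ps
        using ut' that t'K by (simp add: kern_def)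
      show "u i \<le> u (Suc i)" if "i < n" for i
      proof (cases "f (Suc i) = f i")
        case False
        then have e: "f (Suc i) = Suc (f i)" using f(5)[OF that] by blast
        then have "f i < n'" using f(4)[of "Suc i"] that by simp
        then show ?thesis using s(1) e by (simp add: u_def incr_def order_less_imp_le)
      qed (simp add: u_def)
      show "u (Suc j) = u j" by (simp add: u_def fj)
      show "rel_val ps y * (t (Suc j) - t j) = rel_val ps t * (y (Suc j) - y j)"
        if "ps \<in> rels (Suc n) q" "rel_val ps u = 0" "y \<in> kern n q t" for ps y
        by (rule key[OF that(1) _ that(3)]) (use ut'[OF that(1)] that(2) in simp)
    qed (use j in auto)
    moreover have "u n - u 0 \<le> D" using s(3) by (simp add: u_def f)
    ultimately show "has_model n q t (D + int (q ^ (n - 1)))"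
      using has_model_mono by (meson add_right_mono)
  next
    assume pl: "plane_kernel n q t"
    show "line_kernel n' q z"
      unfolding line_kernel_def
    proof
      fix x assume x: "x \<in> kern n' q z"
      define y where "y = (\<lambda>i. x (f i))"
      have "y \<in> kern n q t"
        unfolding kern_def
      proof (intro CollectI ballI impI)
        fix ps assume ps: "ps \<in> rels (Suc n) q" "rel_val ps t = 0"
        then have "rel_val (map (map_prod f f) ps) z = 0"
          using t'K t'z[OF ps(1)] by (simp add: kern_def)
        then have "rel_val (map (map_prod f f) ps) x = 0"
          using x map_rels[OF ps(1)] by (simp add: kern_def)
        then show "rel_val ps y = 0" by (simp add: rel_val_map y_def)
      qed
      from bspec[OF bspec[OF pl[unfolded plane_kernel_def] this] t'K]
      obtain a b c where nz: "a \<noteq> 0 \<or> b \<noteq> 0 \<or> c \<noteq> 0"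
        and comb: "\<And>i. i \<le> n \<Longrightarrow> a * (y i - y 0) + b * (t' i - t' 0) + c * (t i - t 0) = 0"
        by blast
      \<comment> \<open>The \<open>j\<close>-th gap vanishes for the pulled back \<open>y\<close>
        and for \<open>t'\<close> but not for \<open>t\<close>, so the dependence does not involve
        \<open>t\<close>.\<close>
      have yj: "y (Suc j) = y j" by (simp add: y_def fj)
      have "a * (y j - y 0) + b * (t' j - t' 0) + c * (t (Suc j) - t 0) = 0"
        using comb[of "Suc j"] j t'j yj by simp
      moreover have "a * (y j - y 0) + b * (t' j - t' 0) + c * (t j - t 0) = 0"
        using comb[of j] j by simp
      ultimately have "c * (t (Suc j) - t 0) = c * (t j - t 0)" by linarith
      then have "c * (t (Suc j) - t j) = 0" by (simp add: right_diff_distrib)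
      then have c0: "c = 0" using t j by (auto simp: incr_def)
      have a0: "a \<noteq> 0"
      proof
        assume "a = 0"
        then have t0: "t' i = t' 0" if "i \<le> n" for i using comb[OF that] nz c0 by simp
        obtain i where "i < n" "t' i < t' (Suc i)" using t'nc by blast
        moreover from this have "t' i = t' 0" "t' (Suc i) = t' 0" by (intro t0; simp)+
        ultimately show False by linarith
      qed
      have "x k - x 0 = (- b / a) * (z k - z 0)" if "k \<le> n'" for k
      proof -
        have "k \<in> f ` {..n}" using surj that by auto
        then obtain i where i: "i \<le> n" "k = f i" by auto
        have "y i - y 0 = x k - x 0" by (simp add: y_def i(2) f(2))
        moreover have "t' i - t' 0 = z k - z 0" using z(1)[OF i(1)] z(1)[of 0] by (simp add: i(2) f(2))
        ultimately have "a * (x k - x 0) = - b * (z k - z 0)" using comb[OF i(1)] c0 by simp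
        then have "(a * (x k - x 0)) / a = (- b * (z k - z 0)) / a" by (rule arg_cong)
        then show ?thesis using a0 by simp
      qed
      then show "\<exists>c. \<forall>i\<le>n'. x i - x 0 = c * (z i - z 0)"
        by (intro exI[of _ "- b / a"]) simp
    qed
  qed
qed

text \<open>Crude, but uniform in \<open>t\<close>: it shows that the minimum defining
  \<open>H\<close> exists, and it suffices for the equality of the spectra.\<close>

lemma model_exists:
  assumes q: "1 \<le> q"
  shows "\<lbrakk>1 \<le> n; incr n t\<rbrakk> \<Longrightarrow> has_model n q t (\<Sum>j<n. int (q ^ j))"
proof (induction n arbitrary: t rule: less_induct)
  case (less n)
  note t = less.prems(2)
  have n: "(\<Sum>j<n. int (q ^ j)) = (\<Sum>j<n - 1. int (q ^ j)) + int (q ^ (n - 1))"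
    using less.prems(1) by (cases n) auto
  show ?case
  proof (cases "line_kernel n q t")
    case True
    have nn: "0 \<le> (\<Sum>j<n - 1. int (q ^ j))" by (intro sum_nonneg) simp
    show ?thesis
      by (rule has_model_mono[OF model_line[OF q less.prems(1) t True]]) (use nn n in simp)
  next
    case False
    obtain n' z where z: "1 \<le> n'" "n' < n" "incr n' z"
      and lift: "\<forall>D. has_model n' q z D \<longrightarrow> has_model n q t (D + int (q ^ (n - 1)))"
      using model_step[OF q t False] by blast
    have le: "(\<Sum>j<n'. int (q ^ j)) \<le> (\<Sum>j<n - 1. int (q ^ j))"
      using z(2) by (intro sum_mono2) auto
    have "has_model n' q z (\<Sum>j<n'. int (q ^ j))"
      by (rule less.IH[OF z(2) z(1) z(3)])
    from mp[OF spec[OF lift] this] show ?thesis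
      by (rule has_model_mono) (use le n in simp)
  qed
qed

text \<open>One step already reaches a line kernel, so at most two powers of \<open>q\<close> are
  paid.\<close>

lemma model_plane:
  assumes q: "1 \<le> q" and n: "2 \<le> n" and t: "incr n t" and pl: "plane_kernel n q t"
  shows "has_model n q t (int (q ^ (n - 2)) + int (q ^ (n - 1)))"
proof (cases "line_kernel n q t")
  case True
  have "1 \<le> n" using n by simp
  then have "has_model n q t (int (q ^ (n - 1)))"
    by (rule model_line[OF q _ t True])
  then show ?thesis by (rule has_model_mono) simp
next
  case False
  obtain n' z where z: "1 \<le> n'" "n' < n" "incr n' z"
    and lift: "\<forall>D. has_model n' q z D \<longrightarrow> has_model n q t (D + int (q ^ (n - 1)))"
    and li: "plane_kernel n q t \<longrightarrow> line_kernel n' q z"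
    using model_step[OF q t False] by blast
  have le: "int (q ^ (n' - 1)) \<le> int (q ^ (n - 2))"
    unfolding of_nat_le_iff using z(2) n q by (intro power_increasing) auto
  have "has_model n' q z (int (q ^ (n' - 1)))"
    by (rule model_line[OF q z(1) z(3) mp[OF li pl]])
  from mp[OF spec[OF lift] this] show ?thesis
    by (rule has_model_mono) (use le in simp)
qed

section \<open>Two-dimensional kernels in gap coordinates\<close>

text \<open>Padding the matrix of \<open>N + 1\<close> vectors in dimension \<open>N\<close> with a
  zero row makes it square and singular.\<close>

lemma dependent_family:
  fixes a :: "nat \<Rightarrow> nat \<Rightarrow> real"
  shows "\<exists>c. (\<exists>i\<le>N. c i \<noteq> 0) \<and> (\<forall>k<N. (\<Sum>i\<le>N. c i * a i k) = 0)"
proof -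
  define M where "M = mat (Suc N) (Suc N) (\<lambda>(k, i). if k < N then a i k else 0)"
  have M: "M \<in> carrier_mat (Suc N) (Suc N)" by (simp add: M_def)
  have "det M = (\<Sum>j<Suc N. M $$ (N, j) * cofactor M N j)"
    by (rule laplace_expansion_row[OF M]) simp
  also have "\<dots> = 0" by (intro sum.neutral) (simp add: M_def)
  finally obtain v where v: "v \<in> carrier_vec (Suc N)" "v \<noteq> 0\<^sub>v (Suc N)" "M *\<^sub>v v = 0\<^sub>v (Suc N)"
    using det_0_iff_vec_prod_zero_field[OF M] by blast
  show ?thesis
  proof (intro exI[of _ "\<lambda>i. v $ i"] conjI allI impI)
    show "\<exists>i\<le>N. v $ i \<noteq> 0"
    proof (rule ccontr)
      assume "\<not> ?thesis"
      then have "v = 0\<^sub>v (Suc N)" using v(1) by (intro eq_vecI) (auto simp: less_Suc_eq_le)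
      then show False using v(2) by blast
    qed
    fix k assume k: "k < N"
    have "(M *\<^sub>v v) $ k = (\<Sum>i<Suc N. a i k * v $ i)"
      using k v(1) by (auto simp: mult_mat_vec_def scalar_prod_def M_def atLeast0LessThan intro!: sum.cong)
    then have "(\<Sum>i<Suc N. a i k * v $ i) = 0" using v(3) k by simp
    then show "(\<Sum>i\<le>N. v $ i * a i k) = 0" by (simp add: lessThan_Suc_atMost mult.commute)
  qed
qed

text \<open>The coefficient of the gap between the letters \<open>k\<close> and \<open>k + 1\<close>.\<close>

definition gapc :: "(nat \<times> nat) list \<Rightarrow> nat \<Rightarrow> int" where
  "gapc ps k = rel_val ps (\<lambda>i. if k < i then 1 else 0)"

lemma rel_val_gaps:
  fixes x :: "nat \<Rightarrow> 'a::comm_ring_1"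
  assumes "ps \<in> rels (Suc n) q"
  shows "rel_val ps x = (\<Sum>k<n. of_int (gapc ps k) * (x (Suc k) - x k))"
proof -
  have s: "set ps \<subseteq> {..<Suc n} \<times> {..<Suc n}" using assms by (simp add: rels_def)
  have x: "x i = x 0 + (\<Sum>k<n. (x (Suc k) - x k) * of_int (if k < i then 1 else 0))" if "i < Suc n" for i
  proof -
    have "(\<Sum>k<n. (x (Suc k) - x k) * of_int (if k < i then 1 else 0))
        = (\<Sum>k<n. if k < i then x (Suc k) - x k else 0)"
      by (intro sum.cong) auto
    also have "\<dots> = (\<Sum>k\<in>{..<n} \<inter> {k. k < i}. x (Suc k) - x k)"
      by (subst sum.inter_restrict) auto
    also have "{..<n} \<inter> {k. k < i} = {..<i}" using that by auto
    also have "(\<Sum>k<i. x (Suc k) - x k) = x i - x 0" by (rule sum_lessThan_telescope)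
    finally show ?thesis by simp
  qed
  have "rel_val ps x = rel_val ps (\<lambda>i. x 0 + (\<Sum>k<n. (x (Suc k) - x k) * of_int (if k < i then 1 else 0)))"
    by (rule rel_val_cong[OF s]) (rule x)
  also have "\<dots> = (\<Sum>k<n. (x (Suc k) - x k) * of_int (gapc ps k))"
    unfolding rel_val_add rel_val_sum rel_val_scale gapc_def rel_val_of_int
    by (subst rel_val_const[OF s, of "\<lambda>i. x 0" "x 0"]) auto
  finally show ?thesis by (simp only: mult.commute)
qed

text \<open>The gap vectors of \<open>y\<close>, \<open>z\<close>, \<open>t\<close> and the
  \<open>n - 2\<close> conditions \<open>\<sigma> l\<close> are \<open>n + 1\<close> vectors in
  dimension \<open>n\<close>, hence dependent. Orthogonality and \<open>indep\<close> remove the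
  conditions from the dependence.\<close>

lemma plane_kernelI:
  fixes \<sigma> :: "nat \<Rightarrow> nat \<Rightarrow> real"
  assumes n: "2 \<le> n"
    and V: "\<And>l y. \<lbrakk>l < n - 2; y \<in> kern n q t\<rbrakk> \<Longrightarrow> (\<Sum>k<n. \<sigma> l k * (y (Suc k) - y k)) = 0"
    and indep: "\<And>c l. \<lbrakk>\<And>k. k < n \<Longrightarrow> (\<Sum>l<n - 2. c l * \<sigma> l k) = 0; l < n - 2\<rbrakk> \<Longrightarrow> c l = 0"
  shows "plane_kernel n q t"
  unfolding plane_kernel_def
proof (intro ballI)
  fix y z assume y: "y \<in> kern n q t" and z: "z \<in> kern n q t"
  define g where "g = (\<lambda>x :: nat \<Rightarrow> real. \<lambda>k. x (Suc k) - x k)"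
  define a where "a = (\<lambda>i. if i = 0 then g y else if i = 1 then g z else if i = 2 then g t else \<sigma> (i - 3))"
  obtain c where c: "\<exists>i\<le>n. c i \<noteq> 0" "\<And>k. k < n \<Longrightarrow> (\<Sum>i\<le>n. c i * a i k) = 0"
    using dependent_family[of n a] by blast
  define \<omega> where "\<omega> = (\<lambda>k. \<Sum>l<n - 2. c (l + 3) * \<sigma> l k)"
  have sum4: "(\<Sum>i\<le>n. F i) = F 0 + F 1 + F 2 + (\<Sum>l<n - 2. F (l + 3))" for F :: "nat \<Rightarrow> real"
  proof -
    have add: "(\<Sum>i<3 + m. F i) = F 0 + F 1 + F 2 + (\<Sum>l<m. F (l + 3))" for m
      by (induction m) (simp_all add: numeral_3_eq_3 numeral_2_eq_2)
    have "{..n} = {..<3 + (n - 2)}" using n by auto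
    then show ?thesis by (simp only: add)
  qed
  have eq: "c 0 * g y k + c 1 * g z k + c 2 * g t k + \<omega> k = 0" if "k < n" for k
    using c(2)[OF that] unfolding sum4 by (simp add: a_def \<omega>_def)
  have orth: "(\<Sum>k<n. \<omega> k * g x k) = 0" if "x \<in> kern n q t" for x
  proof -
    have "(\<Sum>k<n. \<omega> k * g x k) = (\<Sum>l<n - 2. c (l + 3) * (\<Sum>k<n. \<sigma> l k * g x k))"
      unfolding \<omega>_def sum_distrib_right sum_distrib_left
      by (subst sum.swap) (simp add: mult.assoc)
    also have "\<dots> = 0" using V[OF _ that] by (intro sum.neutral) (auto simp: g_def)
    finally show ?thesis .
  qed
  \<comment> \<open>\<open>\<omega>\<close> is orthogonal to the three gap vectors and also a
    combination of them, hence orthogonal to itself.\<close>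
  have "(\<Sum>k<n. \<omega> k * \<omega> k) =
      (\<Sum>k<n. - c 0 * (\<omega> k * g y k) - c 1 * (\<omega> k * g z k) - c 2 * (\<omega> k * g t k))"
  proof (rule sum.cong)
    fix k assume "k \<in> {..<n}"
    then have w: "\<omega> k = - (c 0 * g y k) - c 1 * g z k - c 2 * g t k" using eq[of k] by simp
    show "\<omega> k * \<omega> k = - c 0 * (\<omega> k * g y k) - c 1 * (\<omega> k * g z k) - c 2 * (\<omega> k * g t k)"
      by (subst (2) w) (simp add: algebra_simps)
  qed simp
  also have "\<dots> = - c 0 * (\<Sum>k<n. \<omega> k * g y k) - c 1 * (\<Sum>k<n. \<omega> k * g z k) - c 2 * (\<Sum>k<n. \<omega> k * g t k)"
    by (simp only: sum_subtractf sum_distrib_left)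
  also have "\<dots> = 0" using orth[OF y] orth[OF z] orth[OF self_kern] by simp
  finally have "\<forall>k\<in>{..<n}. \<omega> k * \<omega> k = 0"
    by (subst (asm) sum_nonneg_eq_0_iff) auto
  then have w0: "\<omega> k = 0" if "k < n" for k using that by auto
  have c0: "c (l + 3) = 0" if "l < n - 2" for l
    by (rule indep[of "\<lambda>l. c (l + 3)", OF _ that]) (use w0 in \<open>simp add: \<omega>_def\<close>)
  have nz: "c 0 \<noteq> 0 \<or> c 1 \<noteq> 0 \<or> c 2 \<noteq> 0"
  proof -
    obtain i where i: "i \<le> n" "c i \<noteq> 0" using c(1) by blast
    have "i < 3"
    proof (rule ccontr)
      assume "\<not> i < 3"
      then have "c ((i - 3) + 3) = 0" using i(1) by (intro c0) auto
      then show False using i(2) \<open>\<not> i < 3\<close> by simp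
    qed
    then have "i = 0 \<or> i = 1 \<or> i = 2" by auto
    then show ?thesis using i(2) by blast
  qed
  have "c 0 * (y i - y 0) + c 1 * (z i - z 0) + c 2 * (t i - t 0) = 0" if "i \<le> n" for i
    using that
  proof (induction i)
    case (Suc i)
    then have "c 0 * g y i + c 1 * g z i + c 2 * g t i = 0" using eq[of i] w0[of i] by simp
    then show ?case using Suc by (simp add: g_def algebra_simps)
  qed simp
  then show "\<exists>a b c. (a \<noteq> 0 \<or> b \<noteq> 0 \<or> c \<noteq> 0) \<and>
      (\<forall>i\<le>n. a * (y i - y 0) + b * (z i - z 0) + c * (t i - t 0) = 0)"
    using nz by blast
qed

section \<open>Relations between four and five letters\<close>

text \<open>Half the total variation of \<open>0, \<sigma> 0, \<dots>, \<sigma> (n - 1), 0\<close> is at most \<open>q\<close>; alternating sums of more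
  than four terms are not needed.\<close>

definition gap_bounded :: "nat \<Rightarrow> nat \<Rightarrow> (nat \<Rightarrow> int) \<Rightarrow> bool" where
  "gap_bounded n q \<sigma> \<longleftrightarrow> (\<forall>a<n. \<bar>\<sigma> a\<bar> \<le> int q) \<and>
     (\<forall>b<n. \<forall>a<b. \<bar>\<sigma> a - \<sigma> b\<bar> \<le> int q) \<and>
     (\<forall>c<n. \<forall>b<c. \<forall>a<b. \<bar>\<sigma> a - \<sigma> b + \<sigma> c\<bar> \<le> int q) \<and>
     (\<forall>d<n. \<forall>c<d. \<forall>b<c. \<forall>a<b. \<bar>\<sigma> a - \<sigma> b + \<sigma> c - \<sigma> d\<bar> \<le> int q)"

lemma rel_val_01_bound:
  assumes "\<And>i. f i \<in> {0, 1 :: int}"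
  shows "\<bar>rel_val ps f\<bar> \<le> int (length ps)"
proof (induction ps)
  case (Cons p ps)
  have "f (fst p) = 0 \<or> f (fst p) = 1" "f (snd p) = 0 \<or> f (snd p) = 1" using assms by auto
  then have "\<bar>f (fst p) - f (snd p)\<bar> \<le> 1" by auto
  then show ?case using Cons by simp
qed simp

text \<open>An alternating sum of gap coefficients at increasing indices is the value of the
  relation at the indicator of a union of intervals, where each pair contributes at most 1 in
  absolute value.\<close>

lemma gap_bounded_gapc:
  assumes "ps \<in> rels m q"
  shows "gap_bounded n q (gapc ps)"
proof -
  have l: "\<bar>rel_val ps f\<bar> \<le> int q" if "\<And>i. f i \<in> {0, 1 :: int}" for f
    using rel_val_01_bound[of f ps, OF that] assms by (simp add: rels_def)
  show ?thesis
    unfolding gap_bounded_def gapc_def rel_val_add[symmetric] rel_val_diff[symmetric]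
    by (intro conjI allI impI l) auto
qed

lemma sum_lt4: "(\<Sum>k<4. f k) = f (0 :: nat) + f 1 + f 2 + (f 3 :: 'a::comm_monoid_add)"
  by (simp add: eval_nat_numeral ac_simps)

lemma sum_lt3: "(\<Sum>k<3. f k) = f (0 :: nat) + f 1 + (f 2 :: 'a::comm_monoid_add)"
  by (simp add: eval_nat_numeral ac_simps)

lemma all_lt4: "(\<forall>k<4. P k) \<longleftrightarrow> P 0 \<and> P 1 \<and> P 2 \<and> P (3 :: nat)"
  by (auto simp: eval_nat_numeral less_Suc_eq)

lemma gap_bounded4:
  assumes "gap_bounded 4 q \<sigma>"
  shows "\<bar>\<sigma> 0\<bar> \<le> int q" "\<bar>\<sigma> 1\<bar> \<le> int q" "\<bar>\<sigma> 2\<bar> \<le> int q" "\<bar>\<sigma> 3\<bar> \<le> int q"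
    "\<bar>\<sigma> 0 - \<sigma> 1\<bar> \<le> int q" "\<bar>\<sigma> 0 - \<sigma> 2\<bar> \<le> int q" "\<bar>\<sigma> 0 - \<sigma> 3\<bar> \<le> int q"
    "\<bar>\<sigma> 1 - \<sigma> 2\<bar> \<le> int q" "\<bar>\<sigma> 1 - \<sigma> 3\<bar> \<le> int q" "\<bar>\<sigma> 2 - \<sigma> 3\<bar> \<le> int q"
    "\<bar>\<sigma> 0 - \<sigma> 1 + \<sigma> 2\<bar> \<le> int q" "\<bar>\<sigma> 0 - \<sigma> 1 + \<sigma> 3\<bar> \<le> int q"
    "\<bar>\<sigma> 0 - \<sigma> 2 + \<sigma> 3\<bar> \<le> int q" "\<bar>\<sigma> 1 - \<sigma> 2 + \<sigma> 3\<bar> \<le> int q"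
    "\<bar>\<sigma> 0 - \<sigma> 1 + \<sigma> 2 - \<sigma> 3\<bar> \<le> int q"
proof -
  have 1: "\<bar>\<sigma> a\<bar> \<le> int q" if "a < 4" for a
    using assms that by (simp add: gap_bounded_def)
  have 2: "\<bar>\<sigma> a - \<sigma> b\<bar> \<le> int q" if "b < 4" "a < b" for a b
    using assms that by (simp add: gap_bounded_def)
  have 3: "\<bar>\<sigma> a - \<sigma> b + \<sigma> c\<bar> \<le> int q" if "c < 4" "b < c" "a < b" for a b c
    using assms that by (simp add: gap_bounded_def)
  have 4: "\<bar>\<sigma> a - \<sigma> b + \<sigma> c - \<sigma> d\<bar> \<le> int q" if "d < 4" "c < d" "b < c" "a < b" for a b c d
    using assms that by (simp add: gap_bounded_def)
  show "\<bar>\<sigma> 0\<bar> \<le> int q" "\<bar>\<sigma> 1\<bar> \<le> int q" "\<bar>\<sigma> 2\<bar> \<le> int q" "\<bar>\<sigma> 3\<bar> \<le> int q"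
    "\<bar>\<sigma> 0 - \<sigma> 1\<bar> \<le> int q" "\<bar>\<sigma> 0 - \<sigma> 2\<bar> \<le> int q" "\<bar>\<sigma> 0 - \<sigma> 3\<bar> \<le> int q"
    "\<bar>\<sigma> 1 - \<sigma> 2\<bar> \<le> int q" "\<bar>\<sigma> 1 - \<sigma> 3\<bar> \<le> int q" "\<bar>\<sigma> 2 - \<sigma> 3\<bar> \<le> int q"
    "\<bar>\<sigma> 0 - \<sigma> 1 + \<sigma> 2\<bar> \<le> int q" "\<bar>\<sigma> 0 - \<sigma> 1 + \<sigma> 3\<bar> \<le> int q"
    "\<bar>\<sigma> 0 - \<sigma> 2 + \<sigma> 3\<bar> \<le> int q" "\<bar>\<sigma> 1 - \<sigma> 2 + \<sigma> 3\<bar> \<le> int q"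
    "\<bar>\<sigma> 0 - \<sigma> 1 + \<sigma> 2 - \<sigma> 3\<bar> \<le> int q"
    by (rule 1 2 3 4; simp)+
qed

section \<open>Integer inequalities for gap coefficients\<close>

text \<open>The bound behind this is that two vectors of the hexagon
  \<open>max(|u|, |v|, |u + v|) \<le> 1\<close> span a parallelogram of area at most 1.\<close>

lemma hexagon_det_bound:
  fixes u v U V q p :: int
  assumes "\<bar>u\<bar> \<le> q" "\<bar>v\<bar> \<le> q" "\<bar>u + v\<bar> \<le> q" "\<bar>U\<bar> \<le> p" "\<bar>V\<bar> \<le> p" "\<bar>U + V\<bar> \<le> p"
  shows "\<bar>u * V - v * U\<bar> \<le> p * q"
proof -
  have q: "0 \<le> q" using assms(1) by linarith
  have key: "\<bar>x * X - y * Y\<bar> \<le> p * q" if "\<bar>x\<bar> \<le> q" "\<bar>y\<bar> \<le> q" "\<bar>X\<bar> + \<bar>Y\<bar> \<le> p" for x y X Y :: int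
  proof -
    have "\<bar>x * X - y * Y\<bar> \<le> \<bar>x\<bar> * \<bar>X\<bar> + \<bar>y\<bar> * \<bar>Y\<bar>"
      using abs_triangle_ineq4[of "x * X" "y * Y"] by (simp only: abs_mult)
    also have "\<dots> \<le> q * \<bar>X\<bar> + q * \<bar>Y\<bar>" using that by (intro add_mono mult_right_mono) auto
    also have "\<dots> = q * (\<bar>X\<bar> + \<bar>Y\<bar>)" by (simp add: distrib_left)
    also have "\<dots> \<le> q * p" using that q by (intro mult_left_mono) auto
    finally show ?thesis by (simp add: mult.commute)
  qed
  \<comment> \<open>The largest of the three absolute values is the sum of the other two, so some
    two add up to at most \<open>p\<close>; the determinant can be rewritten in terms of any
    two.\<close>
  consider "\<bar>U\<bar> + \<bar>V\<bar> \<le> p" | "\<bar>U + V\<bar> + \<bar>U\<bar> \<le> p" | "\<bar>V\<bar> + \<bar>U + V\<bar> \<le> p"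
    using assms(4-6) by linarith
  then show ?thesis
  proof cases
    case 1
    then show ?thesis using key[of u v V U] assms by simp
  next
    case 2
    have "u * V - v * U = u * (U + V) - (u + v) * U" by (simp add: algebra_simps)
    then show ?thesis using key[of u "u + v" "U + V" U] assms 2 by simp
  next
    case 3
    have "u * V - v * U = (u + v) * V - v * (U + V)" by (simp add: algebra_simps)
    then show ?thesis using key[of "u + v" v V "U + V"] assms 3 by simp
  qed
qed

text \<open>Both coefficient triples are orthogonal to the primitive vector
  \<open>(x, y, z)\<close>, so their cross product is an integer multiple \<open>k\<close> of it.
  Its coordinate sum is a determinant as in \<open>hexagon_det_bound\<close>, at most
  \<open>p * q\<close> in absolute value, which leaves only \<open>k = 0\<close>.\<close>

lemma cross_zero:
  fixes a b c A B C x y z :: int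
  assumes co: "gcd x (gcd y z) = 1" and nn: "0 \<le> x" "0 \<le> y" "0 \<le> z"
    and S: "A * x + B * y + C * z = 0" and s: "a * x + b * y + c * z = 0"
    and ab: "\<bar>a - b\<bar> \<le> q" "\<bar>b - c\<bar> \<le> q" "\<bar>a - c\<bar> \<le> q"
    and AB: "\<bar>A - B\<bar> \<le> p" "\<bar>B - C\<bar> \<le> p" "\<bar>A - C\<bar> \<le> p"
    and big: "p * q < x + y + z"
  shows "a * B = b * A" "a * C = c * A" "b * C = c * B"
proof -
  define w1 w2 w3 where "w1 = b * C - c * B" and "w2 = c * A - a * C" and "w3 = a * B - b * A"
  have p1: "w1 * y = w2 * x"
  proof -
    have "w1 * y - w2 * x = C * (a * x + b * y + c * z) - c * (A * x + B * y + C * z)"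
      by (simp add: w1_def w2_def algebra_simps)
    then show ?thesis using S s by simp
  qed
  have p2: "w1 * z = w3 * x"
  proof -
    have "w1 * z - w3 * x = b * (A * x + B * y + C * z) - B * (a * x + b * y + c * z)"
      by (simp add: w1_def w3_def algebra_simps)
    then show ?thesis using S s by simp
  qed
  have p3: "w2 * z = w3 * y"
  proof -
    have "w2 * z - w3 * y = A * (a * x + b * y + c * z) - a * (A * x + B * y + C * z)"
      by (simp add: w2_def w3_def algebra_simps)
    then show ?thesis using S s by simp
  qed
  \<comment> \<open>Primitivity enters through Bezout coefficients, which show that the common ratio
    \<open>k\<close> is an integer.\<close>
  obtain \<beta> \<gamma> where g: "\<beta> * y + \<gamma> * z = gcd y z" using bezout_int by blast
  obtain \<alpha> \<delta> where a: "\<alpha> * x + \<delta> * gcd y z = 1" using bezout_int[of x "gcd y z"] unfolding co by blast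
  have one: "\<alpha> * x + \<delta> * \<beta> * y + \<delta> * \<gamma> * z = 1"
    using a unfolding g[symmetric] by (simp only: distrib_left add.assoc mult.assoc)
  define k where "k = \<alpha> * w1 + \<delta> * \<beta> * w2 + \<delta> * \<gamma> * w3"
  have "k * x = w1 * (\<alpha> * x + \<delta> * \<beta> * y + \<delta> * \<gamma> * z)"
  proof -
    have "k * x = \<alpha> * (w1 * x) + \<delta> * \<beta> * (w2 * x) + \<delta> * \<gamma> * (w3 * x)" by (simp add: k_def algebra_simps)
    then show ?thesis unfolding p1[symmetric] p2[symmetric] by (simp add: algebra_simps)
  qed
  then have kx: "w1 = k * x" using one by simp
  have "k * y = w2 * (\<alpha> * x + \<delta> * \<beta> * y + \<delta> * \<gamma> * z)"
  proof -
    have "k * y = \<alpha> * (w1 * y) + \<delta> * \<beta> * (w2 * y) + \<delta> * \<gamma> * (w3 * y)" by (simp add: k_def algebra_simps)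
    then show ?thesis unfolding p1 p3[symmetric] by (simp add: algebra_simps)
  qed
  then have ky: "w2 = k * y" using one by simp
  have "k * z = w3 * (\<alpha> * x + \<delta> * \<beta> * y + \<delta> * \<gamma> * z)"
  proof -
    have "k * z = \<alpha> * (w1 * z) + \<delta> * \<beta> * (w2 * z) + \<delta> * \<gamma> * (w3 * z)" by (simp add: k_def algebra_simps)
    then show ?thesis unfolding p2 p3 by (simp add: algebra_simps)
  qed
  then have kz: "w3 = k * z" using one by simp
  have "w1 + w2 + w3 = (a - b) * (B - C) - (b - c) * (A - B)"
    by (simp add: w1_def w2_def w3_def algebra_simps)
  then have "\<bar>w1 + w2 + w3\<bar> \<le> p * q"
    using hexagon_det_bound[of "a - b" q "b - c" "A - B" p "B - C"] ab AB by simp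
  moreover have "w1 + w2 + w3 = k * (x + y + z)" by (simp add: kx ky kz algebra_simps)
  ultimately have "\<bar>k\<bar> * (x + y + z) < 1 * (x + y + z)" using big nn by (simp add: abs_mult)
  then have "\<bar>k\<bar> < 1" using nn by (subst (asm) mult_less_cancel_right) linarith
  then have "k = 0" by simp
  then show "a * B = b * A" "a * C = c * A" "b * C = c * B"
    using kx ky kz by (auto simp: w1_def w2_def w3_def)
qed

text \<open>With \<open>z = d'\<close> the equation, divided by \<open>d\<close>, reads
  \<open>P' * x - N' * y = Z'\<close> with coprime \<open>P'\<close> and \<open>N'\<close>. Along
  its solutions \<open>x + y\<close> moves in steps of \<open>m = P' + N' < q\<close>, so some sum
  falls into the window of length \<open>q\<close>. A common divisor of \<open>x\<close>,
  \<open>y\<close> and \<open>d'\<close> also divides \<open>Z'\<close>, which is coprime to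
  \<open>d'\<close>.\<close>

lemma primitive_solution_aux:
  fixes P N Z q :: int
  assumes q: "2 \<le> q" and P: "0 < P" and N: "0 < N" and Z: "0 \<le> Z" and PN: "P + N \<le> q - 1" and PZ: "P + Z \<le> q - 1"
  shows "\<exists>x y z. 0 \<le> x \<and> 0 \<le> y \<and> 0 \<le> z \<and> P * x = N * y + Z * z \<and> gcd x (gcd y z) = 1 \<and>
    q * q - q < x + y + z \<and> x + y + z \<le> q * q"
proof -
  define d where "d = gcd P N"
  define g where "g = gcd d Z"
  have d0: "0 < d" using P by (simp add: d_def)
  have g0: "0 < g" using d0 by (simp add: g_def)
  obtain P' where P': "P = d * P'" unfolding d_def using gcd_dvd1 by (rule dvdE)
  obtain N' where N': "N = d * N'" unfolding d_def using gcd_dvd2 by (rule dvdE)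
  obtain d' where d': "d = g * d'" unfolding g_def using gcd_dvd1 by (rule dvdE)
  obtain Z' where Z': "Z = g * Z'" unfolding g_def using gcd_dvd2 by (rule dvdE)
  have "0 < d * P'" "0 < d * N'" "0 < g * d'" "0 \<le> g * Z'"
    unfolding P'[symmetric] N'[symmetric] d'[symmetric] Z'[symmetric] by (fact P N d0 Z)+
  then have pos: "0 < P'" "0 < N'" "0 < d'" "0 \<le> Z'"
    using d0 g0 zero_less_mult_pos zero_le_mult_iff[of g Z'] by (blast, blast, blast, linarith)
  have cop: "gcd P' N' = 1"
  proof -
    have "\<bar>d\<bar> * gcd P' N' = gcd P N" unfolding gcd_mult_distrib_int P'[symmetric] N'[symmetric] ..
    also have "\<dots> = d" by (simp only: d_def)
    finally have "\<bar>d\<bar> * gcd P' N' = d" .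
    then have "d * gcd P' N' = d * 1" using d0 by simp
    then show ?thesis using d0 by (subst (asm) mult_cancel_left) simp
  qed
  have cod: "gcd d' Z' = 1"
  proof -
    have "\<bar>g\<bar> * gcd d' Z' = gcd d Z" unfolding gcd_mult_distrib_int d'[symmetric] Z'[symmetric] ..
    also have "\<dots> = g" by (simp only: g_def)
    finally have "\<bar>g\<bar> * gcd d' Z' = g" .
    then have "g * gcd d' Z' = g * 1" using g0 by simp
    then show ?thesis using g0 by (subst (asm) mult_cancel_left) simp
  qed
  obtain \<alpha> \<beta> where ab: "\<alpha> * P' + \<beta> * N' = 1" using bezout_int[of P' N'] unfolding cop by blast
  have bez: "P' * (\<alpha> * Z') - N' * (- \<beta> * Z') = Z'"
  proof -
    have "P' * (\<alpha> * Z') - N' * (- \<beta> * Z') = (\<alpha> * P' + \<beta> * N') * Z'" by (simp add: algebra_simps)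
    then show ?thesis by (simp only: ab mult_1)
  qed
  define m where "m = P' + N'"
  define s0 where "s0 = \<alpha> * Z' + (- \<beta> * Z') + d'"
  \<comment> \<open>This selects the last solution whose sum is at most \<open>q * q\<close>;
    \<open>s0\<close> is the sum at \<open>k = 0\<close>.\<close>
  define k where "k = (q * q - s0) div m"
  define x y where "x = \<alpha> * Z' + k * N'" and "y = - \<beta> * Z' + k * P'"
  have m0: "0 < m" using pos by (simp add: m_def)
  have le: "b \<le> a * b" if "0 < a" "0 \<le> b" for a b :: int
    using that mult_right_mono[of 1 a b] by simp
  have "P' \<le> P" unfolding P' using d0 pos(1) by (intro le) auto
  moreover have "N' \<le> N" unfolding N' using d0 pos(2) by (intro le) auto
  moreover have "d' \<le> d" unfolding d' using g0 pos(3) by (intro le) auto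
  moreover have "Z' \<le> Z" unfolding Z' using g0 pos(4) by (intro le) auto
  moreover have "d \<le> P" unfolding d_def using P by (intro zdvd_imp_le) auto
  ultimately have les: "P' \<le> P" "N' \<le> N" "d' \<le> d" "Z' \<le> Z" "d \<le> P" by blast+
  then have mq: "m \<le> q - 1" using PN by (simp add: m_def)
  have eq: "P' * x - N' * y = Z'"
  proof -
    have "P' * x - N' * y = P' * (\<alpha> * Z') - N' * (- \<beta> * Z')" by (simp add: x_def y_def algebra_simps)
    then show ?thesis by (simp only: bez)
  qed
  have size: "x + y + d' = s0 + k * m" by (simp add: x_def y_def s0_def m_def algebra_simps)
  have "k * m = (q * q - s0) - (q * q - s0) mod m"
    by (simp add: k_def minus_mod_eq_div_mult)
  moreover have "0 \<le> (q * q - s0) mod m" "(q * q - s0) mod m < m" using m0 by auto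
  ultimately have up: "x + y + d' \<le> q * q" and lo: "q * q - q < x + y + d'"
    using size mq by linarith+
  have qq: "q - 1 \<le> q * q - q"
  proof -
    have "1 * (q - 1) \<le> q * (q - 1)" using q by (intro mult_right_mono) auto
    then show ?thesis by (simp add: algebra_simps)
  qed
  \<comment> \<open>A negative \<open>y\<close> would force \<open>x \<le> Z'\<close> and a sum of
    at most \<open>q - 1\<close>, which is below the window.\<close>
  have y0: "0 \<le> y"
  proof (rule ccontr)
    assume "\<not> 0 \<le> y"
    then have "N' * y < 0" using pos(2) by (simp add: mult_pos_neg)
    then have px: "P' * x < Z'" using eq by linarith
    have "x \<le> Z'"
    proof (cases "0 \<le> x")
      case True
      then show ?thesis using le[OF pos(1) True] px by linarith
    next
      case False
      then show ?thesis using pos(4) by linarith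
    qed
    then have "x + y + d' \<le> Z + P" using \<open>\<not> 0 \<le> y\<close> les by linarith
    then show False using lo PZ qq by linarith
  qed
  have x0: "0 \<le> x"
  proof -
    have "0 \<le> N' * y" using pos(2) y0 by (intro mult_nonneg_nonneg) auto
    then have "0 \<le> P' * x" using eq pos(4) by linarith
    then show ?thesis using pos(1) by (simp add: zero_le_mult_iff)
  qed
  have co: "gcd x (gcd y d') = 1"
  proof -
    let ?h = "gcd x (gcd y d')"
    have h: "?h dvd x" "?h dvd y" "?h dvd d'"
      using dvd_trans[OF gcd_dvd2[of x "gcd y d'"]] by auto
    have "?h dvd P' * x - N' * y" by (intro dvd_diff dvd_mult h(1,2))
    then have "?h dvd gcd d' Z'" unfolding eq using h(3) by (rule gcd_greatest[rotated])
    then show ?thesis unfolding cod by simp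
  qed
  have "P * x = N * y + Z * d'"
  proof -
    have "P * x - N * y = d * (P' * x - N' * y)" by (simp add: P' N' algebra_simps)
    also have "\<dots> = d * Z'" by (simp only: eq)
    also have "\<dots> = Z * d'" by (simp add: d' Z')
    finally show ?thesis by linarith
  qed
  then show ?thesis using x0 y0 pos(3) co lo up by (intro exI[of _ x] exI[of _ y] exI[of _ d']) simp
qed

text \<open>Permutations and a change of sign lead to one positive and two nonpositive coefficients.
  The lower end of the window is what \<open>cross_zero\<close> asks for with
  \<open>p = q - 1\<close>; the upper end is the sum allowed in \<open>facet_gaps\<close>.\<close>

lemma primitive_solution:
  fixes A B C q :: int
  assumes q: "2 \<le> q" and pos: "0 < A \<or> 0 < B \<or> 0 < C" and neg: "A < 0 \<or> B < 0 \<or> C < 0"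
    and d: "\<bar>A - B\<bar> \<le> q - 1" "\<bar>B - C\<bar> \<le> q - 1" "\<bar>A - C\<bar> \<le> q - 1"
  shows "\<exists>x y z. 0 \<le> x \<and> 0 \<le> y \<and> 0 \<le> z \<and> A * x + B * y + C * z = 0 \<and> gcd x (gcd y z) = 1 \<and>
    q * q - q < x + y + z \<and> x + y + z \<le> q * q"
proof -
  let ?sol = "\<lambda>A B C. \<exists>x y z. 0 \<le> x \<and> 0 \<le> y \<and> 0 \<le> z \<and> A * x + B * y + C * z = 0 \<and> gcd x (gcd y z) = 1 \<and>
    q * q - q < x + y + z \<and> x + y + z \<le> q * q"
  have s12: "?sol A B C \<Longrightarrow> ?sol B A C" for A B C
    by (elim exE, rule_tac x = y in exI, rule_tac x = x in exI, rule_tac x = z in exI)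
      (simp add: ac_simps gcd.left_commute)
  have s23: "?sol A B C \<Longrightarrow> ?sol A C B" for A B C
    by (elim exE, rule_tac x = x in exI, rule_tac x = z in exI, rule_tac x = y in exI)
      (simp add: ac_simps)
  have sn: "?sol (- A) (- B) (- C) \<Longrightarrow> ?sol A B C" for A B C
    by (elim exE, rule_tac x = x in exI, rule_tac x = y in exI, rule_tac x = z in exI)
      (auto simp: algebra_simps)
  have c0: "?sol P (- N) (- Z)" if "0 < P" "0 < N" "0 \<le> Z" "P + N \<le> q - 1" "P + Z \<le> q - 1" for P N Z
    using primitive_solution_aux[OF q that] by (simp add: algebra_simps)
  have c1: "?sol A B C" if "0 < A" "B \<le> 0" "C \<le> 0" "B < 0 \<or> C < 0" "A - B \<le> q - 1" "A - C \<le> q - 1" for A B C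
  proof (cases "B < 0")
    case True
    then show ?thesis using c0[of A "- B" "- C"] that by simp
  next
    case False
    then show ?thesis using s23[OF c0[of A "- C" "- B"]] that by simp
  qed
  have c2: "?sol A B C" if "0 < A \<and> B \<le> 0 \<and> C \<le> 0 \<or> 0 < B \<and> A \<le> 0 \<and> C \<le> 0 \<or> 0 < C \<and> A \<le> 0 \<and> B \<le> 0"
    "A < 0 \<or> B < 0 \<or> C < 0" "\<bar>A - B\<bar> \<le> q - 1" "\<bar>B - C\<bar> \<le> q - 1" "\<bar>A - C\<bar> \<le> q - 1" for A B C
    using that(1)
  proof (elim disjE)
    assume "0 < A \<and> B \<le> 0 \<and> C \<le> 0"
    then show ?thesis using c1[of A B C] that(2-) by auto
  next
    assume "0 < B \<and> A \<le> 0 \<and> C \<le> 0"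
    then show ?thesis using s12[OF c1[of B A C]] that(2-) by auto
  next
    assume "0 < C \<and> A \<le> 0 \<and> B \<le> 0"
    then show ?thesis using s23[OF s12[OF c1[of C A B]]] that(2-) by auto
  qed
  show ?thesis
  proof (cases "0 < A \<and> B \<le> 0 \<and> C \<le> 0 \<or> 0 < B \<and> A \<le> 0 \<and> C \<le> 0 \<or> 0 < C \<and> A \<le> 0 \<and> B \<le> 0")
    case True
    then show ?thesis using c2 neg d by blast
  next
    case False
    then have f: "0 < - A \<and> - B \<le> 0 \<and> - C \<le> 0 \<or> 0 < - B \<and> - A \<le> 0 \<and> - C \<le> 0 \<or> 0 < - C \<and> - A \<le> 0 \<and> - B \<le> 0"
      using pos neg by linarith
    show ?thesis
    proof (rule sn[OF c2[OF f]])
      show "- A < 0 \<or> - B < 0 \<or> - C < 0" using pos by linarith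
    qed (use d in linarith)+
  qed
qed

text \<open>The gaps N q, M q - 1, 1 solve the relation with coefficients M, -N, -N. Any relation on
  them gives \<open>c = b\<close> modulo \<open>q\<close>, so \<open>c - b\<close> is 0 or
  \<open>q\<close> up to sign; the latter forces signs that contradict
  \<open>M \<ge> 2\<close>.\<close>

lemma facet_pattern_two_equal:
  fixes M N a b c q :: int
  assumes q: "M + N = q" and M: "2 \<le> M" and N: "0 < N"
    and rel: "a * (N * q) + b * (q * q - 1 - N * q) + c = 0"
    and bd: "\<bar>a\<bar> \<le> q" "\<bar>b\<bar> \<le> q" "\<bar>c\<bar> \<le> q" "\<bar>a - b\<bar> \<le> q" "\<bar>b - c\<bar> \<le> q" "\<bar>a - c\<bar> \<le> q"
      "\<bar>a - b + c\<bar> \<le> q"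
  shows "a * N + b * M = 0 \<and> b = c"
proof -
  have q0: "0 < q" using q M N by simp
  have m: "c - b = - q * (a * N + b * M)" using rel by (simp add: algebra_simps flip: q)
  define k where "k = a * N + b * M"
  have k: "c - b = - q * k" using m by (simp add: k_def)
  have "q * \<bar>k\<bar> = \<bar>c - b\<bar>" using q0 by (simp add: k abs_mult)
  then have "q * \<bar>k\<bar> \<le> q * 1" using bd(5) by linarith
  then have "\<bar>k\<bar> \<le> 1" using q0 by simp
  then consider "k = 0" | "k = - 1" | "k = 1" by linarith
  then show ?thesis
  proof cases
    case 1
    then show ?thesis using k k_def by simp
  next
    case 2
    then have c: "c = b + q" using k by simp
    have s: "a \<le> 0" "b \<le> 0" using c bd by linarith+
    have "a * N = - 1 - b * M" using 2 k_def by linarith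
    moreover have "a * N \<le> 0" using s(1) N by (simp add: mult_nonpos_nonneg)
    moreover have "b * N \<le> a * N" using N c bd by (intro mult_right_mono) auto
    ultimately have bM: "- 1 \<le> b * M" "b * q \<le> - 1" by (simp_all add: q[symmetric] algebra_simps)
    have "b \<noteq> 0" using bM(2) by auto
    then have "b \<le> - 1" using s(2) by linarith
    then have "b * M \<le> - 1 * M" using M by (intro mult_right_mono) auto
    then show ?thesis using bM(1) M by linarith
  next
    case 3
    then have c: "c = b - q" using k by simp
    have s: "0 \<le> a" "0 \<le> b" using c bd by linarith+
    have "a * N = 1 - b * M" using 3 k_def by linarith
    moreover have "0 \<le> a * N" using s(1) N by simp
    moreover have "a * N \<le> b * N" using N c bd by (intro mult_right_mono) auto
    ultimately have bM: "b * M \<le> 1" "1 \<le> b * q" by (simp_all add: q[symmetric] algebra_simps)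
    have "b \<noteq> 0" using bM(2) by auto
    then have "1 \<le> b" using s(2) by linarith
    then have "1 * M \<le> b * M" using M by (intro mult_right_mono) auto
    then show ?thesis using bM(1) M by linarith
  qed
qed

text \<open>The gaps 1, q^2 - 1, q have the sum q^2 + q allowed for four letters. Modulo
  \<open>q\<close> a relation on them leaves \<open>a - b\<close> equal to 0 or \<open>q\<close> up
  to sign; this determines \<open>c\<close> from \<open>b\<close>, and the bounds on
  \<open>b - c\<close>, \<open>a - c\<close> and \<open>a - b + c\<close> exclude all nonzero
  cases.\<close>

lemma generic_four:
  fixes a b c q :: int
  assumes q: "2 \<le> q" and rel: "a + b * (q * q - 1) + c * q = 0"
    and bd: "\<bar>a\<bar> \<le> q" "\<bar>b\<bar> \<le> q" "\<bar>c\<bar> \<le> q" "\<bar>a - b\<bar> \<le> q" "\<bar>b - c\<bar> \<le> q" "\<bar>a - c\<bar> \<le> q"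
      "\<bar>a - b + c\<bar> \<le> q"
  shows "a = 0 \<and> b = 0 \<and> c = 0"
proof -
  have aux: "a = 0 \<and> b = 0 \<and> c = 0" if rel: "a + b * (q * q - 1) + c * q = 0" and ba: "b \<le> a"
    and bd: "\<bar>a\<bar> \<le> q" "\<bar>b\<bar> \<le> q" "\<bar>c\<bar> \<le> q" "\<bar>a - b\<bar> \<le> q" "\<bar>b - c\<bar> \<le> q" "\<bar>a - c\<bar> \<le> q"
      "\<bar>a - b + c\<bar> \<le> q" for a b c
  proof -
    define k where "k = - (b * q + c)"
    have k: "a - b = q * k" using rel by (simp add: k_def algebra_simps)
    have "q * k \<le> q * 1" "q * 0 \<le> q * k" using bd(4) ba by (simp_all flip: k)
    then have "k \<le> 1" "0 \<le> k" using q by (simp_all only: mult_le_cancel_left_pos)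
    then consider "k = 0" | "k = 1" by linarith
    then show ?thesis
    proof cases
      case 1
      then have c: "c = - (b * q)" and ab: "a = b" using k by (simp_all add: k_def)
      have "\<bar>b * (q + 1)\<bar> \<le> q" using bd(5) c by (simp add: algebra_simps)
      then have "\<bar>b\<bar> * (q + 1) < 1 * (q + 1)" using q by (simp add: abs_mult)
      then have "\<bar>b\<bar> < 1" using q by (subst (asm) mult_less_cancel_right) auto
      then show ?thesis using c ab by simp
    next
      case 2
      then have c: "c = - 1 - b * q" and ab: "a = b + q" using k by (simp_all add: k_def)
      have "(- b) * (q + 1) \<le> 1 * (q + 1)" using bd(5) c by (simp add: algebra_simps)
      then have "- b \<le> 1" using q by (subst (asm) mult_le_cancel_right) auto
      moreover have "b \<le> 0" using ab bd(1) by linarith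
      ultimately consider "b = 0" | "b = - 1" by linarith
      then show ?thesis
      proof cases
        case 1
        then have "a - c = q + 1" using c ab by simp
        then show ?thesis using bd(6) by linarith
      next
        case 2
        then have "a - b + c = 2 * q - 1" using c ab by simp
        then show ?thesis using bd(7) q by linarith
      qed
    qed
  qed
  show ?thesis
  proof (cases "b \<le> a")
    case True
    then show ?thesis using aux[OF rel True bd] by blast
  next
    case False
    have "(- a) + (- b) * (q * q - 1) + (- c) * q = 0" using rel by (simp add: algebra_simps)
    then have "- a = 0 \<and> - b = 0 \<and> - c = 0"
      by (rule aux) ((use False in linarith), (use bd(1) in linarith), (use bd(2) in linarith),
        (use bd(3) in linarith), (use bd(4) in linarith), (use bd(5) in linarith),
        (use bd(6) in linarith), (use bd(7) in linarith))
    then show ?thesis by simp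
  qed
qed

text \<open>The method of \<open>generic_four\<close> with one more digit, for gaps 1, q, q^3 - q -
  1, q^2 of sum q^3 + q^2: reduction modulo \<open>q\<close> restricts \<open>s1 - s3\<close>, and
  its carry \<open>k\<close> enters the reduction that restricts \<open>s2 - s3\<close>.\<close>

lemma generic_five:
  fixes s1 s2 s3 s4 q :: int
  assumes q: "2 \<le> q" and rel: "s1 + s2 * q + s3 * (q * q * q - q - 1) + s4 * (q * q) = 0"
    and bd: "\<bar>s1\<bar> \<le> q" "\<bar>s2\<bar> \<le> q" "\<bar>s3\<bar> \<le> q" "\<bar>s4\<bar> \<le> q" "\<bar>s1 - s2\<bar> \<le> q" "\<bar>s1 - s3\<bar> \<le> q" "\<bar>s1 - s4\<bar> \<le> q"
      "\<bar>s2 - s3\<bar> \<le> q" "\<bar>s2 - s4\<bar> \<le> q" "\<bar>s3 - s4\<bar> \<le> q" "\<bar>s2 - s3 + s4\<bar> \<le> q" "\<bar>s1 - s3 + s4\<bar> \<le> q"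
  shows "s1 = 0 \<and> s2 = 0 \<and> s3 = 0 \<and> s4 = 0"
proof -
  have aux: "s1 = 0 \<and> s2 = 0 \<and> s3 = 0 \<and> s4 = 0"
    if rel: "s1 + s2 * q + s3 * (q * q * q - q - 1) + s4 * (q * q) = 0"
      and ord: "s3 < s1 \<or> s3 = s1 \<and> s3 \<le> s2"
      and bd: "\<bar>s1\<bar> \<le> q" "\<bar>s2\<bar> \<le> q" "\<bar>s3\<bar> \<le> q" "\<bar>s4\<bar> \<le> q" "\<bar>s1 - s2\<bar> \<le> q" "\<bar>s1 - s3\<bar> \<le> q" "\<bar>s1 - s4\<bar> \<le> q"
      "\<bar>s2 - s3\<bar> \<le> q" "\<bar>s2 - s4\<bar> \<le> q" "\<bar>s3 - s4\<bar> \<le> q" "\<bar>s2 - s3 + s4\<bar> \<le> q" "\<bar>s1 - s3 + s4\<bar> \<le> q"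
    for s1 s2 s3 s4
  proof -
    define h where "h = - (s4 + q * s3)"
    define k where "k = q * h - (s2 - s3)"
    have k: "s1 - s3 = q * k" using rel by (simp add: k_def h_def algebra_simps)
    have "q * k \<le> q * 1" "q * 0 \<le> q * k" using bd(6) ord by (auto simp flip: k)
    then have "k \<le> 1" "0 \<le> k" using q by (simp_all only: mult_le_cancel_left_pos)
    have s3: "s3 = 0 \<or> s3 = - 1" if "s4 = - 1 - q * s3" "s3 \<le> 0"
    proof -
      have "(- s3) * (q + 1) \<le> 1 * (q + 1)" using bd(10) that by (simp add: algebra_simps)
      then have "- s3 \<le> 1" using q by (subst (asm) mult_le_cancel_right) auto
      then show ?thesis using that by linarith
    qed
    consider "k = 0" | "k = 1" using \<open>k \<le> 1\<close> \<open>0 \<le> k\<close> by linarith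
    then show ?thesis
    proof cases
      case 1
      then have s13: "s1 = s3" and h: "s2 - s3 = q * h" using k by (simp_all add: k_def)
      have "q * h \<le> q * 1" "q * 0 \<le> q * h" using bd(8) ord s13 by (auto simp flip: h)
      then have "h \<le> 1" "0 \<le> h" using q by (simp_all only: mult_le_cancel_left_pos)
      then consider "h = 0" | "h = 1" by linarith
      then show ?thesis
      proof cases
        case 1
        then have s4: "s4 = - (q * s3)" and s23: "s2 = s3" using h by (simp_all add: h_def)
        have "\<bar>s3 * (q + 1)\<bar> \<le> q" using bd(10) s4 by (simp add: algebra_simps)
        then have "\<bar>s3\<bar> * (q + 1) < 1 * (q + 1)" using q by (simp add: abs_mult)
        then have "\<bar>s3\<bar> < 1" using q by (subst (asm) mult_less_cancel_right) auto
        then show ?thesis using s4 s23 s13 by simp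
      next
        case 2
        then have s4: "s4 = - 1 - q * s3" and s23: "s2 = s3 + q" using h by (simp_all add: h_def)
        moreover have "s3 \<le> 0" using s23 bd(2) by linarith
        ultimately consider "s3 = 0" | "s3 = - 1" using s3 by blast
        then show ?thesis
        proof cases
          case 1
          then have "s2 - s4 = q + 1" using s4 s23 by simp
          then show ?thesis using bd(9) by linarith
        next
          case 2
          then have "s2 - s3 + s4 = 2 * q - 1" using s4 s23 by simp
          then show ?thesis using bd(11) q by linarith
        qed
      qed
    next
      case 2
      then have s13: "s1 = s3 + q" and h: "s2 - s3 + 1 = q * h" using k by (simp_all add: k_def)
      have "0 < q * h" using h s13 bd(5) by linarith
      moreover have "q * h < q * 2" using h bd(8) q by linarith
      ultimately have "q * 0 < q * h" "q * h < q * 2" by simp_all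
      then have "0 < h" "h < 2" using q by (simp_all only: mult_less_cancel_left_pos)
      then have "h = 1" by linarith
      then have s4: "s4 = - 1 - q * s3" and s23: "s2 = s3 + q - 1" using h by (simp_all add: h_def)
      moreover have "s3 \<le> 0" using s13 bd(1) by linarith
      ultimately consider "s3 = 0" | "s3 = - 1" using s3 by blast
      then show ?thesis
      proof cases
        case 1
        then have "s1 - s4 = q + 1" using s4 s13 by simp
        then show ?thesis using bd(7) by linarith
      next
        case 2
        then have "s1 - s3 + s4 = 2 * q - 1" using s4 s13 by simp
        then show ?thesis using bd(12) q by linarith
      qed
    qed
  qed
  show ?thesis
  proof (cases "s3 < s1 \<or> s3 = s1 \<and> s3 \<le> s2")
    case True
    show ?thesis by (rule aux[OF rel True bd])
  next
    case False
    have "(- s1) + (- s2) * q + (- s3) * (q * q * q - q - 1) + (- s4) * (q * q) = 0"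
      using rel by (simp add: algebra_simps)
    moreover have "- s3 < - s1 \<or> - s3 = - s1 \<and> - s3 \<le> - s2" using False by linarith
    ultimately have "- s1 = 0 \<and> - s2 = 0 \<and> - s3 = 0 \<and> - s4 = 0"
      by (rule aux) ((use bd(1) in linarith), (use bd(2) in linarith),
        (use bd(3) in linarith), (use bd(4) in linarith), (use bd(5) in linarith),
        (use bd(6) in linarith), (use bd(7) in linarith), (use bd(8) in linarith),
        (use bd(9) in linarith), (use bd(10) in linarith), (use bd(11) in linarith),
        (use bd(12) in linarith))
    then show ?thesis by simp
  qed
qed

text \<open>The gaps belonging to \<open>si\<close>, \<open>sm\<close>, \<open>so\<close> are those
  of \<open>generic_four\<close>; the gap of \<open>sj\<close> is what the relation with
  coefficients 1, -z, 1 - q, 1 - q then dictates. So \<open>sj = 0\<close> leaves only the zero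
  relation, and otherwise the long gap forces \<open>sj\<close> to be 1 up to sign.\<close>

lemma unit_pattern_model:
  fixes sj si sm so z q :: int
  assumes q: "2 \<le> q" and z: "0 \<le> z" "z \<le> q - 1"
    and rel: "sj * ((q - 1) * (q * q - 1 + q) + z) + si + sm * (q * q - 1) + so * q = 0"
    and bd: "\<bar>sj\<bar> \<le> q" "\<bar>si\<bar> \<le> q" "\<bar>sm\<bar> \<le> q" "\<bar>so\<bar> \<le> q" "\<bar>sj - si\<bar> \<le> q" "\<bar>sj - sm\<bar> \<le> q" "\<bar>sj - so\<bar> \<le> q"
      "\<bar>si - sm\<bar> \<le> q" "\<bar>sm - so\<bar> \<le> q" "\<bar>si - so\<bar> \<le> q" "\<bar>si - sm + so\<bar> \<le> q"
  shows "si = - z * sj \<and> sm = - (q - 1) * sj \<and> so = - (q - 1) * sj"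
proof -
  define G where "G = q * q - 1 + q"
  have aux: "si = - z * sj \<and> sm = - (q - 1) * sj \<and> so = - (q - 1) * sj"
    if rel: "sj * ((q - 1) * G + z) + si + sm * (q * q - 1) + so * q = 0" and "0 < sj"
      and bd: "\<bar>sj - si\<bar> \<le> q" "\<bar>sj - sm\<bar> \<le> q" "\<bar>sj - so\<bar> \<le> q" for sj si sm so
  proof -
    have qq: "q * 2 \<le> q * q" using q by (intro mult_left_mono) auto
    \<comment> \<open>The other coefficients are at least \<open>sj - q\<close>. Measured from
      there, all terms are nonnegative, and comparing sizes gives first \<open>sj = 1\<close> and
      then \<open>b = c = 0\<close>.\<close>
    define a b c where "a = si - (sj - q)" and "b = sm - (sj - q)" and "c = so - (sj - q)"
    have nn: "0 \<le> a" "0 \<le> b" "0 \<le> c"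
      unfolding a_def b_def c_def using bd(1) bd(2) bd(3) by linarith+
    have e: "a + b * (q * q - 1) + c * q = q * (1 + G) - sj * (q * G + z + 1)"
      using rel by (simp add: a_def b_def c_def G_def algebra_simps)
    have bq: "0 \<le> b * (q * q - 1)" "0 \<le> c * q" using nn qq q by (intro mult_nonneg_nonneg; simp)+
    have "1 \<le> G" unfolding G_def using qq q by linarith
    then have qG: "q * 1 \<le> q * G" using q by (intro mult_left_mono) auto
    have "q * (1 + G) < 2 * (q * G + z + 1)"
    proof -
      have "q + X < 2 * (X + z + 1)" if "q \<le> X" for X
        using that z unfolding distrib_left by linarith
      from this[of "q * G"] qG show ?thesis by (simp add: distrib_left)
    qed
    moreover have "sj * (q * G + z + 1) \<le> q * (1 + G)" using e nn bq by linarith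
    moreover have pos: "0 < q * G + z + 1" using q qG z by linarith
    ultimately have "sj * (q * G + z + 1) < 2 * (q * G + z + 1)" by linarith
    then have sj: "sj = 1" using pos \<open>0 < sj\<close> by (subst (asm) mult_less_cancel_right) auto
    have e1: "a + b * (q * q - 1) + c * q = q - 1 - z" using e sj by (simp add: algebra_simps)
    have "b = 0"
    proof (rule ccontr)
      assume "b \<noteq> 0"
      then have "1 \<le> b" using nn(2) by linarith
      moreover have "0 \<le> q * q - 1" using qq q by linarith
      ultimately have "1 * (q * q - 1) \<le> b * (q * q - 1)" by (rule mult_right_mono)
      then have "q * q - 1 \<le> b * (q * q - 1)" by (simp only: mult_1_left)
      moreover have False if "q * q - 1 \<le> B" "a + B + C = q - 1 - z" "0 \<le> C" for B C
        using that nn(1) qq q z(1) by linarith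
      ultimately show False using e1 bq(2) by blast
    qed
    moreover have "c = 0"
    proof (rule ccontr)
      assume "c \<noteq> 0"
      then have "q \<le> c * q" using mult_right_mono[of 1 c q] nn q by simp
      moreover have False if "q \<le> C" "a + B + C = q - 1 - z" "0 \<le> B" for B C
        using that nn(1) z(1) by linarith
      ultimately show False using e1 bq(1) by blast
    qed
    ultimately show ?thesis using e1 sj by (simp add: a_def b_def c_def)
  qed
  consider "sj = 0" | "0 < sj" | "sj < 0" by linarith
  then show ?thesis
  proof cases
    case 1
    then have "si + sm * (q * q - 1) + so * q = 0" using rel by simp
    then have "si = 0 \<and> sm = 0 \<and> so = 0" by (rule generic_four[OF q _ bd(2-4) bd(8-11)])
    then show ?thesis using 1 by simp
  next
    case 2
    have "sj * ((q - 1) * G + z) + si + sm * (q * q - 1) + so * q = 0" using rel by (simp only: G_def)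
    then show ?thesis by (rule aux[OF _ 2 bd(5-7)])
  next
    case 3
    have "(- sj) * ((q - 1) * G + z) + (- si) + (- sm) * (q * q - 1) + (- so) * q = 0"
      using rel by (simp add: G_def algebra_simps)
    then have "- si = - z * - sj \<and> - sm = - (q - 1) * - sj \<and> - so = - (q - 1) * - sj"
      by (rule aux) ((use 3 in linarith), (use bd(5) in linarith), (use bd(6) in linarith),
        (use bd(7) in linarith))
    then show ?thesis by simp
  qed
qed

text \<open>The hypotheses of \<open>primitive_solution\<close> for three of the gaps; the fourth
  gap will be closed.\<close>

definition short_triple :: "int \<Rightarrow> int \<Rightarrow> int \<Rightarrow> int \<Rightarrow> bool" where
  "short_triple q a b c \<longleftrightarrow> (0 < a \<or> 0 < b \<or> 0 < c) \<and> (a < 0 \<or> b < 0 \<or> c < 0) \<and>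
     \<bar>a - b\<bar> \<le> q - 1 \<and> \<bar>b - c\<bar> \<le> q - 1 \<and> \<bar>a - c\<bar> \<le> q - 1"

text \<open>Obstructions, up to negation and reversal. In each family the negative extreme lies
  exactly \<open>q\<close> below the positive one and occupies two neighbouring places, the shape
  used in \<open>soluble_pattern_triple\<close> and \<open>soluble_unit_pattern\<close>.\<close>

definition extremal_pattern :: "int \<Rightarrow> int \<Rightarrow> int \<Rightarrow> int \<Rightarrow> int \<Rightarrow> bool" where
  "extremal_pattern q a b c d \<longleftrightarrow>
     0 < a \<and> a = b \<and> c = d \<and> c = a - q \<and> c < 0 \<or>
     0 < a \<and> b = a - q \<and> c = b \<and> b < 0 \<and> b \<le> d \<and> d \<le> 0 \<or>
     0 < a \<and> c = a - q \<and> d = c \<and> c < 0 \<and> c \<le> b \<and> b \<le> 0 \<or>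
     a = 0 \<and> 0 < b \<and> c = b - q \<and> d = c \<and> c < 0"

text \<open>If the extreme values of the four numbers differ by \<open>q\<close> and no three of them form a short triple,
  then each extreme value is attained twice or is the only one of its sign.\<close>

lemma four_term_patterns:
  fixes a b c d q :: int
  assumes bd: "\<bar>a\<bar> \<le> q" "\<bar>b\<bar> \<le> q" "\<bar>c\<bar> \<le> q" "\<bar>d\<bar> \<le> q" "\<bar>a - b\<bar> \<le> q" "\<bar>a - c\<bar> \<le> q" "\<bar>a - d\<bar> \<le> q"
      "\<bar>b - c\<bar> \<le> q" "\<bar>b - d\<bar> \<le> q" "\<bar>c - d\<bar> \<le> q"
      "\<bar>a - b + c\<bar> \<le> q" "\<bar>a - b + d\<bar> \<le> q" "\<bar>a - c + d\<bar> \<le> q" "\<bar>b - c + d\<bar> \<le> q" "\<bar>a - b + c - d\<bar> \<le> q"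
    and pos: "0 < a \<or> 0 < b \<or> 0 < c \<or> 0 < d" and neg: "a < 0 \<or> b < 0 \<or> c < 0 \<or> d < 0"
  shows "short_triple q a b c \<or> short_triple q a b d \<or> short_triple q a c d \<or> short_triple q b c d \<or>
    a = 0 \<and> b = 0 \<or> a = 0 \<and> c = 0 \<or> a = 0 \<and> d = 0 \<or> b = 0 \<and> c = 0 \<or> b = 0 \<and> d = 0 \<or> c = 0 \<and> d = 0 \<or>
    extremal_pattern q a b c d \<or> extremal_pattern q d c b a \<or>
    extremal_pattern q (- a) (- b) (- c) (- d) \<or> extremal_pattern q (- d) (- c) (- b) (- a)"
  unfolding short_triple_def extremal_pattern_def using bd pos neg by (smt (z3))

text \<open>A finite check for \<open>soluble_two_pattern\<close>: the gaps 1, 5, 4, 2 satisfy the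
  relation with coefficients 1, 1, -1, -1 and have the sum 12 = 2^3 + 2^2.\<close>

lemma two_pattern_relation:
  fixes a b c d :: int
  assumes r: "a + b * 5 + c * 4 + d * 2 = 0"
    and bd: "\<bar>a\<bar> \<le> 2" "\<bar>b\<bar> \<le> 2" "\<bar>c\<bar> \<le> 2" "\<bar>d\<bar> \<le> 2"
    "\<bar>a - b\<bar> \<le> 2" "\<bar>a - c\<bar> \<le> 2" "\<bar>a - d\<bar> \<le> 2"
    "\<bar>b - c\<bar> \<le> 2" "\<bar>b - d\<bar> \<le> 2" "\<bar>c - d\<bar> \<le> 2"
    "\<bar>a - b + c\<bar> \<le> 2" "\<bar>a - b + d\<bar> \<le> 2"
    "\<bar>a - c + d\<bar> \<le> 2" "\<bar>b - c + d\<bar> \<le> 2"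
  shows "a = b \<and> c = - b \<and> d = - b"
proof -
  have "a \<in> {-2..2}" "b \<in> {-2..2}" "c \<in> {-2..2}" using bd(1-3) by auto
  moreover have "{-2..2::int} = {-2, -1, 0, 1, 2}" by auto
  ultimately have "a \<in> {-2, -1, 0, 1, 2}" "b \<in> {-2, -1, 0, 1, 2}" "c \<in> {-2, -1, 0, 1, 2}" by simp_all
  then show ?thesis using r bd(4-) by (elim insertE emptyE) (simp_all, presburger+)?
qed

section \<open>Gaps adapted to a single relation between five letters\<close>

text \<open>Here \<open>S\<close> are the gap coefficients of the only relation of a five-letter tuple, up to multiples, and
  \<open>g\<close> are the gaps of a model, respectively of a degenerate tuple that can be lifted to a model.\<close>

definition parallel4 :: "(nat \<Rightarrow> int) \<Rightarrow> (nat \<Rightarrow> int) \<Rightarrow> bool" where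
  "parallel4 \<sigma> S \<longleftrightarrow> (\<forall>a<4. \<forall>b<4. \<sigma> a * S b = \<sigma> b * S a)"

definition model_gaps :: "nat \<Rightarrow> (nat \<Rightarrow> int) \<Rightarrow> bool" where
  "model_gaps q S \<longleftrightarrow> (\<exists>g. (\<forall>k<4. 0 < g k) \<and> (\<Sum>k<4. S k * g k) = 0 \<and>
     (\<Sum>k<4. g k) \<le> int (q ^ 3 + q\<^sup>2) \<and>
     (\<forall>\<sigma>. gap_bounded 4 q \<sigma> \<longrightarrow> (\<Sum>k<4. \<sigma> k * g k) = 0 \<longrightarrow> parallel4 \<sigma> S))"

text \<open>The sum may only be q^2 because \<open>facet_lift\<close> adds q^3. Proportionality is
  asked off the index \<open>j\<close> only: modulo \<open>S\<close>, such a relation then reduces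
  to the \<open>j\<close>-th gap, which is the condition \<open>key\<close> of
  \<open>facet_lift\<close>.\<close>

definition facet_gaps :: "nat \<Rightarrow> (nat \<Rightarrow> int) \<Rightarrow> bool" where
  "facet_gaps q S \<longleftrightarrow> (\<exists>g. \<exists>j<4. (\<forall>k<4. 0 \<le> g k) \<and> g j = 0 \<and> (\<Sum>k<4. S k * g k) = 0 \<and>
     (\<Sum>k<4. g k) \<le> int (q\<^sup>2) \<and>
     (\<forall>\<sigma>. gap_bounded 4 q \<sigma> \<longrightarrow> (\<Sum>k<4. \<sigma> k * g k) = 0 \<longrightarrow>
       (\<forall>a<4. \<forall>b<4. a \<noteq> j \<longrightarrow> b \<noteq> j \<longrightarrow> \<sigma> a * S b = \<sigma> b * S a)))"

definition soluble :: "nat \<Rightarrow> (nat \<Rightarrow> int) \<Rightarrow> bool" where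
  "soluble q S \<longleftrightarrow> model_gaps q S \<or> facet_gaps q S"

lemma soluble_uminus:
  assumes "soluble q (\<lambda>k. - S k)"
  shows "soluble q S"
  using assms
  by (simp add: soluble_def model_gaps_def facet_gaps_def parallel4_def sum_negf)

lemma less4_rev: "k < 4 \<Longrightarrow> 3 - k < (4::nat)" "k < 4 \<Longrightarrow> 3 - (3 - k) = (k::nat)"
  by auto

lemma sum_rev4:
  fixes f :: "nat \<Rightarrow> int"
  shows "(\<Sum>k<4. f (3 - k)) = (\<Sum>k<4. f k)"
  by (simp add: sum_lt4)

lemma gap_bounded_rev:
  assumes "gap_bounded 4 q \<sigma>"
  shows "gap_bounded 4 q (\<lambda>k. \<sigma> (3 - k))"
proof -
  have 1: "\<bar>\<sigma> a\<bar> \<le> int q" if "a < 4" for a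
    using assms that by (simp add: gap_bounded_def)
  have 2: "\<bar>\<sigma> a - \<sigma> b\<bar> \<le> int q" if "b < 4" "a < b" for a b
    using assms that by (simp add: gap_bounded_def)
  have 3: "\<bar>\<sigma> a - \<sigma> b + \<sigma> c\<bar> \<le> int q" if "c < 4" "b < c" "a < b" for a b c
    using assms that by (simp add: gap_bounded_def)
  have 4: "\<bar>\<sigma> a - \<sigma> b + \<sigma> c - \<sigma> d\<bar> \<le> int q" if "d < 4" "c < d" "b < c" "a < b" for a b c d
    using assms that by (simp add: gap_bounded_def)
  show ?thesis
    unfolding gap_bounded_def
  proof (intro conjI allI impI)
    fix a :: nat assume "a < 4"
    then show "\<bar>\<sigma> (3 - a)\<bar> \<le> int q" by (intro 1) simp
  next
    fix a b :: nat assume "b < 4" "a < b"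
    then have "3 - a < 4" "3 - b < 3 - a" by arith+
    from 2[OF this] show "\<bar>\<sigma> (3 - a) - \<sigma> (3 - b)\<bar> \<le> int q" by linarith
  next
    fix a b c :: nat assume "c < 4" "b < c" "a < b"
    then have "3 - a < 4" "3 - b < 3 - a" "3 - c < 3 - b" by arith+
    from 3[OF this] show "\<bar>\<sigma> (3 - a) - \<sigma> (3 - b) + \<sigma> (3 - c)\<bar> \<le> int q" by linarith
  next
    fix a b c d :: nat assume "d < 4" "c < d" "b < c" "a < b"
    then have "3 - a < 4" "3 - b < 3 - a" "3 - c < 3 - b" "3 - d < 3 - c" by arith+
    from 4[OF this] show "\<bar>\<sigma> (3 - a) - \<sigma> (3 - b) + \<sigma> (3 - c) - \<sigma> (3 - d)\<bar> \<le> int q" by linarith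
  qed
qed

lemma soluble_rev:
  assumes "soluble q (\<lambda>k. S (3 - k))"
  shows "soluble q S"
  using assms unfolding soluble_def
proof
  assume "model_gaps q (\<lambda>k. S (3 - k))"
  then obtain g where g: "\<forall>k<4. 0 < g k" "(\<Sum>k<4. S (3 - k) * g k) = 0"
    "(\<Sum>k<4. g k) \<le> int (q ^ 3 + q\<^sup>2)"
    "\<And>\<sigma>. \<lbrakk>gap_bounded 4 q \<sigma>; (\<Sum>k<4. \<sigma> k * g k) = 0\<rbrakk> \<Longrightarrow> parallel4 \<sigma> (\<lambda>k. S (3 - k))"
    unfolding model_gaps_def by blast
  have "model_gaps q S"
    unfolding model_gaps_def
  proof (intro exI[of _ "\<lambda>k. g (3 - k)"] conjI allI impI)
    show "0 < g (3 - k)" if "k < 4" for k using g(1) by simp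
    show "(\<Sum>k<4. S k * g (3 - k)) = 0" using g(2) by (simp add: sum_lt4)
    show "(\<Sum>k<4. g (3 - k)) \<le> int (q ^ 3 + q\<^sup>2)" using g(3) by (simp only: sum_rev4)
  next
    fix \<sigma> assume \<sigma>: "gap_bounded 4 q \<sigma>" "(\<Sum>k<4. \<sigma> k * g (3 - k)) = 0"
    have "(\<Sum>k<4. \<sigma> (3 - k) * g k) = 0" using \<sigma>(2) by (simp add: sum_lt4)
    from g(4)[OF gap_bounded_rev[OF \<sigma>(1)] this]
    have p: "\<sigma> (3 - a) * S (3 - b) = \<sigma> (3 - b) * S (3 - a)" if "a < 4" "b < 4" for a b
      using that unfolding parallel4_def by blast
    show "parallel4 \<sigma> S"
      unfolding parallel4_def
    proof (intro allI impI)
      fix a b :: nat assume "a < 4" "b < 4"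
      then show "\<sigma> a * S b = \<sigma> b * S a" using p[of "3 - a" "3 - b"] by simp
    qed
  qed
  then show "model_gaps q S \<or> facet_gaps q S" ..
next
  assume "facet_gaps q (\<lambda>k. S (3 - k))"
  then obtain g j where g: "j < 4" "\<forall>k<4. 0 \<le> g k" "g j = 0" "(\<Sum>k<4. S (3 - k) * g k) = 0"
    "(\<Sum>k<4. g k) \<le> int (q\<^sup>2)"
    "\<And>\<sigma>. \<lbrakk>gap_bounded 4 q \<sigma>; (\<Sum>k<4. \<sigma> k * g k) = 0\<rbrakk> \<Longrightarrow>
       (\<forall>a<4. \<forall>b<4. a \<noteq> j \<longrightarrow> b \<noteq> j \<longrightarrow> \<sigma> a * S (3 - b) = \<sigma> b * S (3 - a))"
    unfolding facet_gaps_def by blast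
  have "facet_gaps q S"
    unfolding facet_gaps_def
  proof (intro exI[of _ "\<lambda>k. g (3 - k)"] exI[of _ "3 - j"] conjI allI impI)
    show "3 - j < 4" by simp
    show "0 \<le> g (3 - k)" if "k < 4" for k using g(2) by simp
    show "g (3 - (3 - j)) = 0" using g(1,3) by (simp add: less4_rev)
    show "(\<Sum>k<4. S k * g (3 - k)) = 0" using g(4) by (simp add: sum_lt4)
    show "(\<Sum>k<4. g (3 - k)) \<le> int (q\<^sup>2)" using g(5) by (simp only: sum_rev4)
  next
    fix \<sigma> a b assume \<sigma>: "gap_bounded 4 q \<sigma>" "(\<Sum>k<4. \<sigma> k * g (3 - k)) = 0"
      and ab: "a < 4" "b < 4" "a \<noteq> 3 - j" "b \<noteq> 3 - j"
    have "(\<Sum>k<4. \<sigma> (3 - k) * g k) = 0" using \<sigma>(2) by (simp add: sum_lt4)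
    from g(6)[OF gap_bounded_rev[OF \<sigma>(1)] this]
    have p: "\<sigma> (3 - c) * S (3 - d) = \<sigma> (3 - d) * S (3 - c)" if "c < 4" "d < 4" "c \<noteq> j" "d \<noteq> j" for c d
      using that by blast
    have "3 - a \<noteq> j" "3 - b \<noteq> j" using ab by auto
    then show "\<sigma> a * S b = \<sigma> b * S a" using p[of "3 - a" "3 - b"] ab by simp
  qed
  then show "model_gaps q S \<or> facet_gaps q S" ..
qed

text \<open>With gap \<open>j\<close> closed, only three coefficients matter; the order of
  \<open>i0\<close>, \<open>i1\<close>, \<open>i2\<close> is what supplies the alternating bound on
  \<open>a - b + c\<close>.\<close>

lemma facet_of_triple:
  assumes idx: "j < 4" "i0 < i1" "i1 < i2" "i2 < 4" "j \<noteq> i0" "j \<noteq> i1" "j \<noteq> i2"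
    and nn: "0 \<le> x" "0 \<le> y" "0 \<le> z" and S: "S i0 * x + S i1 * y + S i2 * z = 0" and size: "x + y + z \<le> int (q\<^sup>2)"
    and par: "\<And>a b c. \<lbrakk>a * x + b * y + c * z = 0; \<bar>a\<bar> \<le> int q; \<bar>b\<bar> \<le> int q; \<bar>c\<bar> \<le> int q; \<bar>a - b\<bar> \<le> int q; \<bar>b - c\<bar> \<le> int q;
      \<bar>a - c\<bar> \<le> int q; \<bar>a - b + c\<bar> \<le> int q\<rbrakk> \<Longrightarrow>
      a * S i1 = b * S i0 \<and> a * S i2 = c * S i0 \<and> b * S i2 = c * S i1"
  shows "soluble q S"
proof -
  define g where "g = (\<lambda>k. if k = i0 then x else if k = i1 then y else if k = i2 then z else 0 :: int)"
  have univ: "{..<4} = {j, i0, i1, i2}"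
  proof (rule sym, rule card_subset_eq)
    show "card {j, i0, i1, i2} = card {..<4::nat}" using idx by simp
  qed (use idx in auto)
  have sum: "(\<Sum>k<4. f k * g k) = f i0 * x + f i1 * y + f i2 * z" for f
    unfolding univ using idx by (simp add: g_def)
  have "facet_gaps q S"
    unfolding facet_gaps_def
  proof (intro exI[of _ g] exI[of _ j] conjI allI impI)
    show "j < 4" by (rule idx)
    show "0 \<le> g k" for k using nn by (simp add: g_def)
    show "g j = 0" using idx by (simp add: g_def)
    show "(\<Sum>k<4. S k * g k) = 0" using S by (simp only: sum)
    show "(\<Sum>k<4. g k) \<le> int (q\<^sup>2)" using sum[of "\<lambda>_. 1"] size by simp
  next
    fix \<sigma> a b assume \<sigma>: "gap_bounded 4 q \<sigma>" "(\<Sum>k<4. \<sigma> k * g k) = 0"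
      and ab: "a < 4" "b < 4" "a \<noteq> j" "b \<noteq> j"
    have p: "\<sigma> i0 * S i1 = \<sigma> i1 * S i0 \<and> \<sigma> i0 * S i2 = \<sigma> i2 * S i0 \<and> \<sigma> i1 * S i2 = \<sigma> i2 * S i1"
    proof (rule par)
      show "\<sigma> i0 * x + \<sigma> i1 * y + \<sigma> i2 * z = 0" using \<sigma>(2) by (simp only: sum)
    qed (use \<sigma>(1) idx in \<open>simp_all add: gap_bounded_def\<close>)
    have "a \<in> {i0, i1, i2}" "b \<in> {i0, i1, i2}" using ab univ by auto
    then show "\<sigma> a * S b = \<sigma> b * S a" using p by (elim insertE emptyE) simp_all
  qed
  then show ?thesis by (simp add: soluble_def)
qed

text \<open>At the solution from \<open>primitive_solution\<close>, whose sum exceeds (q - 1) q,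
  \<open>cross_zero\<close> makes every bounded relation that holds proportional to
  \<open>S\<close>.\<close>

lemma soluble_short_triple:
  assumes q: "2 \<le> q" and idx: "j < 4" "i0 < i1" "i1 < i2" "i2 < 4" "j \<noteq> i0" "j \<noteq> i1" "j \<noteq> i2"
    and short: "short_triple (int q) (S i0) (S i1) (S i2)"
  shows "soluble q S"
proof -
  have q': "2 \<le> int q" using q by simp
  have pos: "0 < S i0 \<or> 0 < S i1 \<or> 0 < S i2" and neg: "S i0 < 0 \<or> S i1 < 0 \<or> S i2 < 0"
    and d: "\<bar>S i0 - S i1\<bar> \<le> int q - 1" "\<bar>S i1 - S i2\<bar> \<le> int q - 1" "\<bar>S i0 - S i2\<bar> \<le> int q - 1"
    using short unfolding short_triple_def by blast+
  from primitive_solution[OF q' pos neg d]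
  obtain x y z where sol: "0 \<le> x \<and> 0 \<le> y \<and> 0 \<le> z \<and> S i0 * x + S i1 * y + S i2 * z = 0 \<and> gcd x (gcd y z) = 1 \<and>
    int q * int q - int q < x + y + z \<and> x + y + z \<le> int q * int q"
    by (elim exE)
  then have xyz: "0 \<le> x" "0 \<le> y" "0 \<le> z" "S i0 * x + S i1 * y + S i2 * z = 0" "gcd x (gcd y z) = 1"
    "int q * int q - int q < x + y + z" "x + y + z \<le> int q * int q"
    by blast+
  show ?thesis
  proof (rule facet_of_triple[where S = S, OF idx xyz(1-4)])
    show "x + y + z \<le> int (q\<^sup>2)" using xyz(7) by (simp add: power2_eq_square)
    fix a b c assume r: "a * x + b * y + c * z = 0"
      and bd: "\<bar>a - b\<bar> \<le> int q" "\<bar>b - c\<bar> \<le> int q" "\<bar>a - c\<bar> \<le> int q"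
    have "(int q - 1) * int q < x + y + z" using xyz(6) by (simp add: left_diff_distrib)
    note cross = cross_zero[OF xyz(5,1-4) r bd d this]
    show "a * S i1 = b * S i0 \<and> a * S i2 = c * S i0 \<and> b * S i2 = c * S i1"
      by (intro conjI cross)
  qed
qed

text \<open>Two coefficients differ by \<open>q\<close>, so \<open>cross_zero\<close> would require
  a sum above q^2. Explicit gaps N q, M q - 1, 1 of sum q^2 replace the general solution.\<close>

lemma soluble_pattern_triple:
  assumes q: "2 \<le> q" and idx: "j < 4" "i0 < i1" "i1 < i2" "i2 < 4" "j \<noteq> i0" "j \<noteq> i1" "j \<noteq> i2"
    and S: "2 \<le> S i0" "S i1 = S i0 - int q" "S i2 = S i1" "S i1 < 0"
  shows "soluble q S"
proof -
  define M N Q where "M = S i0" and "N = - S i1" and "Q = int q"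
  have MN: "M + N = Q" "2 \<le> M" "0 < N" and Q: "2 \<le> Q"
    and S': "S i0 = M" "S i1 = - N" "S i2 = - N"
    using S q by (auto simp: M_def N_def Q_def)
  have QQ: "Q * Q = M * Q + N * Q" unfolding MN(1)[symmetric] by (rule distrib_right)
  have "2 * 2 \<le> M * Q" using MN(2) Q by (intro mult_mono) auto
  then have y0: "0 \<le> Q * Q - 1 - N * Q" using QQ by linarith
  show ?thesis
  proof (rule facet_of_triple[OF idx _ y0, of "N * Q" 1])
    show "0 \<le> N * Q" using MN Q by simp
    have "M * (N * Q) + (- N) * (Q * Q - 1 - N * Q) + (- N) * 1 = N * (M * Q + N * Q - Q * Q)"
      by (simp add: algebra_simps)
    then show "S i0 * (N * Q) + S i1 * (Q * Q - 1 - N * Q) + S i2 * 1 = 0"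
      unfolding S' QQ by simp
    show "N * Q + (Q * Q - 1 - N * Q) + 1 \<le> int (q\<^sup>2)" by (simp add: Q_def power2_eq_square)
  next
    fix a b c :: int
    assume r: "a * (N * Q) + b * (Q * Q - 1 - N * Q) + c * 1 = 0"
      and bd: "\<bar>a\<bar> \<le> int q" "\<bar>b\<bar> \<le> int q" "\<bar>c\<bar> \<le> int q" "\<bar>a - b\<bar> \<le> int q" "\<bar>b - c\<bar> \<le> int q"
      "\<bar>a - c\<bar> \<le> int q" "\<bar>a - b + c\<bar> \<le> int q"
    have "a * (N * Q) + b * (Q * Q - 1 - N * Q) + c = 0" using r by simp
    from facet_pattern_two_equal[OF MN this bd[folded Q_def]]
    have f: "a * N + b * M = 0" and bc: "b = c" by blast+
    have "a * - N = b * M" using f by linarith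
    then show "a * S i1 = b * S i0 \<and> a * S i2 = c * S i0 \<and> b * S i2 = c * S i1"
      unfolding S' bc by simp
  qed simp
qed

text \<open>Gaps 1 and \<open>q\<close> at the zeros of \<open>S\<close>, and 0 elsewhere, satisfy
  \<open>S\<close> trivially, while a bounded relation that holds there must vanish at both
  places.\<close>

lemma soluble_two_zeros:
  assumes q: "2 \<le> q" and idx: "j < 4" "y < z" "z < 4" "y \<noteq> j" "z \<noteq> j"
    and S: "S y = 0" "S z = 0"
  shows "soluble q S"
proof -
  define g where "g = (\<lambda>k. if k = y then 1 else if k = z then int q else 0)"
  have sum: "(\<Sum>k<4. f k * g k) = f y + f z * int q" for f :: "nat \<Rightarrow> int"
  proof -
    have "(\<Sum>k<4. f k * g k) = (\<Sum>k\<in>{y, z}. f k * g k)"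
      using idx by (intro sum.mono_neutral_right) (auto simp: g_def)
    then show ?thesis using idx by (simp add: g_def)
  qed
  have qq: "1 + int q \<le> int q * int q"
  proof -
    have "2 * int q \<le> int q * int q" using q by (intro mult_right_mono) auto
    then show ?thesis using q by linarith
  qed
  have "facet_gaps q S"
    unfolding facet_gaps_def
  proof (intro exI[of _ g] exI[of _ j] conjI allI impI)
    show "j < 4" by (rule idx)
    show "0 \<le> g k" for k by (simp add: g_def)
    show "g j = 0" using idx by (simp add: g_def)
    show "(\<Sum>k<4. S k * g k) = 0" using S by (simp add: sum)
    show "(\<Sum>k<4. g k) \<le> int (q\<^sup>2)" using sum[of "\<lambda>_. 1"] qq by (simp add: power2_eq_square)
  next
    fix \<sigma> a b assume \<sigma>: "gap_bounded 4 q \<sigma>" "(\<Sum>k<4. \<sigma> k * g k) = 0"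
      and ab: "a < 4" "b < 4" "a \<noteq> j" "b \<noteq> j"
    have r: "\<sigma> y = - (\<sigma> z * int q)" using \<sigma>(2) by (simp only: sum)
    have bd: "\<bar>\<sigma> y\<bar> \<le> int q" "\<bar>\<sigma> y - \<sigma> z\<bar> \<le> int q" using \<sigma>(1) idx by (simp_all add: gap_bounded_def)
    have "\<sigma> y - \<sigma> z = - (\<sigma> z * (int q + 1))" using r by (simp add: algebra_simps)
    then have "\<bar>\<sigma> z\<bar> * (int q + 1) < 1 * (int q + 1)" using bd(2) by (simp add: abs_mult)
    then have z0: "\<sigma> z = 0" by (subst (asm) mult_less_cancel_right) auto
    then have y0: "\<sigma> y = 0" using r by simp
    show "\<sigma> a * S b = \<sigma> b * S a"
    proof (cases "a = b \<or> a \<in> {y, z} \<or> b \<in> {y, z}")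
      case True
      then show ?thesis using z0 y0 S by auto
    next
      case False
      \<comment> \<open>There are not two different indices below 4 other than \<open>y\<close>,
        \<open>z\<close> and \<open>j\<close>.\<close>
      have "card {a, b, y, z, j} = 5" using False ab idx by auto
      moreover have "card {a, b, y, z, j} \<le> card {..<4::nat}" using ab idx by (intro card_mono) auto
      ultimately show ?thesis by simp
    qed
  qed
  then show ?thesis by (simp add: soluble_def)
qed

text \<open>The gap \<open>j\<close> is determined by the three others. It is so long that a relation with
  nonzero coefficient there must be a multiple of the given one.\<close>

lemma soluble_unit_pattern:
  assumes q: "2 \<le> q" and idx: "{j, i, m, l} = {..<4}" "i < m \<and> m < l \<or> l < m \<and> m < i"
    and S: "S j = 1" "S m = 1 - int q" "S l = 1 - int q" "S i \<le> 0" "1 - int q \<le> S i"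
  shows "soluble q S"
proof -
  define Q where "Q = int q"
  define z where "z = - S i"
  have Q: "2 \<le> Q" and z: "0 \<le> z" "z \<le> Q - 1"
    and S': "S j = 1" "S m = - (Q - 1)" "S l = - (Q - 1)" "S i = - z"
    using S q by (auto simp: Q_def z_def)
  have lt: "j < 4" "i < 4" "m < 4" "l < 4" using idx(1) by auto
  have "card {j, i, m, l} = 4" using idx(1) by simp
  then have dist: "j \<noteq> i" "j \<noteq> m" "j \<noteq> l" "i \<noteq> m" "i \<noteq> l" "m \<noteq> l"
    by (auto simp: card_insert_if split: if_splits)
  define J where "J = (Q - 1) * (Q * Q - 1 + Q) + z"
  define g where "g = (\<lambda>k. if k = j then J else if k = i then 1 else if k = m then Q * Q - 1 else Q)"
  have sum: "(\<Sum>k<4. f k * g k) = f j * J + f i + f m * (Q * Q - 1) + f l * Q" for f :: "nat \<Rightarrow> int"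
    unfolding idx(1)[symmetric] using dist by (simp add: g_def)
  have "2 * Q \<le> Q * Q" using Q by (intro mult_right_mono) auto
  then have QQ: "0 < Q * Q - 1" using Q by linarith
  then have J: "0 < J" using Q z by (auto simp: J_def intro!: add_pos_nonneg mult_pos_pos)
  have "model_gaps q S"
    unfolding model_gaps_def
  proof (intro exI[of _ g] conjI allI impI)
    show "0 < g k" for k using J QQ Q by (simp add: g_def)
    show "(\<Sum>k<4. S k * g k) = 0" unfolding sum S' by (simp add: J_def algebra_simps)
    have "(\<Sum>k<4. g k) = J + 1 + (Q * Q - 1) + Q" using sum[of "\<lambda>_. 1"] by simp
    also have "\<dots> = Q * Q * Q + Q * Q - (Q - 1 - z)" by (simp add: J_def algebra_simps)
    also have "\<dots> \<le> Q * Q * Q + Q * Q" using z by simp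
    also have "\<dots> = int (q ^ 3 + q\<^sup>2)" by (simp add: Q_def power3_eq_cube power2_eq_square)
    finally show "(\<Sum>k<4. g k) \<le> int (q ^ 3 + q\<^sup>2)" .
  next
    fix \<sigma> assume \<sigma>: "gap_bounded 4 q \<sigma>" "(\<Sum>k<4. \<sigma> k * g k) = 0"
    have r: "\<sigma> j * ((Q - 1) * (Q * Q - 1 + Q) + z) + \<sigma> i + \<sigma> m * (Q * Q - 1) + \<sigma> l * Q = 0"
      using \<sigma>(2) unfolding sum J_def .
    have 1: "\<bar>\<sigma> a\<bar> \<le> Q" if "a < 4" for a
      using \<sigma>(1) that by (simp add: gap_bounded_def Q_def)
    have 2: "\<bar>\<sigma> a - \<sigma> b\<bar> \<le> Q" if "a < 4" "b < 4" "a \<noteq> b" for a b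
      using \<sigma>(1) that by (cases "a < b") (auto simp: gap_bounded_def Q_def abs_minus_commute)
    have 3: "\<bar>\<sigma> i - \<sigma> m + \<sigma> l\<bar> \<le> Q"
      using idx(2)
    proof
      assume "i < m \<and> m < l"
      then show ?thesis using \<sigma>(1) lt by (simp add: gap_bounded_def Q_def)
    next
      assume "l < m \<and> m < i"
      then have "\<bar>\<sigma> l - \<sigma> m + \<sigma> i\<bar> \<le> Q" using \<sigma>(1) lt by (simp add: gap_bounded_def Q_def)
      then show ?thesis by linarith
    qed
    have s: "\<sigma> i = - z * \<sigma> j \<and> \<sigma> m = - (Q - 1) * \<sigma> j \<and> \<sigma> l = - (Q - 1) * \<sigma> j"
      by (rule unit_pattern_model[OF Q z r 1 1 1 1 2 2 2 2 2 2 3]) (use lt dist in auto)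
    have "\<sigma> k = S k * \<sigma> j" if "k < 4" for k
    proof -
      have "k \<in> {j, i, m, l}" using that idx(1) by simp
      then show ?thesis using s by (elim insertE emptyE) (simp_all only: S' mult_1_left)
    qed
    then show "parallel4 \<sigma> S" unfolding parallel4_def by (simp add: mult.commute mult.left_commute)
  qed
  then show ?thesis by (simp add: soluble_def)
qed

text \<open>No coefficient reaches 2 in absolute value, so \<open>soluble_pattern_triple\<close>
  does not apply, even after negation and reversal.\<close>

lemma soluble_two_pattern:
  assumes S: "S 0 = 1" "S 1 = 1" "S 2 = - 1" "S 3 = - 1"
  shows "soluble 2 S"
proof -
  define g where "g = (\<lambda>k::nat. if k = 0 then 1 else if k = 1 then 5 else if k = 2 then 4 else 2 :: int)"
  have sum: "(\<Sum>k<4. f k * g k) = f 0 + f 1 * 5 + f 2 * 4 + f 3 * 2" for f :: "nat \<Rightarrow> int"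
    by (simp add: sum_lt4 g_def)
  have "model_gaps 2 S"
    unfolding model_gaps_def
  proof (intro exI[of _ g] conjI allI impI)
    show "0 < g k" for k by (simp add: g_def)
    show "(\<Sum>k<4. S k * g k) = 0" unfolding sum S by simp
    show "(\<Sum>k<4. g k) \<le> int (2 ^ 3 + 2\<^sup>2)" using sum[of "\<lambda>_. 1"] by simp
  next
    fix \<sigma> assume \<sigma>: "gap_bounded 4 2 \<sigma>" "(\<Sum>k<4. \<sigma> k * g k) = 0"
    define a b c d where "a = \<sigma> 0" and "b = \<sigma> 1" and "c = \<sigma> 2" and "d = \<sigma> 3"
    note defs = a_def[symmetric] b_def[symmetric] c_def[symmetric] d_def[symmetric]
    note bd = gap_bounded4[OF \<sigma>(1), unfolded defs]
    have r: "a + b * 5 + c * 4 + d * 2 = 0" using \<sigma>(2) by (simp only: sum defs)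
    have "a = b \<and> c = - b \<and> d = - b"
      by (rule two_pattern_relation[OF r bd(1-14)[unfolded of_nat_numeral]])
    then show "parallel4 \<sigma> S" unfolding parallel4_def all_lt4 defs S by simp
  qed
  then show ?thesis by (simp add: soluble_def)
qed

text \<open>A positive value of at least 2 is covered by \<open>soluble_pattern_triple\<close>. If
  it is 1 and occurs once, \<open>soluble_unit_pattern\<close> applies. If it is 1 and occurs twice,
  negation and reversal put \<open>q - 1\<close> in its place, which fails to reach 2 only for
  \<open>q = 2\<close>.\<close>

lemma soluble_pattern:
  assumes q: "2 \<le> q"
    and pat: "extremal_pattern (int q) (S 0) (S 1) (S 2) (S 3)"
  shows "soluble q S"
  using pat unfolding extremal_pattern_def
proof (elim disjE)
  assume a: "0 < S 0 \<and> S 0 = S 1 \<and> S 2 = S 3 \<and> S 2 = S 0 - int q \<and> S 2 < 0"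
  consider "2 \<le> S 0" | "S 0 = 1" "3 \<le> q" | "S 0 = 1" "q = 2" using a q by linarith
  then show ?thesis
  proof cases
    case 1
    show ?thesis by (rule soluble_pattern_triple[OF q, of 0 1 2 3]) (use 1 a in \<open>(simp; fail) | linarith\<close>)+
  next
    case 2
    have "soluble q (\<lambda>k. - S (3 - k))"
    proof (rule soluble_pattern_triple[OF q, of 0 1 2 3])
      have "S 3 = 1 - int q" "S 1 = 1" using a 2 by linarith+
      then show "2 \<le> - S (3 - 1)" "- S (3 - 2) = - S (3 - 1) - int q" "- S (3 - 3) = - S (3 - 2)" "- S (3 - 2) < 0"
        using a 2 by simp_all
    qed simp_all
    then show ?thesis by (rule soluble_rev[OF soluble_uminus])
  next
    case 3
    have "S 1 = 1" "S 2 = - 1" "S 3 = - 1" using a 3 by linarith+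
    then have "soluble 2 S" using soluble_two_pattern[of S] 3(1) by blast
    then show ?thesis using 3 by simp
  qed
next
  assume a: "0 < S 0 \<and> S 1 = S 0 - int q \<and> S 2 = S 1 \<and> S 1 < 0 \<and> S 1 \<le> S 3 \<and> S 3 \<le> 0"
  show ?thesis
  proof (cases "S 0 = 1")
    case True
    show ?thesis
    proof (rule soluble_unit_pattern[OF q, of 0 3 2 1])
      show "{0, 3, 2, 1} = {..<4::nat}" by auto
    qed (use True a q in linarith)+
  next
    case False
    show ?thesis by (rule soluble_pattern_triple[OF q, of 3 0 1 2]) (use False a in \<open>(simp; fail) | linarith\<close>)+
  qed
next
  assume a: "0 < S 0 \<and> S 2 = S 0 - int q \<and> S 3 = S 2 \<and> S 2 < 0 \<and> S 2 \<le> S 1 \<and> S 1 \<le> 0"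
  show ?thesis
  proof (cases "S 0 = 1")
    case True
    show ?thesis
    proof (rule soluble_unit_pattern[OF q, of 0 1 2 3])
      show "{0, 1, 2, 3} = {..<4::nat}" by auto
    qed (use True a q in linarith)+
  next
    case False
    show ?thesis by (rule soluble_pattern_triple[OF q, of 1 0 2 3]) (use False a in \<open>(simp; fail) | linarith\<close>)+
  qed
next
  assume a: "S 0 = 0 \<and> 0 < S 1 \<and> S 2 = S 1 - int q \<and> S 3 = S 2 \<and> S 2 < 0"
  show ?thesis
  proof (cases "S 1 = 1")
    case True
    show ?thesis
    proof (rule soluble_unit_pattern[OF q, of 1 0 2 3])
      show "{1, 0, 2, 3} = {..<4::nat}" by auto
    qed (use True a q in linarith)+
  next
    case False
    show ?thesis by (rule soluble_pattern_triple[OF q, of 0 1 2 3]) (use False a in \<open>(simp; fail) | linarith\<close>)+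
  qed
qed

lemma soluble_relation:
  assumes q: "2 \<le> q" and bd: "gap_bounded 4 q S"
    and pos: "0 < S 0 \<or> 0 < S 1 \<or> 0 < S 2 \<or> 0 < S 3" and neg: "S 0 < 0 \<or> S 1 < 0 \<or> S 2 < 0 \<or> S 3 < 0"
  shows "soluble q S"
proof -
  have zeros: "soluble q S" if "S y = 0 \<and> S z = 0" "j < 4" "y < z" "z < 4" "y \<noteq> j" "z \<noteq> j" for y z j
    using soluble_two_zeros[OF q that(2-6)] that(1) by blast
  from four_term_patterns[OF gap_bounded4[OF bd] pos neg] show ?thesis
  proof (elim disjE)
    assume "short_triple (int q) (S 0) (S 1) (S 2)"
    then show ?thesis by (rule soluble_short_triple[OF q, of 3, rotated -1]) simp_all
  next
    assume "short_triple (int q) (S 0) (S 1) (S 3)"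
    then show ?thesis by (rule soluble_short_triple[OF q, of 2, rotated -1]) simp_all
  next
    assume "short_triple (int q) (S 0) (S 2) (S 3)"
    then show ?thesis by (rule soluble_short_triple[OF q, of 1, rotated -1]) simp_all
  next
    assume "short_triple (int q) (S 1) (S 2) (S 3)"
    then show ?thesis by (rule soluble_short_triple[OF q, of 0, rotated -1]) simp_all
  next
    assume "S 0 = 0 \<and> S 1 = 0"
    then show ?thesis by (rule zeros[of _ _ 2]) simp_all
  next
    assume "S 0 = 0 \<and> S 2 = 0"
    then show ?thesis by (rule zeros[of _ _ 1]) simp_all
  next
    assume "S 0 = 0 \<and> S 3 = 0"
    then show ?thesis by (rule zeros[of _ _ 1]) simp_all
  next
    assume "S 1 = 0 \<and> S 2 = 0"
    then show ?thesis by (rule zeros[of _ _ 0]) simp_all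
  next
    assume "S 1 = 0 \<and> S 3 = 0"
    then show ?thesis by (rule zeros[of _ _ 0]) simp_all
  next
    assume "S 2 = 0 \<and> S 3 = 0"
    then show ?thesis by (rule zeros[of _ _ 0]) simp_all
  next
    assume "extremal_pattern (int q) (S 0) (S 1) (S 2) (S 3)"
    then show ?thesis by (rule soluble_pattern[OF q])
  next
    assume "extremal_pattern (int q) (S 3) (S 2) (S 1) (S 0)"
    then show ?thesis by (intro soluble_rev[OF soluble_pattern[OF q]]) simp
  next
    assume "extremal_pattern (int q) (- S 0) (- S 1) (- S 2) (- S 3)"
    then show ?thesis by (intro soluble_uminus[OF soluble_pattern[OF q]])
  next
    assume "extremal_pattern (int q) (- S 3) (- S 2) (- S 1) (- S 0)"
    then show ?thesis by (intro soluble_rev[OF soluble_uminus[OF soluble_pattern[OF q]]]) simp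
  qed
qed

section \<open>Models of four, five and more letters\<close>

lemma gap_model:
  fixes t :: "nat \<Rightarrow> real"
  assumes g: "\<And>k. k < n \<Longrightarrow> 0 < g k"
    and eq: "\<And>ps. ps \<in> rels (Suc n) q \<Longrightarrow> rel_val ps t = 0 \<longleftrightarrow> (\<Sum>k<n. gapc ps k * g k) = 0"
    and D: "(\<Sum>k<n. g k) \<le> D"
  shows "has_model n q t D"
proof -
  define s where "s = (\<lambda>i. \<Sum>k<i. g k)"
  show ?thesis
    unfolding has_model_def incr_def
  proof (intro exI[of _ s] conjI allI impI ballI)
    show "s i < s (Suc i)" if "i < n" for i using g[OF that] by (simp add: s_def)
    show "s n - s 0 \<le> D" using D by (simp add: s_def)
    fix ps assume ps: "ps \<in> rels (Suc n) q"
    have "rel_val ps s = (\<Sum>k<n. gapc ps k * g k)"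
      unfolding rel_val_gaps[OF ps] by (simp add: s_def)
    then show "rel_val ps t = 0 \<longleftrightarrow> rel_val ps s = 0" using eq[OF ps] by simp
  qed
qed

lemma kern_gaps:
  assumes "ps \<in> rels (Suc n) q" "rel_val ps t = 0" "y \<in> kern n q t"
  shows "(\<Sum>k<n. real_of_int (gapc ps k) * (y (Suc k) - y k)) = 0"
  using assms by (simp add: kern_def flip: rel_val_gaps)

lemma gap_bounded3:
  assumes "gap_bounded 3 q \<sigma>"
  shows "\<bar>\<sigma> 0\<bar> \<le> int q" "\<bar>\<sigma> 1\<bar> \<le> int q" "\<bar>\<sigma> 2\<bar> \<le> int q" "\<bar>\<sigma> 0 - \<sigma> 1\<bar> \<le> int q" "\<bar>\<sigma> 1 - \<sigma> 2\<bar> \<le> int q"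
    "\<bar>\<sigma> 0 - \<sigma> 2\<bar> \<le> int q" "\<bar>\<sigma> 0 - \<sigma> 1 + \<sigma> 2\<bar> \<le> int q"
proof -
  have 1: "\<bar>\<sigma> a\<bar> \<le> int q" if "a < 3" for a
    using assms that by (simp add: gap_bounded_def)
  have 2: "\<bar>\<sigma> a - \<sigma> b\<bar> \<le> int q" if "b < 3" "a < b" for a b
    using assms that by (simp add: gap_bounded_def)
  have 3: "\<bar>\<sigma> a - \<sigma> b + \<sigma> c\<bar> \<le> int q" if "c < 3" "b < c" "a < b" for a b c
    using assms that by (simp add: gap_bounded_def)
  show "\<bar>\<sigma> 0\<bar> \<le> int q" "\<bar>\<sigma> 1\<bar> \<le> int q" "\<bar>\<sigma> 2\<bar> \<le> int q" "\<bar>\<sigma> 0 - \<sigma> 1\<bar> \<le> int q" "\<bar>\<sigma> 1 - \<sigma> 2\<bar> \<le> int q"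
    "\<bar>\<sigma> 0 - \<sigma> 2\<bar> \<le> int q" "\<bar>\<sigma> 0 - \<sigma> 1 + \<sigma> 2\<bar> \<le> int q"
    by (rule 1 2 3; simp)+
qed

text \<open>Without nontrivial relations the gaps of \<open>generic_four\<close> work; one
  nontrivial relation already makes the kernel a plane, and \<open>model_plane\<close> gives the
  same bound.\<close>

lemma model_four:
  assumes q: "2 \<le> q" and t: "incr 3 t"
  shows "has_model 3 q t (int (q\<^sup>2 + q))"
proof (cases "\<forall>ps\<in>rels 4 q. rel_val ps t = 0 \<longrightarrow> (\<forall>k<3. gapc ps k = 0)")
  case True
  define g where "g = (\<lambda>k::nat. if k = 0 then 1 else if k = 1 then int q * int q - 1 else int q)"
  have "2 * int q \<le> int q * int q" using q by (intro mult_right_mono) auto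
  then have qq: "0 < int q * int q - 1" using q by linarith
  show ?thesis
  proof (rule gap_model)
    show "0 < g k" for k using q qq by (simp add: g_def)
    show "(\<Sum>k<3. g k) \<le> int (q\<^sup>2 + q)" by (simp add: sum_lt3 g_def power2_eq_square)
    fix ps assume "ps \<in> rels (Suc 3) q"
    then have ps: "ps \<in> rels 4 q" "ps \<in> rels (Suc 3) q" by (simp_all add: eval_nat_numeral)
    show "rel_val ps t = 0 \<longleftrightarrow> (\<Sum>k<3. gapc ps k * g k) = 0"
    proof
      assume "rel_val ps t = 0"
      then have "\<forall>k<3. gapc ps k = 0" using True ps(1) by blast
      then show "(\<Sum>k<3. gapc ps k * g k) = 0" by simp
    next
      assume "(\<Sum>k<3. gapc ps k * g k) = 0"
      then have r: "gapc ps 0 + gapc ps 1 * (int q * int q - 1) + gapc ps 2 * int q = 0"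
        unfolding sum_lt3 by (simp add: g_def)
      have q': "2 \<le> int q" using q by simp
      have "gapc ps 0 = 0 \<and> gapc ps 1 = 0 \<and> gapc ps 2 = 0"
        by (rule generic_four[OF q' r gap_bounded3[OF gap_bounded_gapc[OF ps(1)]]])
      then show "rel_val ps t = 0" unfolding rel_val_gaps[OF ps(2)] sum_lt3 by simp
    qed
  qed
next
  case False
  then obtain ps k where "ps \<in> rels 4 q" and z: "rel_val ps t = 0" and k: "k < 3" "gapc ps k \<noteq> 0" by blast
  then have ps: "ps \<in> rels (Suc 3) q" by (simp add: eval_nat_numeral)
  have "plane_kernel 3 q t"
  proof (rule plane_kernelI[of 3 q t "\<lambda>_ k. real_of_int (gapc ps k)"])
    show "(\<Sum>k<3. real_of_int (gapc ps k) * (y (Suc k) - y k)) = 0" if "y \<in> kern 3 q t" for y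
      by (rule kern_gaps[OF ps z that])
    show "c l = 0" if "\<And>k. k < 3 \<Longrightarrow> (\<Sum>l<3 - 2. c l * real_of_int (gapc ps k)) = 0" "l < 3 - 2" for c :: "nat \<Rightarrow> real" and l
      using that(1)[OF k(1)] that(2) k(2) by simp
  qed simp
  from model_plane[OF _ _ t this] have "has_model 3 q t (int (q ^ (3 - 2)) + int (q ^ (3 - 1)))"
    using q by simp
  then show ?thesis by (rule has_model_mono) simp
qed

lemma parallel4_iff:
  assumes S: "b < 4" "S b \<noteq> 0" and x: "(\<Sum>k<4. of_int (S k) * x k) = (0 :: 'a::{idom,ring_char_0})"
    and p: "parallel4 \<sigma> S"
  shows "(\<Sum>k<4. of_int (\<sigma> k) * x k) = 0"
proof -
  have "of_int (S b) * (\<Sum>k<4. of_int (\<sigma> k) * x k) = (\<Sum>k<4. of_int (\<sigma> k * S b) * x k)"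
    by (simp add: sum_distrib_left mult.assoc mult.left_commute)
  also have "\<dots> = (\<Sum>k<4. of_int (\<sigma> b * S k) * x k)"
    using p S(1) by (intro sum.cong) (auto simp: parallel4_def simp del: of_int_mult)
  also have "\<dots> = of_int (\<sigma> b) * (\<Sum>k<4. of_int (S k) * x k)"
    by (simp add: sum_distrib_left mult.assoc)
  finally show ?thesis using x S(2) by simp
qed

text \<open>The cases are the rank of the relations of \<open>t\<close>: rank 0 takes the gaps of
  \<open>generic_five\<close>, rank at least 2 gives a plane kernel, and rank 1 is settled by
  \<open>soluble_relation\<close>.\<close>

lemma model_five:
  assumes q: "2 \<le> q" and t: "incr 4 t"
  shows "has_model 4 q t (int (q ^ 3 + q\<^sup>2))"
proof (cases "\<forall>ps\<in>rels 5 q. rel_val ps t = 0 \<longrightarrow> (\<forall>k<4. gapc ps k = 0)")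
  case True
  define Q where "Q = int q"
  define g where "g = (\<lambda>k::nat. if k = 0 then 1 else if k = 1 then Q else if k = 2 then Q * Q * Q - Q - 1 else Q * Q)"
  have Q: "2 \<le> Q" using q by (simp add: Q_def)
  have "2 * Q \<le> Q * Q" using Q by (intro mult_right_mono) auto
  moreover have "2 * (Q * Q) \<le> Q * Q * Q" using Q by (simp add: mult.assoc)
  ultimately have qq: "0 < Q * Q * Q - Q - 1" using Q by linarith
  show ?thesis
  proof (rule gap_model)
    show "0 < g k" for k using Q qq by (simp add: g_def)
    show "(\<Sum>k<4. g k) \<le> int (q ^ 3 + q\<^sup>2)"
      unfolding sum_lt4 by (simp add: g_def Q_def power2_eq_square power3_eq_cube)
    fix ps assume "ps \<in> rels (Suc 4) q"
    then have ps: "ps \<in> rels 5 q" "ps \<in> rels (Suc 4) q" by (simp_all add: eval_nat_numeral)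
    show "rel_val ps t = 0 \<longleftrightarrow> (\<Sum>k<4. gapc ps k * g k) = 0"
    proof
      assume "rel_val ps t = 0"
      then have "\<forall>k<4. gapc ps k = 0" using True ps(1) by blast
      then show "(\<Sum>k<4. gapc ps k * g k) = 0" by simp
    next
      assume "(\<Sum>k<4. gapc ps k * g k) = 0"
      then have r: "gapc ps 0 + gapc ps 1 * Q + gapc ps 2 * (Q * Q * Q - Q - 1) + gapc ps 3 * (Q * Q) = 0"
        unfolding sum_lt4 by (simp add: g_def)
      have "gapc ps 0 = 0 \<and> gapc ps 1 = 0 \<and> gapc ps 2 = 0 \<and> gapc ps 3 = 0"
        by (rule generic_five[OF Q r gap_bounded4(1-10,14,13)[OF gap_bounded_gapc[OF ps(1)], folded Q_def]])
      then show "rel_val ps t = 0" unfolding rel_val_gaps[OF ps(2)] sum_lt4 by simp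
    qed
  qed
next
  case False
  have five: "rels 5 q = rels (Suc 4) q" by (simp add: eval_nat_numeral)
  obtain ps0 b where ps0: "ps0 \<in> rels (Suc 4) q" and z0: "rel_val ps0 t = 0" and b: "b < 4" "gapc ps0 b \<noteq> 0"
    using False unfolding five by blast
  define S where "S = gapc ps0"
  have Sb: "S b \<noteq> 0" using b by (simp add: S_def)
  have SV: "(\<Sum>k<4. real_of_int (S k) * (y (Suc k) - y k)) = 0" if "y \<in> kern 4 q t" for y
    unfolding S_def by (rule kern_gaps[OF ps0 z0 that])
  show ?thesis
  proof (cases "\<exists>ps\<in>rels (Suc 4) q. rel_val ps t = 0 \<and> \<not> parallel4 (gapc ps) S")
    case True
    then obtain ps where ps: "ps \<in> rels (Suc 4) q" and z: "rel_val ps t = 0" and np: "\<not> parallel4 (gapc ps) S"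
      by blast
    have "plane_kernel 4 q t"
    proof (rule plane_kernelI[of 4 q t "\<lambda>l k. if l = (0 :: nat) then real_of_int (S k) else real_of_int (gapc ps k)"])
      show "(\<Sum>k<4. (if l = 0 then real_of_int (S k) else real_of_int (gapc ps k)) * (y (Suc k) - y k)) = 0"
        if "y \<in> kern 4 q t" for l :: nat and y
        using SV[OF that] kern_gaps[OF ps z that] by (cases "l = 0") simp_all
      fix c :: "nat \<Rightarrow> real" and l :: nat
      assume c: "\<And>k. k < 4 \<Longrightarrow> (\<Sum>l<4 - 2. c l * (if l = 0 then real_of_int (S k) else real_of_int (gapc ps k))) = 0"
        and l: "l < 4 - 2"
      have c': "c 0 * real_of_int (S k) + c 1 * real_of_int (gapc ps k) = 0" if "k < 4" for k
        using c[OF that] by (simp add: eval_nat_numeral)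
      have c1: "c 1 = 0"
      proof (rule ccontr)
        assume c1: "c 1 \<noteq> 0"
        have "parallel4 (gapc ps) S"
          unfolding parallel4_def
        proof (intro allI impI)
          fix a b :: nat assume "a < 4" "b < 4"
          define A B C D where "A = real_of_int (S a)" and "B = real_of_int (S b)"
            and "C = real_of_int (gapc ps a)" and "D = real_of_int (gapc ps b)"
          have "c 0 * A + c 1 * C = 0" "c 0 * B + c 1 * D = 0"
            using c'[OF \<open>a < 4\<close>] c'[OF \<open>b < 4\<close>] by (simp_all add: A_def B_def C_def D_def)
          then have e: "c 1 * C = - c 0 * A" "c 1 * D = - c 0 * B" by simp_all
          have "c 1 * (C * B - D * A) = (c 1 * C) * B - (c 1 * D) * A" by (simp add: algebra_simps)
          also have "\<dots> = 0" unfolding e by simp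
          finally have "C * B = D * A" using c1 by simp
          then have "real_of_int (gapc ps a * S b) = real_of_int (gapc ps b * S a)"
            by (simp add: A_def B_def C_def D_def)
          then show "gapc ps a * S b = gapc ps b * S a" by (simp only: of_int_eq_iff)
        qed
        then show False using np by blast
      qed
      moreover have "c 0 = 0" using c'[OF b(1)] c1 Sb by simp
      moreover have "l = 0 \<or> l = 1" using l by auto
      ultimately show "c l = 0" by blast
    qed simp
    from model_plane[OF _ _ t this] have "has_model 4 q t (int (q ^ (4 - 2)) + int (q ^ (4 - 1)))"
      using q by simp
    then show ?thesis by (rule has_model_mono) simp
  next
    case False
    have par: "rel_val ps t = 0 \<longleftrightarrow> parallel4 (gapc ps) S" if ps: "ps \<in> rels (Suc 4) q" for ps
    proof
      assume "rel_val ps t = 0"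
      then show "parallel4 (gapc ps) S" using False ps by blast
    next
      assume "parallel4 (gapc ps) S"
      then show "rel_val ps t = 0"
        unfolding rel_val_gaps[OF ps] by (rule parallel4_iff[where S = S and b = b, OF b(1) Sb SV[OF self_kern]])
    qed
    have Sbd: "gap_bounded 4 q S" unfolding S_def by (rule gap_bounded_gapc[OF ps0])
    have tpos: "0 < t (Suc k) - t k" if "k < 4" for k using t that by (simp add: incr_def)
    \<comment> \<open>\<open>S\<close> has both signs because it annihilates the gaps of
      \<open>t\<close>, which are all positive.\<close>
    have ex: "\<exists>k<4. S k < 0" "\<exists>k<4. 0 < S k"
    proof -
      have s: "(\<Sum>k<4. real_of_int (S k) * (t (Suc k) - t k)) = 0" by (rule SV[OF self_kern])
      show "\<exists>k<4. S k < 0"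
      proof (rule ccontr)
        assume *: "\<not> ?thesis"
        have "0 < (\<Sum>k<4. real_of_int (S k) * (t (Suc k) - t k))"
        proof (rule sum_pos2[of _ b])
          have nn: "0 \<le> S k" if "k < 4" for k using * that by (meson not_less)
          have "0 < S b" using nn[OF b(1)] Sb by linarith
          then show "0 < real_of_int (S b) * (t (Suc b) - t b)"
            using tpos[OF b(1)] by (intro mult_pos_pos) auto
          show "0 \<le> real_of_int (S k) * (t (Suc k) - t k)" if "k \<in> {..<4}" for k
            using tpos[of k] nn[of k] that by (intro mult_nonneg_nonneg) auto
        qed (use b in auto)
        then show False using s by simp
      qed
      show "\<exists>k<4. 0 < S k"
      proof (rule ccontr)
        assume *: "\<not> ?thesis"
        have "0 < (\<Sum>k<4. - (real_of_int (S k) * (t (Suc k) - t k)))"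
        proof (rule sum_pos2[of _ b])
          have np: "S k \<le> 0" if "k < 4" for k using * that by (meson not_less)
          have "S b < 0" using np[OF b(1)] Sb by linarith
          then have "real_of_int (S b) < 0" by simp
          then show "0 < - (real_of_int (S b) * (t (Suc b) - t b))"
            using mult_neg_pos[OF _ tpos[OF b(1)]] by simp
          show "0 \<le> - (real_of_int (S k) * (t (Suc k) - t k))" if "k \<in> {..<4}" for k
            using tpos[of k] np[of k] that by (auto intro: mult_nonpos_nonneg)
        qed (use b in auto)
        then show False using s by (simp add: sum_negf)
      qed
    qed
    have "\<not> (\<forall>k<4. \<not> S k < 0)" "\<not> (\<forall>k<4. \<not> 0 < S k)" using ex by blast+
    then have "soluble q S" unfolding all_lt4 by (intro soluble_relation[OF q Sbd]) blast+
    then show ?thesis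
      unfolding soluble_def
    proof
      assume "model_gaps q S"
      then obtain g where g: "\<forall>k<4. 0 < g k" "(\<Sum>k<4. S k * g k) = 0" "(\<Sum>k<4. g k) \<le> int (q ^ 3 + q\<^sup>2)"
        "\<forall>\<sigma>. gap_bounded 4 q \<sigma> \<longrightarrow> (\<Sum>k<4. \<sigma> k * g k) = 0 \<longrightarrow> parallel4 \<sigma> S"
        unfolding model_gaps_def by (elim exE conjE)
      show ?thesis
      proof (rule gap_model[OF _ _ g(3)])
        show "0 < g k" if "k < 4" for k using g(1) that by blast
        fix ps assume ps: "ps \<in> rels (Suc 4) q"
        have "parallel4 (gapc ps) S \<Longrightarrow> (\<Sum>k<4. gapc ps k * g k) = 0"
          using parallel4_iff[where x = g and S = S and b = b, OF b(1) Sb] g(2) by simp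
        then show "rel_val ps t = 0 \<longleftrightarrow> (\<Sum>k<4. gapc ps k * g k) = 0"
          using par[OF ps] g(4) gap_bounded_gapc[OF ps] by blast
      qed
    next
      assume "facet_gaps q S"
      then obtain g j where g: "j < 4" "\<forall>k<4. 0 \<le> g k" "g j = 0" "(\<Sum>k<4. S k * g k) = 0" "(\<Sum>k<4. g k) \<le> int (q\<^sup>2)"
        "\<forall>\<sigma>. gap_bounded 4 q \<sigma> \<longrightarrow> (\<Sum>k<4. \<sigma> k * g k) = 0 \<longrightarrow>
          (\<forall>a<4. \<forall>b<4. a \<noteq> j \<longrightarrow> b \<noteq> j \<longrightarrow> \<sigma> a * S b = \<sigma> b * S a)"
        unfolding facet_gaps_def by (elim exE conjE)
      define u where "u = (\<lambda>i. \<Sum>k<i. g k)"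
      have us: "rel_val ps u = (\<Sum>k<4. gapc ps k * g k)" if "ps \<in> rels (Suc 4) q" for ps
        unfolding rel_val_gaps[OF that] by (simp add: u_def)
      \<comment> \<open>\<open>S\<close> has two nonzero coefficients, so one of them lies off the
        closed gap \<open>j\<close>.\<close>
      obtain d where d: "d < 4" "d \<noteq> j" "S d \<noteq> 0"
      proof -
        obtain k1 k2 where "k1 < 4" "S k1 < 0" "k2 < 4" "0 < S k2" using ex by blast
        moreover from this have "k1 \<noteq> k2" by auto
        ultimately show ?thesis using that[of k1] that[of k2] by (metis less_irrefl)
      qed
      have "has_model 4 q t (u 4 - u 0 + int (q ^ (4 - 1)))"
      proof (rule facet_lift[OF _ t])
        show "1 \<le> q" using q by simp
        show "j < 4" by (rule g)
        show "u (Suc j) = u j" using g(3) by (simp add: u_def)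
        show "u i \<le> u (Suc i)" if "i < 4" for i using g(2) that by (simp add: u_def)
        show "rel_val ps u = 0" if ps: "ps \<in> rels (Suc 4) q" and "rel_val ps t = 0" for ps
          unfolding us[OF ps] using parallel4_iff[where x = g and S = S and b = b, OF b(1) Sb] g(4) par[OF ps] that(2) by simp
        fix ps y assume ps: "ps \<in> rels (Suc 4) q" and z: "rel_val ps u = 0" and y: "y \<in> kern 4 q t"
        let ?\<sigma> = "gapc ps"
        \<comment> \<open>Subtracting \<open>?\<sigma> d\<close> times \<open>S\<close> from
          \<open>S d\<close> times the relation cancels all coefficients but the
          \<open>j\<close>-th, which becomes \<open>\<mu>\<close>. On the kernel, where
          \<open>S\<close> vanishes, the relation is thus a multiple of the \<open>j\<close>-th
          gap.\<close>
        define \<mu> where "\<mu> = real_of_int (S d * ?\<sigma> j - ?\<sigma> d * S j)"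
        have p: "?\<sigma> k * S d = ?\<sigma> d * S k" if "k < 4" "k \<noteq> j" for k
          using g(6) gap_bounded_gapc[OF ps] us[OF ps] z that d(1,2) by simp
        have val: "real_of_int (S d) * rel_val ps x = \<mu> * (x (Suc j) - x j)" if x: "x \<in> kern 4 q t" for x
        proof -
          have "real_of_int (S d) * rel_val ps x = (\<Sum>k<4. real_of_int (?\<sigma> k * S d) * (x (Suc k) - x k))"
            unfolding rel_val_gaps[OF ps] by (simp add: sum_distrib_left mult.assoc mult.left_commute)
          also have "\<dots> = (\<Sum>k<4. real_of_int (?\<sigma> d) * (real_of_int (S k) * (x (Suc k) - x k))
              + (if k = j then \<mu> * (x (Suc j) - x j) else 0))"
          proof (rule sum.cong)
            fix k assume "k \<in> {..<4::nat}"
            show "real_of_int (?\<sigma> k * S d) * (x (Suc k) - x k) =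
              real_of_int (?\<sigma> d) * (real_of_int (S k) * (x (Suc k) - x k)) + (if k = j then \<mu> * (x (Suc j) - x j) else 0)"
            proof (cases "k = j")
              case True
              then show ?thesis by (simp add: \<mu>_def algebra_simps)
            next
              case False
              then show ?thesis using p[of k] \<open>k \<in> {..<4}\<close> by (simp add: mult.assoc del: of_int_mult) simp
            qed
          qed simp
          also have "\<dots> = real_of_int (?\<sigma> d) * (\<Sum>k<4. real_of_int (S k) * (x (Suc k) - x k)) + \<mu> * (x (Suc j) - x j)"
            using g(1) by (simp add: sum.distrib sum_distrib_left)
          also have "\<dots> = \<mu> * (x (Suc j) - x j)" unfolding SV[OF x] by simp
          finally show ?thesis .
        qed
        have "real_of_int (S d) * (rel_val ps y * (t (Suc j) - t j)) = real_of_int (S d) * (rel_val ps t * (y (Suc j) - y j))"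
          using val[OF y] val[OF self_kern] by (simp add: mult.assoc[symmetric])
        then show "rel_val ps y * (t (Suc j) - t j) = rel_val ps t * (y (Suc j) - y j)" using d(3) by simp
      qed
      then show ?thesis by (rule has_model_mono) (use g(5) in \<open>simp add: u_def\<close>)
    qed
  qed
qed

text \<open>The recursion now starts at five letters. If merging leaves fewer than five, the crude
  bound 1 + q + q^2 of \<open>model_exists\<close> is still at most q^2 + q^3.\<close>

lemma model_bound:
  assumes q: "2 \<le> q"
  shows "\<lbrakk>4 \<le> n; incr n t\<rbrakk> \<Longrightarrow> has_model n q t (\<Sum>j=2..n - 1. int (q ^ j))"
proof (induction n arbitrary: t rule: less_induct)
  case (less n)
  show ?case
  proof (cases "n = 4")
    case True
    have "(\<Sum>j=2..n - 1. int (q ^ j)) = int (q ^ 3 + q\<^sup>2)" using True by (simp add: eval_nat_numeral)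
    then show ?thesis using model_five[OF q] less.prems(2) True by simp
  next
    case False
    then have n: "5 \<le> n" using less.prems by simp
    have q1: "1 \<le> q" using q by simp
    have split: "(\<Sum>j=2..n - 1. int (q ^ j)) = (\<Sum>j=2..n - 2. int (q ^ j)) + int (q ^ (n - 1))"
    proof -
      have "n - 1 = Suc (n - 2)" using n by simp
      then show ?thesis using n by simp
    qed
    show ?thesis
    proof (cases "line_kernel n q t")
      case True
      have nn: "0 \<le> (\<Sum>j=2..n - 2. int (q ^ j))" by (intro sum_nonneg) simp
      have "1 \<le> n" using n by simp
      from model_line[OF q1 this less.prems(2) True] show ?thesis
        by (rule has_model_mono) (use nn split in simp)
    next
      case False
      obtain n' z where z: "1 \<le> n'" "n' < n" "incr n' z"
        and lift: "\<forall>D. has_model n' q z D \<longrightarrow> has_model n q t (D + int (q ^ (n - 1)))"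
        using model_step[OF q1 less.prems(2) False] by blast
      have "has_model n' q z (\<Sum>j=2..n - 2. int (q ^ j))"
      proof (cases "4 \<le> n'")
        case True
        have "(\<Sum>j=2..n' - 1. int (q ^ j)) \<le> (\<Sum>j=2..n - 2. int (q ^ j))"
          using z(2) by (intro sum_mono2) auto
        then show ?thesis by (rule has_model_mono[OF less.IH[OF z(2) True z(3)]])
      next
        case False
        have "(\<Sum>j<n'. int (q ^ j)) \<le> (\<Sum>j<3. int (q ^ j))"
          using False by (intro sum_mono2) auto
        also have "\<dots> = 1 + int q + int (q ^ 2)" by (simp add: sum_lt3)
        also have "\<dots> \<le> int (q ^ 2) + int (q ^ 3)"
        proof -
          have "2 * 2 * int q \<le> int q * int q * int q" using q by (intro mult_right_mono mult_mono) auto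
          then have "1 + int q \<le> int q * int q * int q" using q by linarith
          then show ?thesis by (simp add: power3_eq_cube)
        qed
        also have "\<dots> = (\<Sum>j\<in>{2, 3}. int (q ^ j))" by simp
        also have "\<dots> \<le> (\<Sum>j=2..n - 2. int (q ^ j))" using n by (intro sum_mono2) auto
        finally show ?thesis by (rule has_model_mono[OF model_exists[OF q1 z(1) z(3)]])
      qed
      then show ?thesis using lift split by simp
    qed
  qed
qed

section \<open>Bounds for H and realization of alphabets\<close>

lemma incr_less:
  assumes "incr n s" "i < j" "j \<le> n"
  shows "s i < (s j :: 'a::order)"
  using assms(2,3)
proof (induction j)
  case (Suc j)
  have "s j < s (Suc j)" using assms(1) Suc.prems by (simp add: incr_def)
  then show ?case using Suc by (cases "i = j") (auto intro: less_trans)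
qed simp

lemma incr_le: "\<lbrakk>incr n s; i \<le> j; j \<le> n\<rbrakk> \<Longrightarrow> s i \<le> (s j :: 'a::order)"
  using incr_less[of n s i j] by (cases "i = j") auto

lemma incr_inj_on: "incr n (s :: nat \<Rightarrow> 'a::linorder) \<Longrightarrow> inj_on s {..<Suc n}"
  using incr_less[of n s] by (intro linorder_inj_onI) (auto simp: less_Suc_eq_le order_less_imp_not_eq)

lemma Min_Max_incr:
  assumes "incr n (s :: nat \<Rightarrow> int)"
  shows "Min (s ` {..<Suc n}) = s 0" "Max (s ` {..<Suc n}) = s n"
  using incr_le[OF assms] by (intro Min_eqI Max_eqI; force)+

lemma sorted_wrt_iff_incr: "length xs = Suc n \<Longrightarrow> sorted_wrt (<) (xs :: 'a::order list) \<longleftrightarrow> incr n ((!) xs)"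
  by (simp add: sorted_wrt_iff_nth_Suc_transp incr_def)

lemma rel_val_zip:
  "length is = length js \<Longrightarrow> rel_val (zip is js) x = (\<Sum>i\<leftarrow>is. x i) - (\<Sum>j\<leftarrow>js. x j)"
  by (induction "is" js rule: list_induct2) (auto simp: algebra_simps)

lemma rel_val_eq_sum_lists: "rel_val ps x = (\<Sum>i\<leftarrow>map fst ps. x i) - (\<Sum>j\<leftarrow>map snd ps. x j)"
  using rel_val_zip[of "map fst ps" "map snd ps" x] by (simp add: zip_map_fst_snd)

lemma order_preserving_model_iff:
  assumes t: "length t = Suc n" "sorted_wrt (<) t"
  shows "order_preserving_model q t s \<longleftrightarrow> length s = Suc n \<and> incr n ((!) s) \<and>
    (\<forall>ps\<in>rels (Suc n) q. rel_val ps ((!) t) = 0 \<longleftrightarrow> rel_val ps ((!) s) = 0)"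
proof (cases "length s = Suc n")
  case False
  then show ?thesis using t by (simp add: order_preserving_model_def)
next
  case True
  have "(\<forall>h is js. 1 \<le> h \<and> h \<le> q \<and> length is = h \<and> length js = h \<and>
        set is \<subseteq> {..<length t} \<and> set js \<subseteq> {..<length t} \<longrightarrow>
        ((\<Sum>i\<leftarrow>is. t ! i) = (\<Sum>j\<leftarrow>js. t ! j) \<longleftrightarrow> (\<Sum>i\<leftarrow>is. s ! i) = (\<Sum>j\<leftarrow>js. s ! j))) \<longleftrightarrow>
    (\<forall>ps\<in>rels (Suc n) q. rel_val ps ((!) t) = 0 \<longleftrightarrow> rel_val ps ((!) s) = 0)" (is "?L \<longleftrightarrow> ?R")
  proof
    assume L: ?L
    show ?R
    proof
      fix ps assume ps: "ps \<in> rels (Suc n) q"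
      show "rel_val ps ((!) t) = 0 \<longleftrightarrow> rel_val ps ((!) s) = 0"
      proof (cases "ps = []")
        case False
        have "set (map fst ps) \<subseteq> {..<length t}" "set (map snd ps) \<subseteq> {..<length t}"
          using ps t(1) by (auto simp: rels_def)
        moreover have "1 \<le> length ps" "length ps \<le> q" using False ps by (auto simp: rels_def Suc_le_eq)
        ultimately have "(\<Sum>i\<leftarrow>map fst ps. t ! i) = (\<Sum>j\<leftarrow>map snd ps. t ! j) \<longleftrightarrow>
            (\<Sum>i\<leftarrow>map fst ps. s ! i) = (\<Sum>j\<leftarrow>map snd ps. s ! j)"
          using spec[OF spec[OF spec[OF L, of "length ps"], of "map fst ps"], of "map snd ps"] by simp
        then show ?thesis by (simp only: rel_val_eq_sum_lists right_minus_eq)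
      qed simp
    qed
  next
    assume R: ?R
    show ?L
    proof (intro allI impI)
      fix h "is" js
      assume a: "1 \<le> h \<and> h \<le> q \<and> length is = h \<and> length js = h \<and>
        set is \<subseteq> {..<length t} \<and> set js \<subseteq> {..<length t}"
      then have "zip is js \<in> rels (Suc n) q"
        using t(1) by (auto simp: rels_def dest: set_zip_leftD set_zip_rightD)
      then have "rel_val (zip is js) ((!) t) = 0 \<longleftrightarrow> rel_val (zip is js) ((!) s) = 0" using R by blast
      then show "(\<Sum>i\<leftarrow>is. t ! i) = (\<Sum>j\<leftarrow>js. t ! j) \<longleftrightarrow> (\<Sum>i\<leftarrow>is. s ! i) = (\<Sum>j\<leftarrow>js. s ! j)"
        using a by (simp add: rel_val_zip)
    qed
  qed
  then show ?thesis
    using True t(1) by (simp add: order_preserving_model_def sorted_wrt_iff_incr[OF True])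
qed

lemma diameter_incr: "\<lbrakk>length s = Suc n; incr n ((!) s)\<rbrakk> \<Longrightarrow> diameter_alphabet (set s) = s ! n - s ! 0"
  using Min_Max_incr[of n "(!) s"] by (simp add: diameter_alphabet_def set_conv_nth image_def lessThan_def conj_commute)

lemma model_iff_has_model:
  assumes t: "length t = Suc n" "sorted_wrt (<) t"
  shows "(\<exists>s. order_preserving_model q t s \<and> diameter_alphabet (set s) \<le> D) \<longleftrightarrow> has_model n q ((!) t) D"
proof
  assume "\<exists>s. order_preserving_model q t s \<and> diameter_alphabet (set s) \<le> D"
  then obtain s where s: "length s = Suc n" "incr n ((!) s)"
    "\<forall>ps\<in>rels (Suc n) q. rel_val ps ((!) t) = 0 \<longleftrightarrow> rel_val ps ((!) s) = 0" "diameter_alphabet (set s) \<le> D"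
    unfolding order_preserving_model_iff[OF t] by blast
  then show "has_model n q ((!) t) D"
    unfolding has_model_def by (intro exI[of _ "(!) s"]) (simp add: diameter_incr)
next
  assume "has_model n q ((!) t) D"
  then obtain f :: "nat \<Rightarrow> int" where f: "incr n f"
    "\<forall>ps\<in>rels (Suc n) q. rel_val ps ((!) t) = 0 \<longleftrightarrow> rel_val ps f = 0" "f n - f 0 \<le> D"
    unfolding has_model_def by blast
  define s where "s = map f [0..<Suc n]"
  have nth: "s ! i = f i" if "i < Suc n" for i using that unfolding s_def by (simp del: upt_Suc)
  have len: "length s = Suc n" by (simp add: s_def)
  have inc: "incr n ((!) s)" using f(1) by (simp add: incr_def nth)
  have "rel_val ps ((!) s) = rel_val ps f" if "ps \<in> rels (Suc n) q" for ps
    by (rule rel_val_cong[of _ "Suc n"]) (use that nth in \<open>auto simp: rels_def\<close>)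
  then have "order_preserving_model q t s"
    unfolding order_preserving_model_iff[OF t] using len inc f(2) by simp
  moreover have "diameter_alphabet (set s) \<le> D" unfolding diameter_incr[OF len inc] using f(3) nth by simp
  ultimately show "\<exists>s. order_preserving_model q t s \<and> diameter_alphabet (set s) \<le> D" by blast
qed

lemma H_eq: "H (Suc n) q = (LEAST D. \<forall>t::real list. length t = Suc n \<and> sorted_wrt (<) t \<longrightarrow> has_model n q ((!) t) (int D))"
  unfolding H_def by (intro arg_cong[where f = Least] ext) (simp add: model_iff_has_model cong: imp_cong conj_cong)

lemma H_le:
  assumes "\<And>t. incr n t \<Longrightarrow> has_model n q t (int D)"
  shows "H (Suc n) q \<le> D"
  unfolding H_eq by (rule Least_le) (use assms sorted_wrt_iff_incr in blast)

lemma has_model_cong: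
  assumes "\<And>i. i \<le> n \<Longrightarrow> t i = t' i"
  shows "has_model n q t D \<longleftrightarrow> has_model n q t' D"
proof -
  have "rel_val ps t = rel_val ps t'" if "ps \<in> rels (Suc n) q" for ps
  proof (rule rel_val_cong)
    show "set ps \<subseteq> {..<Suc n} \<times> {..<Suc n}" using that by (simp add: rels_def)
    show "t i = t' i" if "i < Suc n" for i using assms that by (simp only: less_Suc_eq_le)
  qed
  then show ?thesis by (simp add: has_model_def)
qed

text \<open>The minimum is attained because \<open>model_exists\<close> gives one bound for all
  tuples.\<close>

lemma has_model_H:
  assumes q: "1 \<le> q" and n: "1 \<le> n" and t: "incr n t"
  shows "has_model n q t (int (H (Suc n) q))"
proof -
  let ?P = "\<lambda>D. \<forall>t::real list. length t = Suc n \<and> sorted_wrt (<) t \<longrightarrow> has_model n q ((!) t) (int D)"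
  have "?P (\<Sum>j<n. q ^ j)"
  proof (intro allI impI)
    fix t :: "real list" assume "length t = Suc n \<and> sorted_wrt (<) t"
    then have "incr n ((!) t)" using sorted_wrt_iff_incr by blast
    from model_exists[OF q n this] show "has_model n q ((!) t) (int (\<Sum>j<n. q ^ j))" by simp
  qed
  then have P: "?P (H (Suc n) q)" unfolding H_eq by (rule LeastI)
  define l where "l = map t [0..<Suc n]"
  have nth: "l ! i = t i" if "i < Suc n" for i using that unfolding l_def by (simp del: upt_Suc)
  have "length l = Suc n" by (simp add: l_def)
  moreover have "incr n ((!) l)" using t by (simp add: incr_def nth)
  ultimately have "has_model n q ((!) l) (int (H (Suc n) q))"
    using P sorted_wrt_iff_incr by blast
  moreover have "t i = l ! i" if "i \<le> n" for i using nth[of i] that by simp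
  ultimately show ?thesis using has_model_cong[of n t "(!) l" q] by blast
qed

section \<open>Lower bound for five letters\<close>

text \<open>The extremal tuple: \<open>q + 1\<close> is the least \<open>q\<close>-model size of \<open>(0, 1, q + 1)\<close>, and each of the last
  two letters multiplies the size by \<open>q\<close>.\<close>

lemma H_five_ge:
  assumes q: "2 \<le> q"
  shows "q\<^sup>2 * (q + 1) \<le> H 5 q"
proof -
  define Q where "Q = real q"
  define t where "t = (\<lambda>i::nat. if i = 0 then 0 else if i = 1 then 1 else if i = 2 then Q + 1
    else if i = 3 then Q * (Q + 1) else Q * (Q * (Q + 1)))"
  have rep: "rel_val (replicate k p) x = of_nat k * (x (fst p) - x (snd p))" for k p and x :: "nat \<Rightarrow> 'b::comm_ring_1"
    by (induction k) (auto simp: algebra_simps)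
  have app: "rel_val (ps @ qs) x = rel_val ps x + rel_val qs x" for ps qs and x :: "nat \<Rightarrow> 'b::comm_ring_1"
    by (induction ps) (auto simp: algebra_simps)
  obtain s :: "nat \<Rightarrow> int" where s: "incr 4 s" "\<forall>ps\<in>rels 5 q. rel_val ps t = 0 \<longleftrightarrow> rel_val ps s = 0"
    "s 4 - s 0 \<le> int (H 5 q)"
  proof -
    have Q: "2 \<le> Q" using q by (simp add: Q_def)
    have "1 * (Q + 1) < Q * (Q + 1)" using Q by (intro mult_strict_right_mono) auto
    moreover from this have "Q * (Q + 1) < Q * (Q * (Q + 1))" using Q by (intro mult_strict_left_mono) auto
    ultimately have "incr 4 t" using Q unfolding incr_def all_lt4 by (simp add: t_def)
    then have "has_model 4 q t (int (H (Suc 4) q))" using q by (intro has_model_H) auto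
    then obtain s :: "nat \<Rightarrow> int" where "incr 4 s" "s 4 - s 0 \<le> int (H (Suc 4) q)"
      "\<forall>ps\<in>rels (Suc 4) q. rel_val ps t = 0 \<longleftrightarrow> rel_val ps s = 0"
      unfolding has_model_def by blast
    moreover have "Suc 4 = (5 :: nat)" by simp
    ultimately show ?thesis using that by metis
  qed
  have step: "s (Suc i) - s 0 = int q * (s i - s 0)" if i: "i = 2 \<or> i = 3" for i
  proof -
    \<comment> \<open>In letters, this is \<open>q\<close> times letter \<open>i\<close> equal to
      letter \<open>Suc i\<close> plus \<open>q - 1\<close> times letter 0, a relation of length
      exactly \<open>q\<close>.\<close>
    let ?ps = "(i, Suc i) # replicate (q - 1) (i, 0)"
    have "?ps \<in> rels 5 q" using q i by (auto simp: rels_def)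
    moreover have "rel_val ?ps t = 0"
    proof -
      have "t (Suc i) = Q * t i" using i by (auto simp: t_def)
      moreover have "rel_val ?ps t = t i - t (Suc i) + (Q - 1) * t i"
        using q by (simp add: rep of_nat_diff Q_def t_def)
      ultimately show ?thesis by (simp add: algebra_simps)
    qed
    ultimately have "rel_val ?ps s = 0" using s(2) by blast
    moreover have "rel_val ?ps s = s i - s (Suc i) + (int q - 1) * (s i - s 0)"
      using q by (simp add: rep of_nat_diff)
    ultimately show ?thesis by (simp add: algebra_simps)
  qed
  define a d where "a = nat (s 1 - s 0)" and "d = nat (s 2 - s 0)"
  have ad: "int a = s 1 - s 0" "int d = s 2 - s 0" "0 < a" "a < d"
    using incr_less[OF s(1), of 0 1] incr_less[OF s(1), of 1 2] by (auto simp: a_def d_def)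
  have "q < d"
  proof (rule ccontr)
    assume "\<not> q < d"
    \<comment> \<open>For any integers \<open>a < d\<close> the letters 0, \<open>a\<close>,
      \<open>d\<close> satisfy this relation of length \<open>d\<close>. For 0, 1, q + 1 it would
      mean \<open>d = a (q + 1)\<close>, which \<open>d \<le> q\<close> excludes.\<close>
    let ?ps = "replicate a (1, 2) @ replicate (d - a) (1, 0)"
    have "?ps \<in> rels 5 q" using \<open>\<not> q < d\<close> ad by (auto simp: rels_def)
    moreover have "rel_val ?ps s = 0"
    proof -
      have "rel_val ?ps s = int a * (int a - int d) + (int d - int a) * int a"
        unfolding app rep using ad by (simp add: of_nat_diff)
      then show ?thesis by (simp add: algebra_simps)
    qed
    ultimately have "rel_val ?ps t = 0" using s(2) by blast
    moreover have "rel_val ?ps t = real d - real a * (Q + 1)"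
      unfolding app rep using ad(4) by (simp add: t_def of_nat_diff algebra_simps)
    ultimately have "real d = real a * (Q + 1)" by simp
    moreover have "1 * (Q + 1) \<le> real a * (Q + 1)" using ad by (intro mult_right_mono) (auto simp: Q_def)
    ultimately have "Q + 1 \<le> real d" by (simp only: mult_1_left)
    then show False using \<open>\<not> q < d\<close> by (simp add: Q_def)
  qed
  have "int (q\<^sup>2 * (q + 1)) \<le> int q * (int q * int d)"
  proof -
    have "q * (q * (q + 1)) \<le> q * (q * d)" using \<open>q < d\<close> by (intro mult_le_mono) auto
    then have "int (q * (q * (q + 1))) \<le> int (q * (q * d))" by (simp only: of_nat_le_iff)
    then show ?thesis by (simp add: power2_eq_square mult.assoc distrib_left)
  qed
  also have "\<dots> = s 4 - s 0"
    using step[of 2] step[of 3] ad(2) by simp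
  finally show ?thesis using s(3) by linarith
qed

section \<open>Additive squares and integer models of alphabets\<close>

text \<open>The two blocks of a square in a word of length at most \<open>2 * q + 1\<close> have
  length at most \<open>q\<close>, so their equality of sums is a relation in
  \<open>rels m q\<close>, obtained by zipping them.\<close>

lemma additive_square_map:
  assumes eq: "\<And>ps. ps \<in> rels m q \<Longrightarrow> rel_val ps f = 0 \<longleftrightarrow> rel_val ps g = 0"
    and w: "set w \<subseteq> {..<m}" "length w \<le> 2 * q + 1"
  shows "additive_square (map f w) \<longleftrightarrow> additive_square (map g w)"
proof -
  have split: "additive_square (map h w) \<longleftrightarrow> (\<exists>u v. w = u @ v \<and> u \<noteq> [] \<and> length u = length v \<and>
      rel_val (zip u v) h = 0)" for h :: "nat \<Rightarrow> 'c::ab_group_add"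
  proof
    assume "additive_square (map h w)"
    then obtain u' v' where "map h w = u' @ v'" and uv: "u' \<noteq> []" "length u' = length v'" "sum_list u' = sum_list v'"
      unfolding additive_square_def by blast
    then obtain u v where "w = u @ v" "u' = map h u" "v' = map h v" by (auto simp: map_eq_append_conv)
    then show "\<exists>u v. w = u @ v \<and> u \<noteq> [] \<and> length u = length v \<and> rel_val (zip u v) h = 0"
      using uv by (intro exI[of _ u] exI[of _ v]) (simp add: rel_val_zip)
  next
    assume "\<exists>u v. w = u @ v \<and> u \<noteq> [] \<and> length u = length v \<and> rel_val (zip u v) h = 0"
    then obtain u v where uv: "w = u @ v" "u \<noteq> []" "length u = length v" "rel_val (zip u v) h = 0" by blast
    show "additive_square (map h w)"
      unfolding additive_square_def
      by (intro exI[of _ "map h u"] exI[of _ "map h v"]) (use uv in \<open>simp add: rel_val_zip\<close>)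
  qed
  have "rel_val (zip u v) f = 0 \<longleftrightarrow> rel_val (zip u v) g = 0" if "w = u @ v" "length u = length v" for u v
  proof (rule eq)
    have "length u \<le> q" using that w(2) by simp
    moreover have "set u \<subseteq> {..<m}" "set v \<subseteq> {..<m}" using that(1) w(1) by auto
    ultimately show "zip u v \<in> rels m q" by (auto simp: rels_def dest: set_zip_leftD set_zip_rightD)
  qed
  then show ?thesis unfolding split by blast
qed

lemma additive_square_free_map:
  assumes eq: "\<And>ps. ps \<in> rels m q \<Longrightarrow> rel_val ps f = 0 \<longleftrightarrow> rel_val ps g = 0"
    and w: "set w \<subseteq> {..<m}" "length w \<le> 2 * q + 1"
    and free: "additive_square_free (map f w)"
  shows "additive_square_free (map g w)"
  unfolding additive_square_free_def
proof (intro allI impI)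
  fix x assume "sublist x (map g w)"
  then obtain y where y: "sublist y w" "x = map g y" using sublist_map_rightE by blast
  have "\<not> additive_square (map f y)"
  proof -
    obtain ps ss where "w = ps @ y @ ss" using y(1) unfolding sublist_def by blast
    then have "map f w = map f ps @ map f y @ map f ss" by simp
    then have "sublist (map f y) (map f w)" unfolding sublist_def by blast
    then show ?thesis using free unfolding additive_square_free_def by blast
  qed
  moreover have "set y \<subseteq> {..<m}" "length y \<le> 2 * q + 1"
    using y(1) w sublist_length_le[OF y(1)] by (auto simp: sublist_def)
  ultimately show "\<not> additive_square x"
    unfolding y(2) using additive_square_map[OF eq] by blast
qed

text \<open>Words are taken over the indices, so that two alphabets can be compared on the same
  words.\<close>

definition free_lengths :: "nat \<Rightarrow> (nat \<Rightarrow> 'a::monoid_add) \<Rightarrow> nat set" where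
  "free_lengths m f = {length w |w. set w \<subseteq> {..<m} \<and> additive_square_free (map f w)}"

lemma mem_free_lengths:
  "k \<in> free_lengths m f \<longleftrightarrow> (\<exists>w. length w = k \<and> set w \<subseteq> {..<m} \<and> additive_square_free (map f w))"
  unfolding free_lengths_def by auto

lemma asf_length_image: "asf_length (f ` {..<m}) = (SUP k\<in>free_lengths m f. enat k)"
proof -
  have "(\<lambda>w. enat (length w)) ` {w. set w \<subseteq> f ` {..<m} \<and> additive_square_free w} = enat ` free_lengths m f"
  proof (rule Set.set_eqI, rule iffI)
    fix x assume "x \<in> (\<lambda>w. enat (length w)) ` {w. set w \<subseteq> f ` {..<m} \<and> additive_square_free w}"
    then obtain w where w: "x = enat (length w)" "set w \<subseteq> f ` {..<m}" "additive_square_free w" by blast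
    then have "w \<in> lists (f ` {..<m})" by auto
    then obtain v where "v \<in> lists {..<m}" "w = map f v" unfolding lists_image by blast
    then show "x \<in> enat ` free_lengths m f"
      using w by (intro image_eqI[of _ _ "length v"]) (auto simp: mem_free_lengths)
  next
    fix x assume "x \<in> enat ` free_lengths m f"
    then obtain w where "x = enat (length w)" "set w \<subseteq> {..<m}" "additive_square_free (map f w)"
      by (auto simp: mem_free_lengths)
    then show "x \<in> (\<lambda>w. enat (length w)) ` {w. set w \<subseteq> f ` {..<m} \<and> additive_square_free w}"
      by (intro image_eqI[of _ _ "map f w"]) auto
  qed
  then show ?thesis unfolding asf_length_def by simp
qed

lemma free_lengths_down:
  assumes "k \<in> free_lengths m f" "l \<le> k"
  shows "l \<in> free_lengths m f"
proof -
  obtain w where w: "length w = k" "set w \<subseteq> {..<m}" "additive_square_free (map f w)"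
    using assms(1) unfolding mem_free_lengths by blast
  have "sublist (map f (take l w)) (map f w)"
    unfolding take_map[symmetric] by (rule sublist_take)
  then have "additive_square_free (map f (take l w))"
    using w(3) unfolding additive_square_free_def by (meson sublist_order.order_trans)
  moreover have "length (take l w) = l" "set (take l w) \<subseteq> {..<m}"
    using w assms(2) set_take_subset[of l w] by auto
  ultimately show ?thesis unfolding mem_free_lengths by blast
qed

text \<open>Words of length at most \<open>L\<close> transfer both ways, also for odd
  \<open>L\<close>. As \<open>L\<close> is not the length of a free word for \<open>f\<close>, it is
  none for \<open>g\<close>; a longer free word for \<open>g\<close> would have a free prefix of
  length \<open>L\<close>.\<close>

lemma asf_length_eq:
  fixes f :: "nat \<Rightarrow> 'a::ab_group_add" and g :: "nat \<Rightarrow> 'b::ab_group_add"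
  assumes eq: "\<And>ps. ps \<in> rels m (L div 2) \<Longrightarrow> rel_val ps f = 0 \<longleftrightarrow> rel_val ps g = 0"
    and fin: "asf_length (f ` {..<m}) < enat L"
  shows "asf_length (g ` {..<m}) = asf_length (f ` {..<m})"
proof -
  have L: "L \<le> 2 * (L div 2) + 1" by simp
  have lt: "k < L" if "k \<in> free_lengths m f" for k
  proof -
    have "enat k \<le> asf_length (f ` {..<m})"
      unfolding asf_length_image using that by (rule SUP_upper)
    then show ?thesis using fin by (metis enat_ord_simps(2) le_less_trans)
  qed
  have fg: "k \<in> free_lengths m g" if k: "k \<in> free_lengths m f" "k \<le> L" for k
  proof -
    obtain w where w: "length w = k" "set w \<subseteq> {..<m}" "additive_square_free (map f w)"
      using k(1) unfolding mem_free_lengths by blast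
    have "additive_square_free (map g w)"
      by (rule additive_square_free_map[where q = "L div 2", OF eq w(2) _ w(3)]) (use w(1) k(2) L in linarith)+
    then show ?thesis using w unfolding mem_free_lengths by blast
  qed
  have gf: "k \<in> free_lengths m f" if k: "k \<in> free_lengths m g" "k \<le> L" for k
  proof -
    obtain w where w: "length w = k" "set w \<subseteq> {..<m}" "additive_square_free (map g w)"
      using k(1) unfolding mem_free_lengths by blast
    have "additive_square_free (map f w)"
      by (rule additive_square_free_map[where q = "L div 2", OF eq[symmetric] w(2) _ w(3)]) (use w(1) k(2) L in linarith)+
    then show ?thesis using w unfolding mem_free_lengths by blast
  qed
  have "k \<le> L" if "k \<in> free_lengths m g" for k
  proof (rule ccontr)
    assume "\<not> k \<le> L"
    then have "L \<in> free_lengths m g" using free_lengths_down[OF that] by simp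
    then show False using gf[of L] lt[of L] by simp
  qed
  then have "free_lengths m g = free_lengths m f" using fg gf lt by (meson less_imp_le subsetI subset_antisym)
  then show ?thesis unfolding asf_length_image by simp
qed

text \<open>Translating the smallest letter to 0 and dividing by the gcd \<open>d\<close> only
  rescales the values of relations and does not increase the diameter.\<close>

lemma primitive_model:
  assumes n: "1 \<le> n" and "has_model n q t D"
  obtains s :: "nat \<Rightarrow> int" where "incr n s" "\<And>ps. ps \<in> rels (Suc n) q \<Longrightarrow> rel_val ps t = 0 \<longleftrightarrow> rel_val ps s = 0"
    "s n - s 0 \<le> D" "primitive_alphabet (s ` {..<Suc n})"
proof -
  obtain s0 :: "nat \<Rightarrow> int" where s0: "incr n s0" "\<And>ps. ps \<in> rels (Suc n) q \<Longrightarrow> rel_val ps t = 0 \<longleftrightarrow> rel_val ps s0 = 0"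
    "s0 n - s0 0 \<le> D"
    using assms(2) unfolding has_model_def by blast
  define d where "d = Gcd ((\<lambda>i. s0 i - s0 0) ` {..<Suc n})"
  define s where "s = (\<lambda>i. (s0 i - s0 0) div d)"
  have ds: "d * s i = s0 i - s0 0" if "i < Suc n" for i
    unfolding s_def by (rule dvd_mult_div_cancel) (use that in \<open>auto simp: d_def intro: Gcd_dvd\<close>)
  have pos: "0 < s0 n - s0 0" using incr_less[OF s0(1), of 0 n] n by simp
  have "d \<noteq> 0" using ds[of n] pos by auto
  moreover have "0 \<le> d" by (simp add: d_def)
  ultimately have d: "0 < d" by simp
  have rel: "rel_val ps s0 = d * rel_val ps s" if "ps \<in> rels (Suc n) q" for ps
  proof -
    have sub: "set ps \<subseteq> {..<Suc n} \<times> {..<Suc n}" using that by (simp add: rels_def)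
    have "rel_val ps s0 = rel_val ps (\<lambda>i. d * s i + s0 0)"
      by (rule rel_val_cong[OF sub]) (use ds in simp)
    also have "\<dots> = d * rel_val ps s"
      unfolding rel_val_add rel_val_scale by (simp add: rel_val_const[OF sub, of "\<lambda>i. s0 0" "s0 0"])
    finally show ?thesis .
  qed
  have inc: "incr n s"
    unfolding incr_def
  proof (intro allI impI)
    fix i assume i: "i < n"
    have "d * s i < d * s (Suc i)" using ds[of i] ds[of "Suc i"] i s0(1) by (simp add: incr_def)
    then show "s i < s (Suc i)" using d by simp
  qed
  have s00: "s 0 = 0" by (simp add: s_def)
  show ?thesis
  proof (rule that[OF inc])
    show "rel_val ps t = 0 \<longleftrightarrow> rel_val ps s = 0" if "ps \<in> rels (Suc n) q" for ps
      using s0(2)[OF that] rel[OF that] d by simp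
    have "0 < s n" using incr_less[OF inc, of 0 n] n s00 by simp
    then have "1 * s n \<le> d * s n" using d by (intro mult_right_mono) auto
    then show "s n - s 0 \<le> D" using ds[of n] s0(3) s00 by simp
    have "(*) d ` s ` {..<Suc n} = (\<lambda>i. s0 i - s0 0) ` {..<Suc n}"
      unfolding image_image using ds by (intro image_cong) auto
    then have "d = normalize (d * Gcd (s ` {..<Suc n}))"
      using Gcd_mult[of d "s ` {..<Suc n}"] by (simp add: d_def)
    then have "d * 1 = d * Gcd (s ` {..<Suc n})" using d by (simp add: abs_mult)
    then have "Gcd (s ` {..<Suc n}) = 1" using d by simp
    then show "primitive_alphabet (s ` {..<Suc n})"
      unfolding primitive_alphabet_def Min_Max_incr(1)[OF inc] s00 by simp
  qed
qed

lemma enumerate_alphabet: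
  fixes T :: "'a::linorder set"
  assumes "card T = Suc n"
  obtains t where "incr n t" "T = t ` {..<Suc n}"
proof -
  have fin: "finite T" using assms card.infinite by fastforce
  let ?l = "sorted_list_of_set T"
  have len: "length ?l = Suc n" using assms by simp
  have "sorted_wrt (<) ?l" by (rule strict_sorted_list_of_set)
  then have "incr n ((!) ?l)" using sorted_wrt_iff_incr[OF len] by blast
  moreover have "T = (!) ?l ` {..<Suc n}"
    using fin set_sorted_list_of_set[OF fin] len by (auto simp: set_conv_nth)
  ultimately show ?thesis using that by blast
qed

lemma realize_integer:
  fixes T :: "real set"
  assumes n: "1 \<le> n" and T: "card T = Suc n" "asf_length T < enat L"
    and D: "\<And>t. incr n t \<Longrightarrow> has_model n (L div 2) t D"
  shows "\<exists>T'::int set. card T' = Suc n \<and> primitive_alphabet T' \<and> asf_length T' = asf_length T \<and>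
    diameter_alphabet T' \<le> D"
proof -
  obtain t where t: "incr n t" "T = t ` {..<Suc n}" using enumerate_alphabet[OF T(1)] .
  obtain s where s: "incr n s" "\<And>ps. ps \<in> rels (Suc n) (L div 2) \<Longrightarrow> rel_val ps t = 0 \<longleftrightarrow> rel_val ps s = 0"
    "s n - s 0 \<le> D" "primitive_alphabet (s ` {..<Suc n})"
    using primitive_model[OF n D[OF t(1)]] by blast
  show ?thesis
  proof (intro exI[of _ "s ` {..<Suc n}"] conjI)
    show "card (s ` {..<Suc n}) = Suc n" using card_image[OF incr_inj_on[OF s(1)]] by simp
    show "asf_length (s ` {..<Suc n}) = asf_length T"
      unfolding t(2) by (rule asf_length_eq[OF s(2) T(2)[unfolded t(2)]])
    show "diameter_alphabet (s ` {..<Suc n}) \<le> D"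
      unfolding diameter_alphabet_def Min_Max_incr[OF s(1)] by (rule s(3))
  qed (rule s(4))
qed

lemma spectra_eq:
  assumes "1 \<le> n"
  shows "real_finite_spectrum (Suc n) = int_finite_spectrum (Suc n)"
proof (rule Set.set_eqI, rule iffI)
  fix k assume "k \<in> real_finite_spectrum (Suc n)"
  then obtain T :: "real set" where T: "card T = Suc n" "asf_length T = enat k"
    unfolding real_finite_spectrum_def by blast
  \<comment> \<open>\<open>k + 1\<close> would exceed \<open>k\<close> as well, but
    \<open>L div 2\<close> must be at least 1 even for \<open>k = 0\<close>.\<close>
  define L where "L = k + 2"
  have lt: "asf_length T < enat L" using T(2) by (simp add: L_def)
  have "\<exists>T'::int set. card T' = Suc n \<and> primitive_alphabet T' \<and> asf_length T' = asf_length T \<and>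
      diameter_alphabet T' \<le> (\<Sum>j<n. int ((L div 2) ^ j))"
  proof (rule realize_integer[OF assms T(1) lt])
    fix t :: "nat \<Rightarrow> real" assume "incr n t"
    then show "has_model n (L div 2) t (\<Sum>j<n. int ((L div 2) ^ j))"
      by (intro model_exists assms) (simp_all add: L_def)
  qed
  then obtain T' :: "int set" where T': "card T' = Suc n" "asf_length T' = asf_length T" by blast
  moreover have "finite T'" using T'(1) card.infinite by fastforce
  ultimately have "finite T' \<and> card T' = Suc n \<and> asf_length T' = enat k" using T(2) by simp
  then show "k \<in> int_finite_spectrum (Suc n)" unfolding int_finite_spectrum_def by blast
next
  fix k assume "k \<in> int_finite_spectrum (Suc n)"
  then obtain T :: "int set" where T: "card T = Suc n" "asf_length T = enat k"
    unfolding int_finite_spectrum_def by blast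
  obtain t where t: "incr n t" "T = t ` {..<Suc n}" using enumerate_alphabet[OF T(1)] .
  let ?s = "\<lambda>i. real_of_int (t i)"
  have inc: "incr n ?s" using t(1) by (simp add: incr_def)
  have "asf_length (?s ` {..<Suc n}) = asf_length (t ` {..<Suc n})"
  proof (rule asf_length_eq[of _ "Suc k"])
    show "asf_length (t ` {..<Suc n}) < enat (Suc k)" using T t(2) by simp
  qed (simp add: rel_val_of_int)
  moreover have "card (?s ` {..<Suc n}) = Suc n" using card_image[OF incr_inj_on[OF inc]] by simp
  ultimately have "finite (?s ` {..<Suc n}) \<and> card (?s ` {..<Suc n}) = Suc n \<and> asf_length (?s ` {..<Suc n}) = enat k"
    using T(2) t(2) by simp
  then show "k \<in> real_finite_spectrum (Suc n)" unfolding real_finite_spectrum_def by blast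
qed

theorem proposition11p2:
  shows
    "(real_finite_spectrum 4 = int_finite_spectrum 4 \<and>
      (\<forall>L::nat. L \<ge> 4 \<longrightarrow>
        (\<forall>T::real set. card T = 4 \<and> asf_length T < enat L \<longrightarrow>
          (\<exists>T'::int set. card T' = 4 \<and> primitive_alphabet T' \<and> asf_length T' = asf_length T \<and>
             diameter_alphabet T' \<le> int ((L div 2) * (L div 2 + 1))))))
     \<and>
     ((\<forall>m::nat. m \<ge> 2 \<longrightarrow>
        real_finite_spectrum m = int_finite_spectrum m \<and>
        (\<forall>L::nat. L \<ge> 4 \<longrightarrow>
          (\<forall>T::real set. card T = m \<and> asf_length T < enat L \<longrightarrow>
            (\<exists>T'::int set. card T' = m \<and> primitive_alphabet T' \<and> asf_length T' = asf_length T \<and>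
               diameter_alphabet T' \<le> int (H m (L div 2)))))) \<and>
      (\<forall>L::nat. L \<ge> 4 \<longrightarrow> H 5 (L div 2) = (L div 2)\<^sup>2 * (L div 2 + 1)) \<and>
      (\<forall>m L::nat. m \<ge> 5 \<and> L \<ge> 4 \<longrightarrow> H m (L div 2) \<le> (\<Sum>j=2..m-2. (L div 2) ^ j)))"
proof (intro conjI allI impI)
  show "real_finite_spectrum 4 = int_finite_spectrum 4"
    using spectra_eq[of 3] by simp
next
  fix L :: nat and T :: "real set"
  assume L: "4 \<le> L" and T: "card T = 4 \<and> asf_length T < enat L"
  have "2 \<le> L div 2" using L by simp
  then have "has_model 3 (L div 2) t (int ((L div 2) * (L div 2 + 1)))" if "incr 3 t" for t
    using model_four[of "L div 2", OF _ that] by (simp add: power2_eq_square add.commute)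
  then have "\<exists>T'::int set. card T' = Suc 3 \<and> primitive_alphabet T' \<and> asf_length T' = asf_length T \<and>
      diameter_alphabet T' \<le> int ((L div 2) * (L div 2 + 1))"
    by (rule realize_integer[rotated 3]) (use T in simp_all)
  then show "\<exists>T'::int set. card T' = 4 \<and> primitive_alphabet T' \<and> asf_length T' = asf_length T \<and>
      diameter_alphabet T' \<le> int ((L div 2) * (L div 2 + 1))" by simp
next
  fix m :: nat assume "2 \<le> m"
  then have "1 \<le> m - 1" "Suc (m - 1) = m" by simp_all
  then show "real_finite_spectrum m = int_finite_spectrum m"
    using spectra_eq[of "m - 1"] by metis
next
  fix m L :: nat and T :: "real set"
  assume m: "2 \<le> m" and L: "4 \<le> L" and T: "card T = m \<and> asf_length T < enat L"
  have m': "1 \<le> m - 1" "Suc (m - 1) = m" using m by simp_all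
  have "1 \<le> L div 2" using L by simp
  then have "has_model (m - 1) (L div 2) t (int (H m (L div 2)))" if "incr (m - 1) t" for t
    using has_model_H[OF _ m'(1) that, of "L div 2"] unfolding m'(2) by blast
  then have "\<exists>T'::int set. card T' = Suc (m - 1) \<and> primitive_alphabet T' \<and> asf_length T' = asf_length T \<and>
      diameter_alphabet T' \<le> int (H m (L div 2))"
    by (rule realize_integer[rotated 3]) (use T m' in simp_all)
  then show "\<exists>T'::int set. card T' = m \<and> primitive_alphabet T' \<and> asf_length T' = asf_length T \<and>
      diameter_alphabet T' \<le> int (H m (L div 2))" unfolding m'(2) .
next
  fix L :: nat assume "4 \<le> L"
  then have q: "2 \<le> L div 2" by simp
  have "has_model 4 (L div 2) t (int ((L div 2)\<^sup>2 * (L div 2 + 1)))" if "incr 4 t" for t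
    using model_five[OF q that] by (simp add: power2_eq_square power3_eq_cube distrib_left add.commute)
  then have "H (Suc 4) (L div 2) \<le> (L div 2)\<^sup>2 * (L div 2 + 1)" by (rule H_le)
  then have "H 5 (L div 2) \<le> (L div 2)\<^sup>2 * (L div 2 + 1)" by simp
  then show "H 5 (L div 2) = (L div 2)\<^sup>2 * (L div 2 + 1)"
    using H_five_ge[OF q] by (rule antisym)
next
  fix m L :: nat assume mL: "5 \<le> m \<and> 4 \<le> L"
  then have "5 \<le> m" "4 \<le> L" by blast+
  then have q: "2 \<le> L div 2" and m: "4 \<le> m - 1" "m - 1 - 1 = m - 2" "Suc (m - 1) = m" by simp_all
  have "has_model (m - 1) (L div 2) t (int (\<Sum>j=2..m - 2. (L div 2) ^ j))" if "incr (m - 1) t" for t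
    using model_bound[OF q m(1) that] unfolding m(2) of_nat_sum .
  then have "H (Suc (m - 1)) (L div 2) \<le> (\<Sum>j=2..m - 2. (L div 2) ^ j)" by (rule H_le)
  then show "H m (L div 2) \<le> (\<Sum>j=2..m - 2. (L div 2) ^ j)" unfolding m(3) .
qed

end
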